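(* Every 3-connected non-complete planar graph is degree-truncated $16$-choosable.
   Context: Graphs are finite and simple. A list assignment of a graph $G$ is a mapping $L$ assigning to each vertex $v$ a set $L(v)$ of permissible colours. An $L$-colouring of $G$ is a mapping $\phi$ with $\phi(v)\in L(v)$ for every vertex $v$ and $\phi(u)\neq\phi(v)$ for every edge $uv$; $G$ is $L$-colourable if it has an $L$-colouring. For a positive integer $k$, $G$ is degree-truncated $k$-choosable if $G$ is $L$-colourable for every list assignment $L$ with $|L(v)|\ge \min\{k,d_G(v)\}$ for every vertex $v$, where $d_G(v)$ is the degree of $v$ in $G$. *)

theory Defs
  imports "HOL-Analysis.Analysis" "Graph_Theory.Graph_Theory"
begin

text \<open>
  A finite simple graph is a pre-digraph satisfying the locale predicate \<^term>\<open>graph\<close>: finite,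
  loop-free, without parallel arcs, and symmetric. An undirected edge \<open>uv\<close> is thus a pair of
  opposite arcs, and the degree of a vertex in the undirected sense is its \<^const>\<open>out_degree\<close>.
\<close>

text \<open>
  \<^const>\<open>Digraph_Component.connected\<close> is connectedness of graphs (and is false for the null graph);
  it has to be qualified because of the topological notion of the same name.
\<close>

definition k_connected :: "nat \<Rightarrow> ('a, 'b) pre_digraph \<Rightarrow> bool" where
  "k_connected k G \<longleftrightarrow>
     k < card (verts G) \<and>
     (\<forall>S \<subseteq> verts G. card S < k \<longrightarrow> Digraph_Component.connected (G \<restriction> (verts G - S)))"

definition complete_graph :: "('a, 'b) pre_digraph \<Rightarrow> bool" where
  "complete_graph G \<longleftrightarrow> complete_digraph (card (verts G)) G"

text \<open>
  Drawings in the plane: \<open>p\<close> places the vertices and \<open>\<gamma> {u, v}\<close> is the simple arc drawn for the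
  undirected edge \<open>uv\<close>. Indexing by \<open>{u, v}\<close> gives both opposite arcs of the digraph the same
  curve, whose orientation is irrelevant.
\<close>

definition plane_drawing ::
  "('a, 'b) pre_digraph \<Rightarrow> ('a \<Rightarrow> complex) \<Rightarrow> ('a set \<Rightarrow> real \<Rightarrow> complex) \<Rightarrow> bool" where
  "plane_drawing G p \<gamma> \<longleftrightarrow>
     inj_on p (verts G) \<and>
     (\<forall>u v. u \<rightarrow>\<^bsub>G\<^esub> v \<longrightarrow>
        arc (\<gamma> {u, v}) \<and>
        {pathstart (\<gamma> {u, v}), pathfinish (\<gamma> {u, v})} = {p u, p v} \<and>
        path_image (\<gamma> {u, v}) \<inter> p ` verts G = {p u, p v}) \<and>
     (\<forall>u v x y. u \<rightarrow>\<^bsub>G\<^esub> v \<longrightarrow> x \<rightarrow>\<^bsub>G\<^esub> y \<longrightarrow> {u, v} \<noteq> {x, y} \<longrightarrow>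
        path_image (\<gamma> {u, v}) \<inter> path_image (\<gamma> {x, y}) \<subseteq> p ` ({u, v} \<inter> {x, y}))"

definition planar :: "('a, 'b) pre_digraph \<Rightarrow> bool" where
  "planar G \<longleftrightarrow> (\<exists>p \<gamma>. plane_drawing G p \<gamma>)"

definition list_colouring ::
  "('a, 'b) pre_digraph \<Rightarrow> ('a \<Rightarrow> 'c set) \<Rightarrow> ('a \<Rightarrow> 'c) \<Rightarrow> bool" where
  "list_colouring G L \<phi> \<longleftrightarrow>
     (\<forall>v \<in> verts G. \<phi> v \<in> L v) \<and> (\<forall>u v. u \<rightarrow>\<^bsub>G\<^esub> v \<longrightarrow> \<phi> u \<noteq> \<phi> v)"

definition list_colourable :: "('a, 'b) pre_digraph \<Rightarrow> ('a \<Rightarrow> 'c set) \<Rightarrow> bool" where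
  "list_colourable G L \<longleftrightarrow> (\<exists>\<phi>. list_colouring G L \<phi>)"

text \<open>
  The type of colours is a parameter, so that a theorem polymorphic in \<open>'c\<close> covers lists of
  colours of any kind. An infinite list is larger than any number, whereas its \<^const>\<open>card\<close> is 0;
  hence the cardinality condition is only imposed on finite lists.
\<close>

definition degree_truncated_choosable ::
  "'c itself \<Rightarrow> nat \<Rightarrow> ('a, 'b) pre_digraph \<Rightarrow> bool" where
  "degree_truncated_choosable (_ :: 'c itself) k G \<longleftrightarrow>
     (\<forall>L :: 'a \<Rightarrow> 'c set.
        (\<forall>v \<in> verts G. finite (L v) \<longrightarrow> min k (out_degree G v) \<le> card (L v)) \<longrightarrow>
        list_colourable G L)"

end

theory Submission
  imports Defs
begin

text \<open>
  Let \<open>B\<close> be the set of vertices of degree at least 16. The vertices of \<open>B\<close> are coloured first, along a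
  5-degenerate order; a component (\<^emph>\<open>piece\<close>) \<open>Q\<close> of the rest can be completed as soon as one of its
  vertices has a spare colour, or two remaining lists in an end of \<open>Q\<close> (a leaf block without its cut
  vertex) disagree, or an end is neither a clique nor of degree at most 2. A neighbour \<open>a \<in> B\<close> of \<open>Q\<close>
  \<^emph>\<open>saves\<close> \<open>Q\<close> by avoiding at most 5 colours, whatever happens later. If every piece has three such
  neighbours, then, because a bipartite planar graph on \<open>n\<close> vertices has at most \<open>2n - 4\<close> edges, Hall's
  theorem assigns the pieces to savers so that each vertex saves at most two of them; as
  \<open>5 + 2 \<cdot> 5 < 16\<close>, the greedy colouring succeeds.

  Candidates are the last three neighbours of the ends of \<open>Q\<close>. Trouble arises only if all ends see just two
  vertices \<open>a, b\<close> of \<open>B\<close>. Then \<open>K\<^sub>3\<^sub>,\<^sub>3\<close> shows that no component \<open>D\<close> of \<open>G - Q - {a, b}\<close> is adjacent to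
  both \<open>a\<close> and \<open>b\<close>. Hence either \<open>Q\<close> is the only piece adjacent to one of \<open>a, b\<close>, which can then save it, or
  there are several such \<open>D\<close> and the order can be chosen such that one of them comes after \<open>a\<close> and \<open>b\<close>;
  the last neighbour of \<open>Q\<close>, which always saves \<open>Q\<close>, is then a third saver.

  Contractions are avoided on the topological side by proving Euler's inequality directly for arcs between
  disjoint compact connected sets that do not separate the plane.
\<close>

text \<open>The obstacle is that \<open>B\<close> is coloured greedily: a saver has to fix its
  forbidden colours knowing only the earlier vertices, and the effect must survive every later
  choice. This is where the constant 5 comes from. As there is no \<open>K\<^sub>5\<close>, an end
  of an uncolourable piece has degree at most 3 in \<open>Q\<close>; as a candidate \<open>a\<close>
  is among the last three, at most three neighbours of a vertex of the end are still to be coloured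
  when the turn of \<open>a\<close> comes. A remaining list of more than 6 colours thus keeps a
  spare colour in any case, and of at most 6 colours one need not be forbidden because it also lies
  in another list of the end. The order has to meet two demands, few earlier neighbours and a chosen
  side after \<open>a\<close> and \<open>b\<close>. They are compatible because a side sees at most
  one of \<open>a\<close> and \<open>b\<close>: the average degree of planar graphs leaves room for
  one foreign vertex, but not for two. The demands of different pieces do not block each other in a
  circle, because all chosen sides avoid one common root.\<close>

hide_const (open) Digraph_Component.connected

section \<open>Arcs and separation in the plane\<close>

text \<open>Deleting an inner point of an arc leaves two relatively closed pieces, whereas a disc
  minus a point is connected. Three points of the disc are taken so that the middle one has another
  on either side.\<close>

lemma interior_arc_image:
  fixes h :: "real \<Rightarrow> complex"
  assumes "arc h"
  shows "interior (path_image h) = {}"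
proof (rule ccontr)
  assume "interior (path_image h) \<noteq> {}"
  then obtain x r where r: "r > 0" "ball x r \<subseteq> path_image h"
    by (metis all_not_in_conv mem_interior)
  have "infinite (ball x r)"
    using r(1) by (simp add: uncountable_ball uncountable_infinite)
  then obtain F where F: "F \<subseteq> ball x r" "finite F" "card F = 3"
    by (meson infinite_arbitrarily_large)
  have contg: "continuous_on {0..1} h" and inj: "inj_on h {0..1}"
    using assms by (auto simp: arc_def path_def)
  have sub: "F \<subseteq> h ` {0..1}" using F(1) r(2) unfolding path_image_def by (rule order_trans)
  define T where "T = {t \<in> {0..1}. h t \<in> F}"
  have hT: "h ` T = F" using sub unfolding T_def by blast
  have injT: "inj_on h T" by (rule inj_on_subset[OF inj]) (auto simp: T_def)
  have cardT: "card T = 3" using card_image[OF injT] hT F by simp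
  then have finT: "finite T" by (metis card.infinite zero_neq_numeral)
  define t1 where "t1 = Min T"
  define t3 where "t3 = Max T"
  have "T \<noteq> {}" using cardT by auto
  have t13: "t1 \<in> T" "t3 \<in> T" using \<open>T \<noteq> {}\<close> finT by (auto simp: t1_def t3_def)
  have "\<not> T \<subseteq> {t1, t3}"
  proof
    assume "T \<subseteq> {t1,t3}"
    then have "card T \<le> card {t1,t3}" by (rule card_mono[rotated]) simp
    also have "\<dots> \<le> 2" by (simp add: card_insert_if)
    finally show False using cardT by simp
  qed
  then obtain t where t: "t \<in> T" "t \<noteq> t1" "t \<noteq> t3" by auto
  have lt: "t1 < t" "t < t3"
    using t finT by (auto simp: t1_def t3_def order_less_le)
  have b: "0 \<le> t1" "t3 \<le> 1" "0 \<le> t" "t \<le> 1" using t13 t by (auto simp: T_def)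
  have cl: "closed (h ` {0..t})" "closed (h ` {t..1})"
    using b by (auto intro!: compact_imp_closed compact_continuous_image continuous_on_subset[OF contg])
  have "connected (ball x r - {h t})"
    by (rule connected_open_delete) auto
  moreover have "ball x r - {h t} \<subseteq> h ` {0..t} \<union> h ` {t..1}"
    using r(2) b by (force simp: path_image_def)
  moreover have "h ` {0..t} \<inter> h ` {t..1} \<inter> (ball x r - {h t}) = {}"
  proof -
    have "h u = h t" if "u \<in> {0..t}" "v \<in> {t..1}" "h u = h v" for u v
      using inj_onD[OF inj that(3)] that b by force
    then show ?thesis by fastforce
  qed
  moreover have "h ` {0..t} \<inter> (ball x r - {h t}) \<noteq> {}"
  proof -
    have "h t1 \<noteq> h t" using inj_onD[OF inj, of t1 t] lt b by auto
    moreover have "h t1 \<in> h ` {0..t}" using lt b by auto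
    ultimately show ?thesis using t13 F(1) by (auto simp: T_def)
  qed
  moreover have "h ` {t..1} \<inter> (ball x r - {h t}) \<noteq> {}"
  proof -
    have "h t3 \<noteq> h t" using inj_onD[OF inj, of t3 t] lt b by auto
    moreover have "h t3 \<in> h ` {t..1}" using lt b by auto
    ultimately show ?thesis using t13 F(1) by (auto simp: T_def)
  qed
  ultimately show False
    using cl unfolding connected_closed by blast
qed

text \<open>A transversal of some of the faces. Its size bounds the number of faces from below, so
  components of the complement never have to be counted.\<close>

definition separated_points :: "complex set \<Rightarrow> complex set \<Rightarrow> bool" where
  "separated_points K Z \<longleftrightarrow> finite Z \<and> Z \<subseteq> - K \<and>
     (\<forall>z\<in>Z. \<forall>z'\<in>Z. z \<noteq> z' \<longrightarrow> \<not> connected_component (- K) z z')"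

text \<open>A representative may lie on the new arc. It is then moved within its old face, which is
  open and hence not covered by an arc.\<close>

lemma separated_points_add_arc:
  assumes "closed K" "arc h" "separated_points K Z"
  obtains Z' where "separated_points (K \<union> path_image h) Z'" "card Z' = card Z"
    "\<And>z'. z' \<in> Z' \<Longrightarrow> \<exists>z\<in>Z. connected_component (- K) z z'"
    "\<And>z z'. z \<in> Z' \<Longrightarrow> z' \<in> Z' \<Longrightarrow> connected_component (- K) z z' \<Longrightarrow> z = z'"
proof -
  have "\<exists>z'. connected_component (- K) z z' \<and> z' \<notin> path_image h" if "z \<in> Z" for z
  proof (rule ccontr)
    assume H: "\<not> ?thesis"
    have "open (connected_component_set (- K) z)"
      using assms(1) by (simp add: open_connected_component open_Compl)
    moreover have "connected_component_set (- K) z \<subseteq> path_image h" using H by auto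
    ultimately have "connected_component_set (- K) z \<subseteq> interior (path_image h)"
      by (rule interior_maximal[rotated])
    then have "connected_component_set (- K) z = {}"
      using interior_arc_image[OF assms(2)] by blast
    moreover have "z \<in> - K" using assms(3) that by (auto simp: separated_points_def)
    then have "connected_component (- K) z z" by (rule connected_component_refl)
    ultimately show False by blast
  qed
  then obtain f where f: "\<And>z. z \<in> Z \<Longrightarrow> connected_component (- K) z (f z) \<and> f z \<notin> path_image h"
    by metis
  have eq: "z = z'" if "z \<in> Z" "z' \<in> Z" "connected_component (- K) (f z) (f z')" for z z'
  proof -
    have "connected_component (- K) z z'"
      using f that by (meson connected_component_sym connected_component_trans)
    then show ?thesis using assms(3) that by (auto simp: separated_points_def)
  qed
  have nK: "f z \<notin> K" if "z \<in> Z" for z using f[OF that] connected_component_in by blast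
  have "inj_on f Z"
    by (rule inj_onI) (metis eq nK connected_component_refl ComplI)
  show ?thesis
  proof (rule that[of "f ` Z"])
    show "card (f ` Z) = card Z" using \<open>inj_on f Z\<close> by (rule card_image)
    show "separated_points (K \<union> path_image h) (f ` Z)"
      unfolding separated_points_def
    proof (intro conjI ballI impI)
      show "finite (f ` Z)" using assms(3) by (simp add: separated_points_def)
      show "f ` Z \<subseteq> - (K \<union> path_image h)" using nK f by auto
      fix u v assume uv: "u \<in> f ` Z" "v \<in> f ` Z" "u \<noteq> v"
      show "\<not> connected_component (- (K \<union> path_image h)) u v"
      proof
        assume "connected_component (- (K \<union> path_image h)) u v"
        then have "connected_component (- K) u v"
          by (rule connected_component_of_subset) auto
        then show False using uv eq by auto
      qed
    qed
  qed (use f eq in auto)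
qed

text \<open>\<open>h\<close> and \<open>q\<close> form a Jordan curve. An inner point of
  \<open>h\<close> is a limit of both sides of the curve, and a disc about it that avoids
  \<open>K\<close> contains a point of each: these are joined in the disc but separated by the
  curve.\<close>

lemma arc_closing_loop_separates:
  fixes h q :: "real \<Rightarrow> complex"
  assumes K: "closed K" and h: "arc h" and q: "arc q" "path_image q \<subseteq> K"
    and ends: "pathstart q = pathfinish h" "pathfinish q = pathstart h"
    and hK: "path_image h \<inter> K \<subseteq> {pathstart h, pathfinish h}"
  obtains p r where "p \<notin> K" "p \<notin> path_image h" "r \<notin> K" "r \<notin> path_image h"
    "connected_component (- K) p r" "\<not> connected_component (- (K \<union> path_image h)) p r"
proof -
  define c where "c = h +++ q"
  have c: "simple_path c" "pathfinish c = pathstart c"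
    using simple_path_join_loop[OF h q(1)] ends hK q(2) by (auto simp: c_def)
  have pc: "path_image c = path_image h \<union> path_image q"
    unfolding c_def by (rule path_image_join) (use ends in simp)
  note J = Jordan_inside_outside[OF c]
  obtain z where z: "z \<in> path_image h" "z \<notin> {pathstart h, pathfinish h}"
    using nonempty_simple_path_endless[OF arc_imp_simple_path[OF h]] by auto
  then have "z \<notin> K" using hK by auto
  then obtain d where d: "d > 0" "ball z d \<subseteq> - K"
    using K by (metis ComplI open_Compl open_contains_ball)
  have "z \<in> frontier (inside (path_image c))" "z \<in> frontier (outside (path_image c))"
    using J z(1) pc by auto
  then have "z \<in> closure (inside (path_image c))" "z \<in> closure (outside (path_image c))"
    by (auto simp: frontier_def)
  then obtain p r where p: "p \<in> inside (path_image c)" "p \<in> ball z d"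
    and r: "r \<in> outside (path_image c)" "r \<in> ball z d"
    using d(1) by (metis closure_approachable dist_commute mem_ball)
  show ?thesis
  proof (rule that)
    show "p \<notin> K" "r \<notin> K" using p r d by auto
    show "p \<notin> path_image h" "r \<notin> path_image h"
      using p(1) r(1) pc inside_no_overlap[of "path_image c"] outside_no_overlap[of "path_image c"] by blast+
    show "connected_component (- K) p r"
      using p(2) r(2) d(2) unfolding connected_component_def
      by (intro exI[of _ "ball z d"]) auto
    show "\<not> connected_component (- (K \<union> path_image h)) p r"
    proof
      assume "connected_component (- (K \<union> path_image h)) p r"
      then obtain T where T: "connected T" "T \<subseteq> - (K \<union> path_image h)" "p \<in> T" "r \<in> T"
        by (auto simp: connected_component_def)
      have "T \<subseteq> - path_image c" using T(2) pc q(2) by auto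
      then have "T \<subseteq> inside (path_image c) \<union> outside (path_image c)" using J by auto
      then show False
        using T p(1) r(1) J connectedD[OF T(1), of "inside (path_image c)" "outside (path_image c)"]
        by blast
    qed
  qed
qed

text \<open>At most one representative (the set \<open>N\<close>) lies in the face that
  \<open>h\<close> splits. It is dropped and the two points separated by \<open>h\<close> are added,
  a net gain of at least one.\<close>

lemma separated_points_add_loop_arc:
  fixes h q :: "real \<Rightarrow> complex"
  assumes K: "closed K" and h: "arc h" and q: "arc q" "path_image q \<subseteq> K"
    and ends: "pathstart q = pathfinish h" "pathfinish q = pathstart h"
    and hK: "path_image h \<inter> K \<subseteq> {pathstart h, pathfinish h}"
    and Z: "separated_points K Z"
  obtains Z' where "separated_points (K \<union> path_image h) Z'" "card Z < card Z'"
proof -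
  obtain Y where Y: "separated_points (K \<union> path_image h) Y" "card Y = card Z"
    and Y1: "\<And>z z'. z \<in> Y \<Longrightarrow> z' \<in> Y \<Longrightarrow> connected_component (- K) z z' \<Longrightarrow> z = z'"
    using separated_points_add_arc[OF K h Z] by metis
  obtain p r where pr: "p \<notin> K" "p \<notin> path_image h" "r \<notin> K" "r \<notin> path_image h"
    "connected_component (- K) p r" "\<not> connected_component (- (K \<union> path_image h)) p r"
    using arc_closing_loop_separates[OF K h q ends hK] by metis
  define N where "N = {z \<in> Y. connected_component (- K) p z}"
  have "card N \<le> 1"
  proof -
    have "z = z'" if "z \<in> N" "z' \<in> N" for z z'
      using that Y1 unfolding N_def by (metis (mono_tags) connected_component_sym connected_component_trans mem_Collect_eq)
    then show ?thesis
      using card_le_Suc0_iff_eq[of N] Y(1) by (auto simp: N_def separated_points_def)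
  qed
  have mono: "connected_component (- K) x y" if "connected_component (- (K \<union> path_image h)) x y" for x y
    using that by (rule connected_component_of_subset) auto
  have far: "\<not> connected_component (- (K \<union> path_image h)) x z"
    "\<not> connected_component (- (K \<union> path_image h)) z x" if "x = p \<or> x = r" "z \<in> Y - N" for x z
    using that pr(5) mono unfolding N_def
    by (metis (mono_tags) DiffD1 DiffD2 connected_component_sym connected_component_trans mem_Collect_eq)+
  have "\<forall>z\<in>Y - N. \<not> connected_component (- (K \<union> path_image h)) p z \<and>
      \<not> connected_component (- (K \<union> path_image h)) r z \<and>
      \<not> connected_component (- (K \<union> path_image h)) z p \<and>
      \<not> connected_component (- (K \<union> path_image h)) z r"
    using far by blast
  moreover have "\<not> connected_component (- (K \<union> path_image h)) r p"
    using pr(6) connected_component_sym by blast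
  ultimately have sep: "\<not> connected_component (- (K \<union> path_image h)) r p"
    "\<forall>z\<in>Y - N. \<not> connected_component (- (K \<union> path_image h)) p z \<and>
      \<not> connected_component (- (K \<union> path_image h)) r z \<and>
      \<not> connected_component (- (K \<union> path_image h)) z p \<and>
      \<not> connected_component (- (K \<union> path_image h)) z r"
    by blast+
  have "p \<noteq> r" using pr by (metis ComplI UnE connected_component_refl)
  have pY: "p \<notin> Y - N" "r \<notin> Y - N" using pr unfolding N_def by (auto simp: connected_component_refl)
  have fin: "finite Y" using Y(1) by (simp add: separated_points_def)
  show ?thesis
  proof (rule that[of "insert p (insert r (Y - N))"])
    show "separated_points (K \<union> path_image h) (insert p (insert r (Y - N)))"
      unfolding separated_points_def
    proof (intro conjI ballI impI)
      fix u v assume "u \<in> insert p (insert r (Y - N))" "v \<in> insert p (insert r (Y - N))" "u \<noteq> v"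
      then show "\<not> connected_component (- (K \<union> path_image h)) u v"
        using sep pr(6) Y(1) unfolding separated_points_def by blast
    qed (use Y(1) pr fin in \<open>auto simp: separated_points_def\<close>)
    have "card (Y - N) = card Y - card N"
      by (rule card_Diff_subset) (use fin in \<open>auto simp: N_def intro: finite_subset\<close>)
    moreover have "card N \<le> card Y" by (rule card_mono[OF fin]) (auto simp: N_def)
    ultimately show "card Z < card (insert p (insert r (Y - N)))"
      using \<open>card N \<le> 1\<close> Y(2) \<open>p \<noteq> r\<close> pY fin by simp
  qed
qed

text \<open>Janiszewski's theorem is applied twice: the arc meets \<open>K1\<close> in one point,
  and \<open>K1\<close> with the arc attached meets \<open>K2\<close> in one point, so both
  intersections are connected.\<close>

lemma bridge_arc_not_separating:
  fixes h :: "real \<Rightarrow> complex"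
  assumes "compact K1" "compact K2" "K1 \<inter> K2 = {}" "arc h"
    and "path_image h \<inter> K1 = {x}" "path_image h \<inter> K2 = {y}"
    and ab: "connected_component (- (K1 \<union> K2)) a b" "a \<notin> path_image h" "b \<notin> path_image h"
  shows "connected_component (- (K1 \<union> K2 \<union> path_image h)) a b"
proof -
  have cl: "closed K1" "closed K2" "closed (path_image h)" "compact (path_image h)"
    using assms by (auto simp: compact_imp_closed closed_arc_image compact_arc_image)
  have a1: "connected_component (- K1) a b" "connected_component (- K2) a b"
    using ab(1) by (auto elim!: connected_component_of_subset)
  have ah: "connected_component (- path_image h) a b"
    using connected_arc_complement[OF assms(4)] ab(2,3)
    by (simp add: connected_iff_connected_component)
  have "connected_component (- (K1 \<union> path_image h)) a b"
    using Janiszewski[OF assms(1) cl(3) _ a1(1) ah] assms(5) by (simp add: Int_commute)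
  then have "connected_component (- ((K1 \<union> path_image h) \<union> K2)) a b"
  proof (intro Janiszewski[of "K1 \<union> path_image h" K2])
    have "(K1 \<union> path_image h) \<inter> K2 = {y}" using assms(3,6) by auto
    then show "connected ((K1 \<union> path_image h) \<inter> K2)" by simp
  qed (use a1 assms cl in auto)
  then show ?thesis by (simp add: Un_ac)
qed

text \<open>Janiszewski's theorem applies to the loop and to \<open>K\<close>, since they meet in the connected set
  \<open>path_image q\<close>.\<close>
lemma same_side_of_loop_not_separated:
  fixes h q :: "real \<Rightarrow> complex"
  assumes K: "closed K" and h: "arc h" and q: "arc q" "path_image q \<subseteq> K"
    and ends: "pathstart q = pathfinish h" "pathfinish q = pathstart h"
    and hK: "path_image h \<inter> K \<subseteq> {pathstart h, pathfinish h}"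
    and ab: "connected_component (- K) a b"
      "connected_component (- (path_image h \<union> path_image q)) a b"
  shows "connected_component (- (K \<union> path_image h)) a b"
proof -
  have "(path_image h \<union> path_image q) \<inter> K = path_image q"
    using hK q(2) ends pathstart_in_path_image[of q] pathfinish_in_path_image[of q] by auto
  then have "connected_component (- ((path_image h \<union> path_image q) \<union> K)) a b"
    by (intro Janiszewski[of "path_image h \<union> path_image q" K])
      (use K ab h q in \<open>auto simp: compact_arc_image connected_arc_image\<close>)
  moreover have "path_image h \<union> path_image q \<union> K = K \<union> path_image h" using q(2) by auto
  ultimately show ?thesis by simp
qed

section \<open>Euler's inequality for systems of disjoint sets and arcs\<close>

text \<open>Path-connectedness of the nodes allows an arc between nodes that are already joined to
  be closed to a loop inside the part drawn so far; \<open>connected_compl_P\<close> says that a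
  node encloses no face of its own. As \<open>E\<close> consists of unordered pairs, there are no
  parallel edges.\<close>

locale arc_system =
  fixes I :: "'i set" and E :: "'i set set"
    and P :: "'i \<Rightarrow> complex set" and g :: "'i set \<Rightarrow> real \<Rightarrow> complex"
  assumes finite_I: "finite I"
    and compact_P: "i \<in> I \<Longrightarrow> compact (P i)"
    and path_connected_P: "i \<in> I \<Longrightarrow> path_connected (P i)"
    and connected_compl_P: "i \<in> I \<Longrightarrow> connected (- P i)"
    and disjoint_P: "i \<in> I \<Longrightarrow> j \<in> I \<Longrightarrow> i \<noteq> j \<Longrightarrow> P i \<inter> P j = {}"
    and edge: "e \<in> E \<Longrightarrow> \<exists>i j. i \<in> I \<and> j \<in> I \<and> i \<noteq> j \<and> e = {i, j} \<and>
        pathstart (g e) \<in> P i \<and> pathfinish (g e) \<in> P j"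
    and arc_g: "e \<in> E \<Longrightarrow> arc (g e)"
    and hit: "e \<in> E \<Longrightarrow> path_image (g e) \<inter> \<Union> (P ` I) \<subseteq> {pathstart (g e), pathfinish (g e)}"
    and cross: "e \<in> E \<Longrightarrow> e' \<in> E \<Longrightarrow> e \<noteq> e' \<Longrightarrow>
        path_image (g e) \<inter> path_image (g e') \<subseteq> \<Union> (P ` I)"
begin

definition K :: "'i set set \<Rightarrow> complex set" where
  "K F = \<Union> (P ` I) \<union> (\<Union>e\<in>F. path_image (g e))"

definition oarc :: "'i set \<Rightarrow> complex set" where
  "oarc e = path_image (g e) - {pathstart (g e), pathfinish (g e)}"

lemma edge_subset: "e \<in> E \<Longrightarrow> e \<subseteq> I"
  using edge by blast

lemma finite_E: "finite E"
  by (rule finite_subset[of _ "Pow I"]) (use edge_subset finite_I in auto)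

lemma K_insert: "K (insert e F) = K F \<union> path_image (g e)"
  by (auto simp: K_def)

lemma K_mono: "F \<subseteq> F' \<Longrightarrow> K F \<subseteq> K F'"
  by (auto simp: K_def)

lemma compact_K: "F \<subseteq> E \<Longrightarrow> compact (K F)"
  unfolding K_def using finite_subset[OF _ finite_E]
  by (intro compact_Un compact_UN) (auto simp: finite_I compact_P arc_g compact_arc_image)

lemma closed_K: "F \<subseteq> E \<Longrightarrow> closed (K F)"
  by (simp add: compact_K compact_imp_closed)

lemma ends_in_P:
  assumes "e \<in> E"
  shows "pathstart (g e) \<in> \<Union> (P ` I)" "pathfinish (g e) \<in> \<Union> (P ` I)"
  using edge[OF assms] by auto

lemma arc_Int_K:
  assumes "e \<in> E" "F \<subseteq> E" "e \<notin> F"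
  shows "path_image (g e) \<inter> K F \<subseteq> {pathstart (g e), pathfinish (g e)}"
proof
  fix x assume x: "x \<in> path_image (g e) \<inter> K F"
  have "x \<in> \<Union> (P ` I)"
  proof (cases "x \<in> \<Union> (P ` I)")
    case False
    then obtain e' where "e' \<in> F" "x \<in> path_image (g e')" using x by (auto simp: K_def)
    then show ?thesis using cross[OF assms(1), of e'] assms x by blast
  qed
  then show "x \<in> {pathstart (g e), pathfinish (g e)}" using hit[OF assms(1)] x by blast
qed

lemma oarc_Int_K: "e \<in> E \<Longrightarrow> F \<subseteq> E \<Longrightarrow> e \<notin> F \<Longrightarrow> oarc e \<inter> K F = {}"
  using arc_Int_K[of e F] unfolding oarc_def by blast

lemma oarc_nonempty: "e \<in> E \<Longrightarrow> oarc e \<noteq> {}"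
  unfolding oarc_def by (intro nonempty_simple_path_endless arc_imp_simple_path arc_g)

lemma connected_oarc: "e \<in> E \<Longrightarrow> connected (oarc e)"
  unfolding oarc_def by (intro connected_simple_path_endless arc_imp_simple_path arc_g)

lemma joining_arc:
  assumes "e \<in> E" "path_component (K F) (pathstart (g e)) (pathfinish (g e))"
  obtains q where "arc q" "path_image q \<subseteq> K F" "pathstart q = pathfinish (g e)"
    "pathfinish q = pathstart (g e)"
proof -
  have ne: "pathstart (g e) \<noteq> pathfinish (g e)"
  proof -
    obtain i j where "i \<in> I" "j \<in> I" "i \<noteq> j" "pathstart (g e) \<in> P i" "pathfinish (g e) \<in> P j"
      using edge[OF assms(1)] by auto
    then show ?thesis using disjoint_P[of i j] by auto
  qed
  have "path_component (K F) (pathfinish (g e)) (pathstart (g e))"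
    using assms(2) by (rule path_component_sym)
  then obtain p where p: "path p" "path_image p \<subseteq> K F" "pathstart p = pathfinish (g e)"
    "pathfinish p = pathstart (g e)"
    unfolding path_component_def by blast
  obtain q where q: "arc q" "path_image q \<subseteq> path_image p" "pathstart q = pathfinish (g e)"
    "pathfinish q = pathstart (g e)"
    using path_contains_arc[OF p(1,3,4)] ne by metis
  show ?thesis
    by (rule that[of q]) (use p q in auto)
qed

lemma path_component_P:
  "i \<in> I \<Longrightarrow> x \<in> P i \<Longrightarrow> y \<in> P i \<Longrightarrow> path_component (K F) x y"
  by (rule path_component_of_subset[of "P i"])
    (use path_connected_P in \<open>auto simp: K_def path_connected_component\<close>)

text \<open>\<open>f\<close> labels the connected components of the part of the system drawn so far.\<close>
lemma many_faces:
  assumes "F \<subseteq> E"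
  shows "\<exists>Z (f :: 'i \<Rightarrow> 'i). separated_points (K F) Z \<and>
    card F + 1 + card (f ` I) \<le> card Z + card I \<and>
    (\<forall>i\<in>I. \<forall>j\<in>I. f i = f j \<longrightarrow> (\<forall>x\<in>P i. \<forall>y\<in>P j. path_component (K F) x y))"
proof -
  have "finite F" using assms finite_E finite_subset by blast
  then show ?thesis using assms
  proof (induction F)
    case empty
    have "bounded (K {})" by (simp add: compact_K compact_imp_bounded)
    then have "K {} \<noteq> UNIV" using not_bounded_UNIV by metis
    then obtain z where "z \<notin> K {}" by auto
    then have "separated_points (K {}) {z}" by (simp add: separated_points_def)
    then show ?case
      using path_component_P by (intro exI[of _ "{z}"] exI[of _ id]) auto
  next
    case (insert e F)
    then have e: "e \<in> E" and F: "F \<subseteq> E" by auto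
    obtain Z and f :: "'i \<Rightarrow> 'i" where
      Zf: "separated_points (K F) Z" "card F + 1 + card (f ` I) \<le> card Z + card I"
      and f0: "\<forall>i\<in>I. \<forall>j\<in>I. f i = f j \<longrightarrow> (\<forall>x\<in>P i. \<forall>y\<in>P j. path_component (K F) x y)"
      using insert.IH[OF F] by (elim exE conjE)
    have f: "path_component (K F) x y"
      if "i \<in> I" "j \<in> I" "f i = f j" "x \<in> P i" "y \<in> P j" for i j x y
      using f0 that by simp
    obtain i j where ij: "i \<in> I" "j \<in> I" "i \<noteq> j" "e = {i, j}"
      "pathstart (g e) \<in> P i" "pathfinish (g e) \<in> P j"
      using edge[OF e] by blast
    note f' = f[THEN path_component_of_subset[OF K_mono[OF subset_insertI]]]
    note hK = arc_Int_K[OF e F insert.hyps(2)]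
    \<comment> \<open>If the labels agree, the arc closes a loop and creates a face; if they differ,
      two labels are merged and no face is lost. Both preserve the Euler count.\<close>
    show ?case
    proof (cases "f i = f j")
      case True
      have "path_component (K F) (pathstart (g e)) (pathfinish (g e))"
        using f[OF ij(1,2) True ij(5,6)] .
      then obtain q where q: "arc q" "path_image q \<subseteq> K F" "pathstart q = pathfinish (g e)"
        "pathfinish q = pathstart (g e)"
        using joining_arc[OF e] by metis
      obtain Z' where "separated_points (K F \<union> path_image (g e)) Z'" "card Z < card Z'"
        using separated_points_add_loop_arc[OF closed_K[OF F] arc_g[OF e] q hK Zf(1)] by metis
      moreover from this have "card (insert e F) + 1 + card (f ` I) \<le> card Z' + card I"
        using Zf(2) insert.hyps by simp
      ultimately show ?thesis
        by (intro exI[of _ Z'] exI[of _ f] conjI ballI impI) (simp_all only: K_insert f'[unfolded K_insert])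
    next
      case False
      obtain Z' where Z': "separated_points (K F \<union> path_image (g e)) Z'" "card Z' = card Z"
        using separated_points_add_arc[OF closed_K[OF F] arc_g[OF e] Zf(1)] by metis
      define f1 where "f1 = (\<lambda>k. if f k = f j then f i else f k)"
      have "f1 ` I \<subseteq> f ` I - {f j}" using ij False by (auto simp: f1_def)
      then have "card (f1 ` I) \<le> card (f ` I - {f j})" by (intro card_mono) (simp_all add: finite_I)
      also have "\<dots> < card (f ` I)" using ij finite_I by (intro psubset_card_mono) auto
      finally have c: "card (f1 ` I) < card (f ` I)" .
      let ?C = "path_component (K (insert e F))"
      have "path_image (g e) \<subseteq> K (insert e F)" by (auto simp: K_insert)
      then have st: "?C (pathstart (g e)) (pathfinish (g e))"
        using arc_imp_path[OF arc_g[OF e]] unfolding path_component_def by blast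
      have mix: "?C x y" if "k \<in> I" "l \<in> I" "x \<in> P k" "y \<in> P l" "f k = f i" "f l = f j" for k l x y
        using f'[OF that(1) ij(1) that(5) that(3) ij(5)] st f'[OF ij(2) that(2) that(6)[symmetric] ij(6) that(4)]
        by (meson path_component_trans)
      have "?C x y" if "k \<in> I" "l \<in> I" "x \<in> P k" "y \<in> P l" "f1 k = f1 l" for k l x y
      proof -
        note kl = that
        consider "f k = f l" | "f k = f i" "f l = f j" | "f k = f j" "f l = f i"
          using kl(5) by (auto simp: f1_def split: if_splits)
        then show ?thesis
          using f'[OF kl(1,2) _ kl(3,4)] mix[OF kl(1-4)] mix[OF kl(2,1,4,3)]
          by cases (auto intro: path_component_sym)
      qed
      moreover have "card (insert e F) + 1 + card (f1 ` I) \<le> card Z' + card I"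
        using Zf(2) Z'(2) c insert.hyps by simp
      moreover have "separated_points (K (insert e F)) Z'" using Z'(1) by (simp only: K_insert)
      ultimately show ?thesis by (intro exI[of _ Z'] exI[of _ f1] conjI ballI impI)
    qed
  qed
qed

section \<open>Bridges and leaves\<close>

definition K_on :: "'i set \<Rightarrow> 'i set set \<Rightarrow> complex set" where
  "K_on J F = \<Union> (P ` J) \<union> (\<Union>e\<in>{e\<in>F. e \<subseteq> J}. path_image (g e))"

lemma K_on_Int_P:
  assumes "J \<subseteq> I" "F \<subseteq> E" "x \<in> K_on J F" "x \<in> P k" "k \<in> I"
  shows "k \<in> J"
proof -
  consider j where "j \<in> J" "x \<in> P j" | e where "e \<in> F" "e \<subseteq> J" "x \<in> path_image (g e)"
    using assms(3) by (auto simp: K_on_def)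
  then show ?thesis
  proof cases
    case 1 then show ?thesis using disjoint_P[of j k] assms by auto
  next
    case 2
    then have e: "e \<in> E" using assms(2) by auto
    obtain i j where ij: "i \<in> I" "j \<in> I" "e = {i, j}"
      "pathstart (g e) \<in> P i" "pathfinish (g e) \<in> P j"
      using edge[OF e] by blast
    have "x = pathstart (g e) \<or> x = pathfinish (g e)" using hit[OF e] 2(3) assms(4,5) by blast
    then have "k = i \<or> k = j"
      using ij assms(4,5) disjoint_P[of k i] disjoint_P[of k j] by blast
    then show ?thesis using 2(2) ij(3) by auto
  qed
qed

lemma K_split:
  assumes "J \<subseteq> I" "F \<subseteq> E" "\<And>e. e \<in> F \<Longrightarrow> e \<subseteq> J \<or> e \<inter> J = {}"
  shows "K F = K_on J F \<union> K_on (I - J) F" "K_on J F \<inter> K_on (I - J) F = {}"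
    "compact (K_on J F)" "compact (K_on (I - J) F)"
proof -
  show "K F = K_on J F \<union> K_on (I - J) F"
  proof
    show "K_on J F \<union> K_on (I - J) F \<subseteq> K F" using assms(1) by (auto simp: K_def K_on_def)
    have "e \<subseteq> J \<or> e \<subseteq> I - J" if "e \<in> F" for e
      using assms(3)[OF that] edge_subset[of e] assms(2) that by blast
    then show "K F \<subseteq> K_on J F \<union> K_on (I - J) F" unfolding K_def K_on_def by blast
  qed
  have fin: "finite F" using assms(2) finite_E finite_subset by blast
  have cmp: "compact (K_on J' F)" if "J' \<subseteq> I" for J'
    unfolding K_on_def
  proof (intro compact_Un compact_UN)
    show "finite J'" using that finite_I finite_subset by blast
    show "compact (P i)" if "i \<in> J'" for i using that \<open>J' \<subseteq> I\<close> compact_P by blast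
    show "compact (path_image (g e))" if "e \<in> {e \<in> F. e \<subseteq> J'}" for e
      using that assms(2) arc_g compact_arc_image by blast
  qed (use fin in simp)
  show "compact (K_on J F)" "compact (K_on (I - J) F)" using cmp assms(1) by auto
  show "K_on J F \<inter> K_on (I - J) F = {}"
  proof (rule ccontr)
    assume "K_on J F \<inter> K_on (I - J) F \<noteq> {}"
    then obtain x where x: "x \<in> K_on J F" "x \<in> K_on (I - J) F" by auto
    have "x \<notin> P k" if "k \<in> I" for k
      using K_on_Int_P[OF assms(1,2) x(1) _ that] K_on_Int_P[OF _ assms(2) x(2) _ that] by auto
    then obtain e e' where "e \<in> F" "e \<subseteq> J" "x \<in> path_image (g e)"
      "e' \<in> F" "e' \<subseteq> I - J" "x \<in> path_image (g e')"
      using x assms(1) unfolding K_on_def by auto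
    moreover have "e \<noteq> e'" using calculation edge[of e] assms(2) by auto
    ultimately show False using cross[of e e'] assms(2) \<open>\<And>k. k \<in> I \<Longrightarrow> x \<notin> P k\<close> by blast
  qed
qed

lemma arc_Int_K_on:
  assumes "J \<subseteq> I" "F \<subseteq> E" "e \<in> E" "e \<notin> F" "e = {i, j}" "i \<in> J" "j \<notin> J" "i \<in> I" "j \<in> I"
    "{pathstart (g e), pathfinish (g e)} = {x, y}" "x \<in> P i" "y \<in> P j"
  shows "path_image (g e) \<inter> K_on J F = {x}"
proof -
  have "K_on J F \<subseteq> K F" using assms(1) by (auto simp: K_on_def K_def)
  then have "path_image (g e) \<inter> K_on J F \<subseteq> {x, y}"
    using arc_Int_K[OF assms(3,2,4)] assms(10) by blast
  moreover have "y \<notin> K_on J F" using K_on_Int_P[OF assms(1,2) _ assms(12,9)] assms(7) by auto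
  moreover have "x \<in> K_on J F" using assms by (auto simp: K_on_def)
  moreover have "x \<in> path_image (g e)"
  proof -
    have "x = pathstart (g e) \<or> x = pathfinish (g e)" using assms(10) by blast
    then show ?thesis by auto
  qed
  ultimately show ?thesis by blast
qed

text \<open>\<open>e\<close> is the only edge of \<open>insert e F\<close> that leaves
  \<open>J\<close>, so it joins two disjoint compact sets and
  \<open>bridge_arc_not_separating\<close> applies.\<close>

lemma bridge_not_separating:
  assumes J: "J \<subseteq> I" "F \<subseteq> E" "\<And>e. e \<in> F \<Longrightarrow> e \<subseteq> J \<or> e \<inter> J = {}"
    and e: "e \<in> E" "e \<notin> F" "e \<inter> J \<noteq> {}" "\<not> e \<subseteq> J"
    and ab: "connected_component (- K F) a b" "a \<notin> path_image (g e)" "b \<notin> path_image (g e)"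
  shows "connected_component (- K (insert e F)) a b"
proof -
  obtain i' j' where e': "i' \<in> I" "j' \<in> I" "e = {i', j'}"
    "pathstart (g e) \<in> P i'" "pathfinish (g e) \<in> P j'"
    using edge[OF e(1)] by blast
  have "(i' \<in> J \<and> j' \<notin> J) \<or> (j' \<in> J \<and> i' \<notin> J)" using e(3,4) e'(3) by auto
  then obtain i j x y where ij: "i \<in> I" "j \<in> I" "e = {i, j}" "i \<in> J" "j \<notin> J"
    and xy: "{pathstart (g e), pathfinish (g e)} = {x, y}" "x \<in> P i" "y \<in> P j"
    using e' insert_commute[of i' j' "{}"] insert_commute[of "pathstart (g e)" "pathfinish (g e)" "{}"]
    by metis
  note sp = K_split[OF J]
  have KF: "K F = K_on J F \<union> K_on (I - J) F" by (rule sp(1))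
  have ab1: "connected_component (- (K_on J F \<union> K_on (I - J) F)) a b"
    using ab(1) unfolding KF .
  have 1: "path_image (g e) \<inter> K_on J F = {x}"
    by (rule arc_Int_K_on[OF J(1,2) e(1,2) ij(3) ij(4,5) ij(1,2) xy])
  have 2: "path_image (g e) \<inter> K_on (I - J) F = {y}"
  proof (rule arc_Int_K_on[OF _ J(2) e(1,2)])
    show "e = {j, i}" "{pathstart (g e), pathfinish (g e)} = {y, x}" using ij(3) xy(1) by blast+
  qed (use ij xy in auto)
  have "connected_component (- (K_on J F \<union> K_on (I - J) F \<union> path_image (g e))) a b"
    by (rule bridge_arc_not_separating[OF sp(3,4,2) arc_g[OF e(1)] 1 2 ab1 ab(2,3)])
  then show ?thesis unfolding K_insert KF .
qed

definition leafless :: "'i set set \<Rightarrow> bool" where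
  "leafless F \<longleftrightarrow> (\<forall>e\<in>F. \<forall>i\<in>e. \<exists>e'\<in>F. e' \<noteq> e \<and> i \<in> e')"

text \<open>A leaf edge is a bridge, so pruning it keeps the complement disconnected. Pruning has to
  stop before the edges run out, because finitely many disjoint compact sets that do not separate
  the plane do not separate it together.\<close>

lemma leafless_if_separating:
  assumes "F \<subseteq> E" "\<not> connected (- K F)"
  shows "\<exists>F'\<subseteq>F. F' \<noteq> {} \<and> leafless F'"
proof -
  have base: "connected (- \<Union> (P ` J))" if "J \<subseteq> I" for J
  proof -
    have "finite J" using that finite_I finite_subset by blast
    then show ?thesis using that
    proof (induction J)
      case (insert i J)
      have "connected (- (P i \<union> \<Union> (P ` J)))"
      proof (rule Janiszewski_connected)
        show "closed (\<Union> (P ` J))"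
          using insert by (intro closed_UN) (auto simp: compact_P compact_imp_closed)
        have "P i \<inter> \<Union> (P ` J) = {}" using insert disjoint_P by fastforce
        then show "connected (P i \<inter> \<Union> (P ` J))" by simp
      qed (use insert in \<open>auto simp: compact_P connected_compl_P\<close>)
      then show ?case by simp
    qed (auto simp: connected_UNIV)
  qed
  have "finite F" using assms finite_E finite_subset by blast
  then show ?thesis using assms
  proof (induction F rule: finite_psubset_induct)
    case (psubset F)
    show ?case
    proof (cases "leafless F \<and> F \<noteq> {}")
      case False
      have "F \<noteq> {}" using psubset.prems(2) base[of I] by (auto simp: K_def)
      then obtain e i where ei: "e \<in> F" "i \<in> e" "\<And>e'. e' \<in> F \<Longrightarrow> e' \<noteq> e \<Longrightarrow> i \<notin> e'"
        using False unfolding leafless_def by blast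
      let ?F = "F - {e}"
      have "\<not> connected (- K ?F)"
      proof
        assume con: "connected (- K ?F)"
        have "connected_component (- K F) a b" if "a \<in> - K F" "b \<in> - K F" for a b
        proof -
          have F: "F = insert e ?F" using ei(1) by auto
          have "a \<in> - K ?F" "b \<in> - K ?F" "a \<notin> path_image (g e)" "b \<notin> path_image (g e)"
            using that K_insert[of e ?F] F by auto
          moreover have "connected_component (- K ?F) a b"
            unfolding connected_component_def using con calculation by blast
          moreover have "e \<in> E" "i \<in> I" using ei psubset.prems(1) edge_subset by blast+
          moreover have "\<not> e \<subseteq> {i}" using edge[OF \<open>e \<in> E\<close>] by auto
          moreover have "e' \<subseteq> {i} \<or> e' \<inter> {i} = {}" if "e' \<in> ?F" for e'
            using ei(3)[of e'] that by auto
          moreover have "?F \<subseteq> E" using psubset.prems(1) by auto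
          ultimately have "connected_component (- K (insert e ?F)) a b"
            using ei(2) by (intro bridge_not_separating[of "{i}"]) auto
          then show ?thesis using F by simp
        qed
        then show False using psubset.prems(2) by (simp add: connected_iff_connected_component)
      qed
      moreover have "?F \<subset> F" using ei by auto
      moreover have "?F \<subseteq> E" using psubset.prems(1) by auto
      ultimately obtain F' where "F' \<subseteq> ?F" "F' \<noteq> {}" "leafless F'"
        using psubset.IH[of ?F] by metis
      then show ?thesis by blast
    qed auto
  qed
qed

section \<open>Faces at an edge\<close>

text \<open>Incidence of the face of \<open>a\<close> with the edge \<open>e\<close>. The open arc
  is used because meeting an endpoint would only say that the face reaches a node.\<close>

definition touches :: "complex \<Rightarrow> 'i set \<Rightarrow> bool" where
  "touches a e \<longleftrightarrow> closure (connected_component_set (- K E) a) \<inter> oarc e \<noteq> {}"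

text \<open>A limit point of the face on the open arc has a disc around it that avoids the rest of
  the system; through this disc the face reaches the arc once \<open>e\<close> is erased.\<close>

lemma touches_connected:
  assumes "e \<in> E" "touches a e"
  obtains m where "m \<in> oarc e" "connected_component (- K (E - {e})) a m"
proof -
  obtain m where m: "m \<in> oarc e" "m \<in> closure (connected_component_set (- K E) a)"
    using assms(2) by (auto simp: touches_def)
  have cl: "closed (K (E - {e}))" by (rule closed_K) auto
  have "m \<notin> K (E - {e})" using oarc_Int_K[OF assms(1), of "E - {e}"] m(1) by auto
  then obtain d where d: "d > 0" "ball m d \<subseteq> - K (E - {e})"
    using cl by (metis ComplI open_Compl open_contains_ball)
  obtain w where w: "connected_component (- K E) a w" "w \<in> ball m d"
    using m(2) d(1) by (metis closure_approachable dist_commute mem_Collect_eq mem_ball)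
  have "connected_component (- K (E - {e})) a w"
    by (rule connected_component_of_subset[OF w(1)]) (use K_mono[of "E - {e}" E] in auto)
  moreover have "connected_component (- K (E - {e})) w m"
    unfolding connected_component_def using w(2) d by (intro exI[of _ "ball m d"]) auto
  ultimately show ?thesis using that m(1) connected_component_trans by metis
qed

text \<open>All faces touching \<open>e\<close> merge once \<open>e\<close> is erased. If
  \<open>e\<close> closes a loop, two of three such faces lie on the same side of it and are not
  separated when \<open>e\<close> is drawn again; otherwise \<open>e\<close> is a bridge and
  separates nothing.\<close>

lemma two_faces_at_edge:
  assumes Z: "separated_points (K E) Z" and e: "e \<in> E"
  shows "card {z \<in> Z. touches z e} \<le> 2"
proof (rule ccontr)
  let ?T = "{z \<in> Z. touches z e}"
  let ?F = "E - {e}"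
  assume "\<not> card ?T \<le> 2"
  then have "3 \<le> card ?T" by simp
  then obtain T where "T \<subseteq> ?T" "card T = 3"
    by (metis obtain_subset_with_card_n)
  then obtain a b c where abc: "a \<in> ?T" "b \<in> ?T" "c \<in> ?T" "a \<noteq> b" "a \<noteq> c" "b \<noteq> c"
    by (auto simp: card_3_iff)
  have E: "E = insert e ?F" using e by auto
  have KE: "K E = K ?F \<union> path_image (g e)" using K_insert[of e ?F] E by simp
  have con: "connected_component (- K ?F) x y" if x: "x \<in> ?T" and y: "y \<in> ?T" for x y
  proof -
    obtain m where m: "m \<in> oarc e" "connected_component (- K ?F) x m"
      using touches_connected[OF e] x by blast
    obtain n where n: "n \<in> oarc e" "connected_component (- K ?F) y n"
      using touches_connected[OF e] y by blast
    have "connected_component (- K ?F) m n"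
      unfolding connected_component_def
      using m(1) n(1) connected_oarc[OF e] oarc_Int_K[OF e, of ?F] by (intro exI[of _ "oarc e"]) auto
    then show ?thesis
      using m(2) n(2) by (meson connected_component_sym connected_component_trans)
  qed
  have notin: "x \<notin> K E" if "x \<in> ?T" for x using Z that by (auto simp: separated_points_def)
  have sep: "\<not> connected_component (- K E) x y" if "x \<in> ?T" "y \<in> ?T" "x \<noteq> y" for x y
    using Z that by (auto simp: separated_points_def)
  show False
  proof (cases "path_component (K ?F) (pathstart (g e)) (pathfinish (g e))")
    case True
    obtain q where q: "arc q" "path_image q \<subseteq> K ?F" "pathstart q = pathfinish (g e)"
      "pathfinish q = pathstart (g e)"
      using joining_arc[OF e True] by metis
    have hK: "path_image (g e) \<inter> K ?F \<subseteq> {pathstart (g e), pathfinish (g e)}"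
      using arc_Int_K[OF e, of ?F] by auto
    let ?c = "path_image (g e) \<union> path_image q"
    have c: "simple_path (g e +++ q)" "pathfinish (g e +++ q) = pathstart (g e +++ q)"
      using simple_path_join_loop[OF arc_g[OF e] q(1)] q hK by auto
    have pc: "path_image (g e +++ q) = ?c" by (rule path_image_join) (use q in simp)
    have J: "connected (inside ?c)" "connected (outside ?c)" "inside ?c \<union> outside ?c = - ?c"
      using Jordan_inside_outside[OF c] unfolding pc by auto
    have side: "\<not> (x \<in> S \<and> y \<in> S)"
      if "x \<in> ?T" "y \<in> ?T" "x \<noteq> y" "connected S" "S \<subseteq> - ?c" for x y S
    proof
      assume "x \<in> S \<and> y \<in> S"
      then have "connected_component (- ?c) x y"
        using that unfolding connected_component_def by blast
      then have "connected_component (- K E) x y"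
        using same_side_of_loop_not_separated[OF closed_K[of ?F] arc_g[OF e] q hK con[OF that(1,2)]]
        by (auto simp: KE)
      then show False using sep that by blast
    qed
    have "x \<in> inside ?c \<or> x \<in> outside ?c" if "x \<in> ?T" for x
      using notin[OF that] J(3) q(2) KE by blast
    then show False
      using abc side[OF _ _ _ J(1)] side[OF _ _ _ J(2)] J(3) by (metis (no_types, lifting) Un_upper1 Un_upper2)
  next
    case False
    \<comment> \<open>The nodes joined to the start of \<open>e\<close> without using
      \<open>e\<close>. No other edge leaves this set, which makes \<open>e\<close> a
      bridge.\<close>
    define J where "J = {k \<in> I. \<exists>x\<in>P k. path_component (K ?F) (pathstart (g e)) x}"
    have J1: "path_component (K ?F) (pathstart (g e)) x" if "k \<in> J" "x \<in> P k" for k x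
      using that path_component_P unfolding J_def by (blast intro: path_component_trans)
    have pc: "path_component (K ?F) (pathstart (g e')) (pathfinish (g e'))" if "e' \<in> ?F" for e'
    proof -
      have "path_image (g e') \<subseteq> K ?F" using that by (auto simp: K_def)
      then show ?thesis using arc_imp_path[OF arc_g] that unfolding path_component_def by blast
    qed
    have J2: "e' \<subseteq> J \<or> e' \<inter> J = {}" if "e' \<in> ?F" for e'
    proof -
      obtain i j where ij: "i \<in> I" "j \<in> I" "e' = {i, j}"
        "pathstart (g e') \<in> P i" "pathfinish (g e') \<in> P j"
        using edge[of e'] \<open>e' \<in> ?F\<close> by blast
      have "i \<in> J \<longleftrightarrow> j \<in> J"
      proof
        assume "i \<in> J"
        then have "path_component (K ?F) (pathstart (g e)) (pathfinish (g e'))"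
          using J1 ij pc[OF that] path_component_trans by metis
        then show "j \<in> J" using ij unfolding J_def by blast
      next
        assume "j \<in> J"
        then have "path_component (K ?F) (pathstart (g e)) (pathstart (g e'))"
          using J1 ij pc[OF that] path_component_trans path_component_sym by metis
        then show "i \<in> J" using ij unfolding J_def by blast
      qed
      then show ?thesis using ij by auto
    qed
    obtain i j where ij: "i \<in> I" "j \<in> I" "e = {i, j}"
      "pathstart (g e) \<in> P i" "pathfinish (g e) \<in> P j"
      using edge[OF e] by blast
    have iJ: "i \<in> J"
      using ij path_component_P[OF ij(1) ij(4) ij(4)] unfolding J_def by blast
    have jJ: "j \<notin> J" using J1[of j "pathfinish (g e)"] ij(5) False by blast
    have "connected_component (- K (insert e ?F)) a b"
    proof (rule bridge_not_separating[of J])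
      show "e' \<subseteq> J \<or> e' \<inter> J = {}" if "e' \<in> ?F" for e' by (rule J2[OF that])
      show "e \<inter> J \<noteq> {}" "\<not> e \<subseteq> J" using iJ jJ ij(3) by auto
      show "connected_component (- K ?F) a b" by (rule con[OF abc(1,2)])
      show "a \<notin> path_image (g e)" "b \<notin> path_image (g e)"
        using notin[OF abc(1)] notin[OF abc(2)] KE by auto
    qed (use e in \<open>auto simp: J_def\<close>)
    then show False using sep[OF abc(1,2,4)] E by simp
  qed
qed

text \<open>Let \<open>F\<close> be the set of edges touching the face. A limit point of the face
  outside \<open>K F\<close> belongs to the face, so the face is open and closed in the connected
  set \<open>- K F\<close> and fills it. This leaves no room for an edge outside
  \<open>F\<close>.\<close>

lemma boundary_separates:
  assumes "a \<notin> K E" "connected (- K {e \<in> E. touches a e})"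
  shows "{e \<in> E. touches a e} = E"
proof -
  let ?F = "{e \<in> E. touches a e}"
  let ?W = "connected_component_set (- K E) a"
  have opW: "open ?W" by (intro open_connected_component open_Compl closed_K) auto
  have aW: "a \<in> ?W" using assms(1) by (simp add: connected_component_refl)
  have aF: "a \<in> - K ?F" using assms(1) K_mono[of ?F E] by auto
  have "z \<in> ?W" if z: "z \<in> closure ?W" "z \<notin> K ?F" for z
  proof -
    have "z \<notin> K E"
    proof
      assume "z \<in> K E"
      then obtain e where e: "e \<in> E" "e \<notin> ?F" "z \<in> path_image (g e)" "z \<notin> \<Union> (P ` I)"
        using z(2) by (auto simp: K_def)
      then have "z \<in> oarc e" using ends_in_P[OF e(1)] unfolding oarc_def by blast
      then show False using e z(1) by (auto simp: touches_def)
    qed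
    then have "z \<in> connected_component_set (- K E) z" by (simp add: connected_component_refl)
    moreover have "open (connected_component_set (- K E) z)"
      by (intro open_connected_component open_Compl closed_K) auto
    ultimately have "connected_component_set (- K E) z \<inter> ?W \<noteq> {}"
      using z(1) open_Int_closure_eq_empty by blast
    then show ?thesis
      by (metis (mono_tags, lifting) connected_component_nonoverlap connected_component_eq \<open>z \<in> connected_component_set (- K E) z\<close>)
  qed
  then have cov: "- K ?F \<subseteq> ?W \<union> - closure ?W" by blast
  have "- K ?F \<subseteq> ?W"
  proof (rule ccontr)
    assume "\<not> - K ?F \<subseteq> ?W"
    then have "- closure ?W \<inter> - K ?F \<noteq> {}" using cov by blast
    moreover have "?W \<inter> - K ?F \<noteq> {}" using aW aF by blast
    moreover have "?W \<inter> - closure ?W \<inter> - K ?F = {}" using closure_subset by blast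
    ultimately show False
      using connectedD[OF assms(2) opW, of "- closure ?W"] cov by blast
  qed
  moreover have "?W \<subseteq> - K E" by (rule connected_component_subset)
  ultimately have sub: "K E \<subseteq> K ?F" by blast
  have "e \<in> ?F" if "e \<in> E" for e
  proof (rule ccontr)
    assume "e \<notin> ?F"
    then have "oarc e \<inter> K ?F = {}" using oarc_Int_K[OF that, of ?F] by auto
    moreover have "oarc e \<subseteq> K E" using that by (auto simp: oarc_def K_def)
    ultimately show False using oarc_nonempty[OF that] sub by blast
  qed
  then show ?thesis by blast
qed

text \<open>A nonempty leafless set of edges contains a cycle, so \<open>k\<close> bounds the girth from below. The first
  alternative accounts for forests.\<close>
theorem edge_bound:
  assumes "I \<noteq> {}" and girth: "\<And>F. F \<subseteq> E \<Longrightarrow> F \<noteq> {} \<Longrightarrow> leafless F \<Longrightarrow> k \<le> card F"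
  shows "card E + 1 \<le> card I \<or> k * (card E + 2) \<le> 2 * card E + k * card I"
proof -
  obtain Z and f :: "'i \<Rightarrow> 'i" where Z: "separated_points (K E) Z"
    "card E + 1 + card (f ` I) \<le> card Z + card I"
    using many_faces[OF order_refl] by metis
  have finZ: "finite Z" using Z(1) by (simp add: separated_points_def)
  have "1 \<le> card (f ` I)" using assms(1) finite_I by (simp add: Suc_le_eq card_gt_0_iff)
  with Z(2) have ZE: "card E + 2 \<le> card Z + card I" by simp
  show ?thesis
  proof (cases "\<forall>z\<in>Z. k \<le> card {e \<in> E. touches z e}")
    case True
    have "k * card Z = (\<Sum>z\<in>Z. k)" by simp
    also have "\<dots> \<le> (\<Sum>z\<in>Z. card {e \<in> E. touches z e})" using True by (intro sum_mono) auto
    also have "\<dots> = (\<Sum>e\<in>E. card {z \<in> Z. touches z e})"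
      using sum.swap_restrict[OF finZ finite_E, of "\<lambda>_ _. 1 :: nat" touches] by simp
    also have "\<dots> \<le> (\<Sum>e\<in>E. 2)" using two_faces_at_edge[OF Z(1)] by (intro sum_mono) auto
    finally have "k * card Z \<le> 2 * card E" by simp
    moreover have "k * (card E + 2) \<le> k * (card Z + card I)" using ZE by (rule mult_le_mono2)
    ultimately have "k * (card E + 2) \<le> 2 * card E + k * card I" by (simp add: distrib_left)
    then show ?thesis ..
  next
    \<comment> \<open>The boundary of a face with fewer than \<open>k\<close> edges contains no
      nonempty leafless set, so it does not separate the plane and consists of all edges. Hence
      there is only one face, and the Euler count gives the first alternative.\<close>
    case False
    then obtain z where z: "z \<in> Z" "card {e \<in> E. touches z e} < k" by auto
    let ?F = "{e \<in> E. touches z e}"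
    have "connected (- K ?F)"
    proof (rule ccontr)
      assume "\<not> connected (- K ?F)"
      then obtain F' where F': "F' \<subseteq> ?F" "F' \<noteq> {}" "leafless F'"
        using leafless_if_separating[of ?F] by auto
      then have "k \<le> card F'" using girth[of F'] by auto
      also have "\<dots> \<le> card ?F" using F'(1) finite_E by (intro card_mono) auto
      finally show False using z(2) by simp
    qed
    moreover have "z \<notin> K E" using Z(1) z(1) by (auto simp: separated_points_def)
    ultimately have "?F = E" using boundary_separates by blast
    with \<open>connected (- K ?F)\<close> have con: "connected (- K E)" by simp
    have "x = y" if "x \<in> Z" "y \<in> Z" for x y
    proof -
      have "connected_component (- K E) x y"
        using con that Z(1) unfolding connected_component_def separated_points_def by blast
      then show ?thesis using Z(1) that by (auto simp: separated_points_def)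
    qed
    then have "card Z \<le> 1" using finZ by (simp add: card_le_Suc0_iff_eq)
    then show ?thesis using ZE by simp
  qed
qed

end

section \<open>Plane graphs with contracted parts\<close>

locale sgraph =
  fixes V :: "'a set" and adj :: "'a \<Rightarrow> 'a \<Rightarrow> bool"
  assumes finite_V: "finite V"
    and adj_sym: "adj u v \<Longrightarrow> adj v u"
    and adj_irrefl: "\<not> adj u u"
    and adj_V: "adj u v \<Longrightarrow> u \<in> V"
begin

text \<open>The empty set counts as connected.\<close>
definition conn :: "'a set \<Rightarrow> bool" where
  "conn S \<longleftrightarrow> (\<forall>A\<subseteq>S. A \<noteq> {} \<longrightarrow> (\<forall>x\<in>A. \<forall>y\<in>S. adj x y \<longrightarrow> y \<in> A) \<longrightarrow> A = S)"

definition touch :: "'a set \<Rightarrow> 'a set \<Rightarrow> bool" where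
  "touch A B \<longleftrightarrow> (\<exists>x\<in>A. \<exists>y\<in>B. adj x y)"

text \<open>The branch sets of a minor, to be treated as the vertices of a contracted graph.\<close>

definition parts :: "'a set set \<Rightarrow> bool" where
  "parts \<P> \<longleftrightarrow> (\<forall>A\<in>\<P>. A \<subseteq> V \<and> A \<noteq> {} \<and> conn A) \<and> (\<forall>A\<in>\<P>. \<forall>B\<in>\<P>. A \<noteq> B \<longrightarrow> A \<inter> B = {})"

lemma finite_parts: "parts \<P> \<Longrightarrow> finite \<P>"
  by (rule finite_subset[of _ "Pow V"]) (auto simp: parts_def finite_V)

end

locale plane_graph = sgraph V adj
  for V :: "'a set" and adj :: "'a \<Rightarrow> 'a \<Rightarrow> bool" +
  fixes p :: "'a \<Rightarrow> complex" and \<gamma> :: "'a set \<Rightarrow> real \<Rightarrow> complex"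
  assumes inj_p: "inj_on p V"
    and arc_edge: "adj u v \<Longrightarrow> arc (\<gamma> {u, v})"
    and ends_edge: "adj u v \<Longrightarrow> {pathstart (\<gamma> {u, v}), pathfinish (\<gamma> {u, v})} = {p u, p v}"
    and edge_Int_verts: "adj u v \<Longrightarrow> path_image (\<gamma> {u, v}) \<inter> p ` V = {p u, p v}"
    and edge_Int_edge: "adj u v \<Longrightarrow> adj x y \<Longrightarrow> {u, v} \<noteq> {x, y} \<Longrightarrow>
      path_image (\<gamma> {u, v}) \<inter> path_image (\<gamma> {x, y}) \<subseteq> p ` ({u, v} \<inter> {x, y})"
begin

definition drawn :: "'a set \<Rightarrow> complex set" where
  "drawn S = p ` S \<union> \<Union> {path_image (\<gamma> {u, v}) |u v. u \<in> S \<and> v \<in> S \<and> adj u v}"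

text \<open>What matters about the drawing of a spanning tree of \<open>S\<close>, phrased without
  trees.\<close>

definition tree_like :: "'a set \<Rightarrow> complex set \<Rightarrow> bool" where
  "tree_like S K \<longleftrightarrow> compact K \<and> path_connected K \<and> connected (- K) \<and> p ` S \<subseteq> K \<and> K \<subseteq> drawn S"

lemma p_eq: "u \<in> V \<Longrightarrow> v \<in> V \<Longrightarrow> p u = p v \<longleftrightarrow> u = v"
  using inj_p by (auto dest: inj_onD)

lemma drawn_mono: "S \<subseteq> T \<Longrightarrow> drawn S \<subseteq> drawn T"
  unfolding drawn_def by blast

lemma edge_Int_drawn:
  assumes "adj u v" "S \<subseteq> V" "\<not> {u, v} \<subseteq> S"
  shows "path_image (\<gamma> {u, v}) \<inter> drawn S \<subseteq> p ` ({u, v} \<inter> S)"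
proof
  fix z assume z: "z \<in> path_image (\<gamma> {u, v}) \<inter> drawn S"
  then consider s where "s \<in> S" "z = p s" |
    x y where "x \<in> S" "y \<in> S" "adj x y" "z \<in> path_image (\<gamma> {x, y})"
    unfolding drawn_def by blast
  then show "z \<in> p ` ({u, v} \<inter> S)"
  proof cases
    case 1
    then have "z \<in> {p u, p v}" using edge_Int_verts[OF assms(1)] assms(2) z by blast
    moreover have "u \<in> V" "v \<in> V" using adj_V adj_sym assms(1) by blast+
    moreover have "s \<in> V" using 1 assms(2) by blast
    ultimately have "s = u \<or> s = v" using 1(2) p_eq by auto
    then show ?thesis using 1 by auto
  next
    case 2
    have "{u, v} \<noteq> {x, y}" using 2 assms(3) by auto
    then have "z \<in> p ` ({u, v} \<inter> {x, y})" using edge_Int_edge[OF assms(1) 2(3)] z 2(4) by blast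
    then show ?thesis using 2(1,2) by blast
  qed
qed

lemma drawn_disjoint:
  assumes "S \<subseteq> V" "T \<subseteq> V" "S \<inter> T = {}"
  shows "drawn S \<inter> drawn T = {}"
proof (rule ccontr)
  assume "drawn S \<inter> drawn T \<noteq> {}"
  then obtain z where z: "z \<in> drawn S" "z \<in> drawn T" by auto
  have vert: False if "z = p s" "s \<in> S'" "z \<in> drawn T'" "S' \<subseteq> V" "T' \<subseteq> V" "S' \<inter> T' = {}" for s S' T'
  proof -
    consider t where "t \<in> T'" "z = p t" |
      x y where "x \<in> T'" "y \<in> T'" "adj x y" "z \<in> path_image (\<gamma> {x, y})"
      using \<open>z \<in> drawn T'\<close> unfolding drawn_def by blast
    then show ?thesis
    proof cases
      case 1
      then have "s \<in> V" "t \<in> V" "p s = p t" using that by auto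
      then show ?thesis using p_eq 1 that by auto
    next
      case 2
      have "s \<in> V" "x \<in> V" "y \<in> V" using that 2 by auto
      moreover from this have "z \<in> {p x, p y}" using edge_Int_verts[OF 2(3)] 2(4) that(1) by blast
      ultimately have "s = x \<or> s = y" using that(1) p_eq by auto
      then show ?thesis using that 2 by auto
    qed
  qed
  consider s where "s \<in> S" "z = p s" |
    x y where "x \<in> S" "y \<in> S" "adj x y" "z \<in> path_image (\<gamma> {x, y})"
    using z(1) unfolding drawn_def by blast
  then show False
  proof cases
    case 1 then show ?thesis using vert[of s S T] z(2) assms by blast
  next
    case 2
    then have "\<not> {x, y} \<subseteq> T" using assms by auto
    then have "z \<in> p ` ({x, y} \<inter> T)" using edge_Int_drawn[OF 2(3) assms(2)] z(2) 2(4) by blast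
    then show ?thesis using 2 assms(3) by auto
  qed
qed

text \<open>A spanning tree is grown edge by edge. The new arc meets the set drawn so far in a
  single point, so by Janiszewski's theorem the union still does not separate the plane.\<close>

lemma tree_like_exists:
  assumes "S \<subseteq> V" "S \<noteq> {}" "conn S"
  shows "\<exists>K. tree_like S K"
proof -
  define T where "T = {T. T \<subseteq> S \<and> T \<noteq> {} \<and> (\<exists>K. tree_like T K)}"
  have finS: "finite S" using assms(1) finite_V finite_subset by blast
  have "finite T" unfolding T_def using finS by simp
  obtain s where s: "s \<in> S" using assms(2) by auto
  have "connected (- {p s})" by (rule connected_punctured_universe) simp
  then have "tree_like {s} {p s}" by (auto simp: tree_like_def drawn_def)
  then have "{s} \<in> T" using s by (auto simp: T_def)
  then have "T \<noteq> {}" by auto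
  then obtain M where M: "M \<in> T" "\<And>M'. M' \<in> T \<Longrightarrow> M \<subseteq> M' \<Longrightarrow> M' = M"
    using finite_has_maximal[OF \<open>finite T\<close>] by metis
  obtain K where K: "tree_like M K" "M \<subseteq> S" "M \<noteq> {}" using M(1) by (auto simp: T_def)
  have "M = S"
  proof (rule ccontr)
    assume "M \<noteq> S"
    then obtain u v where uv: "u \<in> M" "v \<in> S" "adj u v" "v \<notin> M"
      using assms(3) K(2,3) unfolding conn_def by blast
    let ?A = "path_image (\<gamma> {u, v})"
    have "?A \<inter> drawn M \<subseteq> p ` ({u, v} \<inter> M)"
      using edge_Int_drawn[OF uv(3), of M] K(2) assms(1) uv(4) by blast
    then have "K \<inter> ?A \<subseteq> {p u}" using K(1) uv(4) by (auto simp: tree_like_def)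
    moreover have "p u \<in> K" using K(1) uv(1) by (auto simp: tree_like_def)
    moreover have pA: "{p u, p v} \<subseteq> ?A" using edge_Int_verts[OF uv(3)] by blast
    ultimately have KA: "K \<inter> ?A = {p u}" by blast
    have "connected (- (K \<union> ?A))"
    proof (rule Janiszewski_connected)
      show "connected (K \<inter> ?A)" unfolding KA by simp
      show "connected (- ?A)" by (rule connected_arc_complement[OF arc_edge[OF uv(3)]]) simp
    qed (use K(1) arc_edge[OF uv(3)] in \<open>auto simp: tree_like_def closed_arc_image\<close>)
    moreover have "path_connected (K \<union> ?A)"
      by (rule path_connected_Un)
        (use K(1) KA arc_edge[OF uv(3)] in \<open>auto simp: tree_like_def intro!: path_connected_path_image arc_imp_path\<close>)
    moreover have "compact (K \<union> ?A)"
      using K(1) arc_edge[OF uv(3)] by (auto simp: tree_like_def compact_arc_image)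
    moreover have "p ` insert v M \<subseteq> K \<union> ?A" using K(1) pA by (auto simp: tree_like_def)
    moreover have "K \<union> ?A \<subseteq> drawn (insert v M)"
    proof -
      have "?A \<subseteq> drawn (insert v M)" using uv unfolding drawn_def by blast
      moreover have "K \<subseteq> drawn (insert v M)"
        using K(1) drawn_mono[of M "insert v M"] unfolding tree_like_def by blast
      ultimately show ?thesis by simp
    qed
    ultimately have "tree_like (insert v M) (K \<union> ?A)" unfolding tree_like_def by simp
    moreover have "insert v M \<subseteq> S" "insert v M \<noteq> {}" using K(2) uv(2) by auto
    ultimately have "insert v M \<in> T" unfolding T_def by blast
    then have "insert v M = M" by (rule M(2)) auto
    then show False using uv(4) by auto
  qed
  with K(1) have "tree_like S K" by simp
  then show ?thesis by (rule exI)
qed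

text \<open>Each part is replaced by a tree-like set and each pair in \<open>\<E>\<close> by one
  edge of the graph between the two parts, which gives an arc system.\<close>

lemma parts_edge_bound:
  fixes \<P> :: "'a set set" and \<E> :: "'a set set set"
  assumes \<P>: "parts \<P>" "\<P> \<noteq> {}"
    and \<E>: "\<And>e. e \<in> \<E> \<Longrightarrow> \<exists>A\<in>\<P>. \<exists>B\<in>\<P>. A \<noteq> B \<and> e = {A, B} \<and> touch A B"
    and girth: "\<And>F. F \<subseteq> \<E> \<Longrightarrow> F \<noteq> {} \<Longrightarrow> (\<forall>e\<in>F. \<forall>i\<in>e. \<exists>e'\<in>F. e' \<noteq> e \<and> i \<in> e') \<Longrightarrow> k \<le> card F"
  shows "card \<E> + 1 \<le> card \<P> \<or> k * (card \<E> + 2) \<le> 2 * card \<E> + k * card \<P>"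
proof -
  have "\<exists>K. tree_like A K" if "A \<in> \<P>" for A
    using tree_like_exists[of A] \<P>(1) that unfolding parts_def by simp
  then obtain P where P: "\<And>A. A \<in> \<P> \<Longrightarrow> tree_like A (P A)" by metis
  have "\<exists>u v A B. A \<in> \<P> \<and> B \<in> \<P> \<and> A \<noteq> B \<and> e = {A, B} \<and> u \<in> A \<and> v \<in> B \<and> adj u v" if "e \<in> \<E>" for e
    using \<E>[OF that] unfolding touch_def by blast
  then obtain u v A B where uv: "\<And>e. e \<in> \<E> \<Longrightarrow> A e \<in> \<P> \<and> B e \<in> \<P> \<and> A e \<noteq> B e \<and> e = {A e, B e} \<and>
      u e \<in> A e \<and> v e \<in> B e \<and> adj (u e) (v e)" by metis
  have disj: "X \<inter> Y = {}" if "X \<in> \<P>" "Y \<in> \<P>" "X \<noteq> Y" for X Y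
    using \<P>(1) that unfolding parts_def by blast
  have sub: "X \<subseteq> V" if "X \<in> \<P>" for X using \<P>(1) that unfolding parts_def by blast
  have dr: "P X \<subseteq> drawn X" "p ` X \<subseteq> P X" if "X \<in> \<P>" for X
    using P[OF that] by (auto simp: tree_like_def)
  interpret S: arc_system \<P> \<E> P "\<lambda>e. \<gamma> {u e, v e}"
  proof
    show "finite \<P>" using finite_parts \<P>(1) .
    show "compact (P X)" "path_connected (P X)" "connected (- P X)" if "X \<in> \<P>" for X
      using P[OF that] by (auto simp: tree_like_def)
    show "P X \<inter> P Y = {}" if "X \<in> \<P>" "Y \<in> \<P>" "X \<noteq> Y" for X Y
      using drawn_disjoint[OF sub[OF that(1)] sub[OF that(2)] disj[OF that]] dr that by blast
  next
    fix e assume e: "e \<in> \<E>"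
    note f = uv[OF e]
    show "arc (\<gamma> {u e, v e})" using arc_edge f by blast
    have ends: "{pathstart (\<gamma> {u e, v e}), pathfinish (\<gamma> {u e, v e})} = {p (u e), p (v e)}"
      using ends_edge f by blast
    then consider "pathstart (\<gamma> {u e, v e}) = p (u e)" "pathfinish (\<gamma> {u e, v e}) = p (v e)" |
      "pathstart (\<gamma> {u e, v e}) = p (v e)" "pathfinish (\<gamma> {u e, v e}) = p (u e)"
      by (metis doubleton_eq_iff)
    moreover have "p (u e) \<in> P (A e)" "p (v e) \<in> P (B e)"
      using f dr(2)[of "A e"] dr(2)[of "B e"] by auto
    ultimately show "\<exists>i j. i \<in> \<P> \<and> j \<in> \<P> \<and> i \<noteq> j \<and> e = {i, j} \<and>
      pathstart (\<gamma> {u e, v e}) \<in> P i \<and> pathfinish (\<gamma> {u e, v e}) \<in> P j"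
    proof cases
      case 1
      then show ?thesis using f \<open>p (u e) \<in> P (A e)\<close> \<open>p (v e) \<in> P (B e)\<close>
        by (intro exI[of _ "A e"] exI[of _ "B e"]) simp
    next
      case 2
      then show ?thesis using f \<open>p (u e) \<in> P (A e)\<close> \<open>p (v e) \<in> P (B e)\<close>
        by (intro exI[of _ "B e"] exI[of _ "A e"]) auto
    qed
    show "path_image (\<gamma> {u e, v e}) \<inter> \<Union> (P ` \<P>) \<subseteq> {pathstart (\<gamma> {u e, v e}), pathfinish (\<gamma> {u e, v e})}"
    proof -
      have "path_image (\<gamma> {u e, v e}) \<inter> P X \<subseteq> {p (u e), p (v e)}" if "X \<in> \<P>" for X
      proof -
        have "\<not> {u e, v e} \<subseteq> X"
          using f disj[of "A e" X] disj[of "B e" X] that by blast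
        then show ?thesis
          using edge_Int_drawn[of "u e" "v e" X] f sub[OF that] dr(1)[OF that] by blast
      qed
      then show ?thesis unfolding ends by blast
    qed
  next
    fix e e' assume e: "e \<in> \<E>" "e' \<in> \<E>" "e \<noteq> e'"
    note f = uv[OF e(1)] and f' = uv[OF e(2)]
    have "{u e, v e} \<noteq> {u e', v e'}"
    proof
      assume eq: "{u e, v e} = {u e', v e'}"
      have "X = Y" if "x \<in> X" "x \<in> Y" "X \<in> \<P>" "Y \<in> \<P>" for x X Y
        using disj[of X Y] that by blast
      then have "{A e, B e} = {A e', B e'}"
        using eq f f' by (metis doubleton_eq_iff)
      then show False using f f' e(3) by metis
    qed
    then have "path_image (\<gamma> {u e, v e}) \<inter> path_image (\<gamma> {u e', v e'}) \<subseteq> p ` ({u e, v e} \<inter> {u e', v e'})"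
      using edge_Int_edge[of "u e" "v e" "u e'" "v e'"] f f' by simp
    also have "\<dots> \<subseteq> \<Union> (P ` \<P>)"
    proof -
      have "p (u e) \<in> P (A e)" "p (v e) \<in> P (B e)"
        using f dr(2)[of "A e"] dr(2)[of "B e"] by auto
      then show ?thesis using f by auto
    qed
    finally show "path_image (\<gamma> {u e, v e}) \<inter> path_image (\<gamma> {u e', v e'}) \<subseteq> \<Union> (P ` \<P>)" .
  qed
  show ?thesis
    by (rule S.edge_bound[OF \<P>(2)]) (use girth in \<open>auto simp: S.leafless_def\<close>)
qed

text \<open>Girth 3: the edges that continue a given one at its two ends are different from each
  other. In the alternative for forests the bound follows from
  \<open>3 \<le> card \<P>\<close>.\<close>

theorem parts_edges:
  assumes \<P>: "parts \<P>" "3 \<le> card \<P>"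
  shows "card {{A, B} |A B. A \<in> \<P> \<and> B \<in> \<P> \<and> A \<noteq> B \<and> touch A B} + 6 \<le> 3 * card \<P>"
    (is "card ?E + 6 \<le> _")
proof -
  have "card ?E + 1 \<le> card \<P> \<or> 3 * (card ?E + 2) \<le> 2 * card ?E + 3 * card \<P>"
  proof (rule parts_edge_bound[OF \<P>(1)])
    show "\<P> \<noteq> {}" using \<P>(2) by auto
    fix F assume F: "F \<subseteq> ?E" "F \<noteq> {}" "\<forall>e\<in>F. \<forall>i\<in>e. \<exists>e'\<in>F. e' \<noteq> e \<and> i \<in> e'"
    have finF: "finite F"
      by (rule finite_subset[of _ "Pow \<P>"]) (use F(1) finite_parts[OF \<P>(1)] in auto)
    obtain e where "e \<in> F" using F(2) by auto
    then obtain A B where AB: "{A, B} \<in> F" "A \<noteq> B" using F(1) by blast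
    obtain e1 where e1: "e1 \<in> F" "e1 \<noteq> {A, B}" "A \<in> e1" using F(3) AB by blast
    obtain e2 where e2: "e2 \<in> F" "e2 \<noteq> {A, B}" "B \<in> e2" using F(3) AB by blast
    have "B \<notin> e1" using e1 F(1) AB(2) by blast
    then have "e1 \<noteq> e2" using e2 by auto
    then have "card {{A, B}, e1, e2} = 3" using e1 e2 by auto
    then show "3 \<le> card F" using card_mono[OF finF, of "{{A, B}, e1, e2}"] AB e1 e2 by auto
  qed blast
  then show ?thesis using \<P>(2) by auto
qed

theorem parts_bipartite:
  assumes \<P>: "parts (\<A> \<union> \<B>)" "\<A> \<inter> \<B> = {}" "3 \<le> card \<A> + card \<B>"
    and R: "\<And>A B. (A, B) \<in> R \<Longrightarrow> A \<in> \<A> \<and> B \<in> \<B> \<and> touch A B"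
  shows "card R + 4 \<le> 2 * (card \<A> + card \<B>)"
proof -
  let ?h = "\<lambda>(A, B). {A, B}"
  have inj: "inj_on ?h R"
    using R \<P>(2) by (auto simp: inj_on_def doubleton_eq_iff) blast+
  have fin: "finite \<A>" "finite \<B>" using finite_parts[OF \<P>(1)] by auto
  have cP: "card (\<A> \<union> \<B>) = card \<A> + card \<B>" using fin \<P>(2) by (simp add: card_Un_disjoint)
  have "card (?h ` R) + 1 \<le> card (\<A> \<union> \<B>) \<or> 4 * (card (?h ` R) + 2) \<le> 2 * card (?h ` R) + 4 * card (\<A> \<union> \<B>)"
  proof (rule parts_edge_bound[OF \<P>(1)])
    show "\<A> \<union> \<B> \<noteq> {}" using \<P>(3) by auto
    show "\<exists>A\<in>\<A> \<union> \<B>. \<exists>B\<in>\<A> \<union> \<B>. A \<noteq> B \<and> e = {A, B} \<and> touch A B" if "e \<in> ?h ` R" for e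
    proof -
      obtain A B where AB: "(A, B) \<in> R" "e = {A, B}" using \<open>e \<in> ?h ` R\<close> by auto
      then have "A \<in> \<A>" "B \<in> \<B>" "touch A B" using R by auto
      moreover from this have "A \<noteq> B" using \<P>(2) by auto
      ultimately show ?thesis using AB(2) by blast
    qed
    fix F assume F: "F \<subseteq> ?h ` R" "F \<noteq> {}" "\<forall>e\<in>F. \<forall>i\<in>e. \<exists>e'\<in>F. e' \<noteq> e \<and> i \<in> e'"
    have "R \<subseteq> \<A> \<times> \<B>" using R by auto
    then have "finite R" using fin finite_subset by blast
    then have finF: "finite F" using F(1) finite_surj by blast
    have ed: "\<exists>A\<in>\<A>. \<exists>B\<in>\<B>. e = {A, B}" if "e \<in> F" for e
    proof -
      obtain A B where AB: "(A, B) \<in> R" "e = {A, B}" using F(1) \<open>e \<in> F\<close> by auto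
      then show ?thesis using R by auto
    qed
    have ne: "A \<noteq> B" if "A \<in> \<A>" "B \<in> \<B>" for A B using that \<P>(2) by auto
    have edA: "\<exists>B\<in>\<B>. e = {A, B}" if "e \<in> F" "A \<in> e" "A \<in> \<A>" for e A
    proof -
      obtain A' B where e: "A' \<in> \<A>" "B \<in> \<B>" "e = {A', B}" using ed[OF \<open>e \<in> F\<close>] by (elim bexE)
      then have "A = A'" using that(2,3) ne[of A B] by simp
      then show ?thesis using e(2,3) by (intro bexI[of _ B]) simp_all
    qed
    have edB: "\<exists>A\<in>\<A>. e = {A, B}" if "e \<in> F" "B \<in> e" "B \<in> \<B>" for e B
    proof -
      obtain A B' where e: "A \<in> \<A>" "B' \<in> \<B>" "e = {A, B'}" using ed[OF \<open>e \<in> F\<close>] by (elim bexE)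
      then have "B = B'" using that(2,3) ne[of A B] by simp
      then show ?thesis using e(1,3) by (intro bexI[of _ A]) simp_all
    qed
    obtain e where "e \<in> F" using F(2) by auto
    then obtain A B where AB: "{A, B} \<in> F" "A \<in> \<A>" "B \<in> \<B>" using ed[of e] by auto
    obtain e1 where "e1 \<in> F" "e1 \<noteq> {A, B}" "A \<in> e1" using bspec[OF F(3) AB(1)] by auto
    then obtain B' where e1: "{A, B'} \<in> F" "B' \<in> \<B>" "B' \<noteq> B" using edA[of e1 A] AB(2) by auto
    obtain e2 where "e2 \<in> F" "e2 \<noteq> {A, B}" "B \<in> e2" using bspec[OF F(3) AB(1)] by auto
    then obtain A' where e2: "{A', B} \<in> F" "A' \<in> \<A>" "A' \<noteq> A" using edB[of e2 B] AB(3) by auto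
    obtain e3 where "e3 \<in> F" "e3 \<noteq> {A, B'}" "B' \<in> e3" using bspec[OF F(3) e1(1)] by auto
    then obtain A'' where e3: "{A'', B'} \<in> F" "A'' \<in> \<A>" "A'' \<noteq> A" using edB[of e3 B'] e1(2) by auto
    have "A \<noteq> B" "A \<noteq> B'" "A' \<noteq> B" "A' \<noteq> B'" "A'' \<noteq> B" "A'' \<noteq> B'"
      using ne AB(2,3) e1(2) e2(2) e3(2) by blast+
    \<comment> \<open>\<open>A'\<close> and \<open>A''\<close> may coincide: the edges form a
      4-cycle or a path, and are distinct in both cases.\<close>
    then have "card {{A, B}, {A, B'}, {A', B}, {A'', B'}} = 4"
      using e1(3) e2(3) e3(3) by (auto simp: doubleton_eq_iff)
    then show "4 \<le> card F"
      using card_mono[OF finF, of "{{A, B}, {A, B'}, {A', B}, {A'', B'}}"] AB e1 e2 e3 by auto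
  qed
  then show ?thesis using \<P>(3) card_image[OF inj] cP by auto
qed

end

section \<open>List colourings of connected graphs\<close>

context sgraph
begin

definition nb :: "'a set \<Rightarrow> 'a \<Rightarrow> 'a set" where
  "nb A v = {u \<in> A. adj v u}"

text \<open>The unions of components of \<open>S\<close>, the empty one included. Unlike single
  components they are preserved by taking complements in \<open>S\<close>.\<close>

definition closed_in :: "'a set \<Rightarrow> 'a set \<Rightarrow> bool" where
  "closed_in S A \<longleftrightarrow> A \<subseteq> S \<and> (\<forall>x\<in>A. \<forall>y\<in>S. adj x y \<longrightarrow> y \<in> A)"

lemma conn_closed_in: "conn S \<longleftrightarrow> (\<forall>A. closed_in S A \<longrightarrow> A \<noteq> {} \<longrightarrow> A = S)"
  by (auto simp: conn_def closed_in_def)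

lemma connD: "conn S \<Longrightarrow> closed_in S A \<Longrightarrow> A \<noteq> {} \<Longrightarrow> A = S"
  by (simp add: conn_closed_in)

lemma closed_in_Diff: "closed_in S A \<Longrightarrow> closed_in S (S - A)"
  unfolding closed_in_def using adj_sym by blast

lemma closed_in_subset: "closed_in S A \<Longrightarrow> A \<subseteq> S"
  by (simp add: closed_in_def)

lemma closed_inD: "closed_in S A \<Longrightarrow> x \<in> A \<Longrightarrow> y \<in> S \<Longrightarrow> adj x y \<Longrightarrow> y \<in> A"
  by (auto simp: closed_in_def)

lemma nb_subset: "nb A v \<subseteq> A"
  by (auto simp: nb_def)

lemma finite_subV: "A \<subseteq> V \<Longrightarrow> finite A"
  using finite_V finite_subset by blast

lemma finite_nb: "A \<subseteq> V \<Longrightarrow> finite (nb A v)"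
  using finite_subV nb_subset finite_subset by metis

lemma card_nb_mono: "A \<subseteq> B \<Longrightarrow> B \<subseteq> V \<Longrightarrow> card (nb A v) \<le> card (nb B v)"
  by (rule card_mono[OF finite_nb]) (auto simp: nb_def)

lemma nb_remove: "nb (Q - {u}) v = nb Q v - {u}"
  by (auto simp: nb_def)

lemma card_nb_remove:
  assumes "Q \<subseteq> V" "u \<in> Q"
  shows "card (nb (Q - {u}) v) = card (nb Q v) - (if adj v u then 1 else 0)"
proof (cases "adj v u")
  case True
  then have "u \<in> nb Q v" using assms by (simp add: nb_def)
  then show ?thesis using True by (simp add: nb_remove card_Diff_singleton)
next
  case False
  then have "u \<notin> nb Q v" by (simp add: nb_def)
  then show ?thesis using False by (simp add: nb_remove)
qed

lemma nb_pos: "Q \<subseteq> V \<Longrightarrow> u \<in> Q \<Longrightarrow> adj v u \<Longrightarrow> 0 < card (nb Q v)"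
  using finite_nb[of Q v] by (auto simp: card_gt_0_iff nb_def)

definition lcol :: "'a set \<Rightarrow> ('a \<Rightarrow> 'c set) \<Rightarrow> bool" where
  "lcol Q L \<longleftrightarrow> (\<exists>\<phi>. (\<forall>v\<in>Q. \<phi> v \<in> L v) \<and> (\<forall>u\<in>Q. \<forall>v\<in>Q. adj u v \<longrightarrow> \<phi> u \<noteq> \<phi> v))"

lemma lcol_mono:
  assumes "lcol Q L" "\<And>v. v \<in> Q \<Longrightarrow> L v \<subseteq> L' v"
  shows "lcol Q L'"
  using assms unfolding lcol_def by blast

lemma lcol_extend:
  assumes u: "u \<in> Q" "c \<in> L u"
    and col: "lcol (Q - {u}) (\<lambda>v. if adj u v then L v - {c} else L v)"
  shows "lcol Q L"
proof -
  obtain \<phi> where \<phi>: "\<forall>v\<in>Q - {u}. \<phi> v \<in> (if adj u v then L v - {c} else L v)"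
    "\<forall>v\<in>Q - {u}. \<forall>w\<in>Q - {u}. adj v w \<longrightarrow> \<phi> v \<noteq> \<phi> w"
    using col unfolding lcol_def by blast
  have ne: "\<phi> v \<noteq> c" if "v \<in> Q - {u}" "adj u v" for v
    using bspec[OF \<phi>(1) that(1)] that(2) by auto
  show ?thesis
    unfolding lcol_def
  proof (intro exI[of _ "\<phi>(u := c)"] conjI ballI impI)
    show "(\<phi>(u := c)) v \<in> L v" if "v \<in> Q" for v
      using \<phi>(1) u that by (cases "v = u") (auto split: if_splits)
    fix v w assume vw: "v \<in> Q" "w \<in> Q" "adj v w"
    then have "v \<noteq> w" using adj_irrefl by auto
    then show "(\<phi>(u := c)) v \<noteq> (\<phi>(u := c)) w"
      using \<phi>(2) ne[of v] ne[of w] adj_sym[OF vw(3)] vw by auto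
  qed
qed

lemma lcol_degenerate:
  assumes "Q \<subseteq> V" "\<And>A. A \<subseteq> Q \<Longrightarrow> A \<noteq> {} \<Longrightarrow> \<exists>v\<in>A. card (nb A v) < card (L v)"
  shows "lcol Q L"
proof -
  have "finite Q" using assms(1) by (rule finite_subV)
  then show ?thesis using assms
  proof (induction Q rule: finite_psubset_induct)
    case (psubset Q)
    show ?case
    proof (cases "Q = {}")
      case False
      then obtain v where v: "v \<in> Q" "card (nb Q v) < card (L v)"
        using psubset.prems(2)[of Q] by auto
      have "lcol (Q - {v}) L"
        using psubset.prems v(1) by (intro psubset.IH) auto
      then obtain \<phi> where \<phi>: "\<forall>w\<in>Q - {v}. \<phi> w \<in> L w"
        "\<forall>u\<in>Q - {v}. \<forall>w\<in>Q - {v}. adj u w \<longrightarrow> \<phi> u \<noteq> \<phi> w"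
        unfolding lcol_def by blast
      have "card (\<phi> ` nb Q v) < card (L v)"
        using card_image_le[OF finite_nb[OF psubset.prems(1)], of \<phi> v] v(2) by simp
      then have "\<not> L v \<subseteq> \<phi> ` nb Q v"
        using card_mono[OF finite_imageI[OF finite_nb[OF psubset.prems(1)]], of "L v" \<phi> v]
        by auto
      then obtain c where c: "c \<in> L v" "c \<notin> \<phi> ` nb Q v" by auto
      have "lcol (Q - {v}) (\<lambda>w. if adj v w then L w - {c} else L w)"
        unfolding lcol_def
      proof (intro exI[of _ \<phi>] conjI ballI)
        fix w assume w: "w \<in> Q - {v}"
        then show "\<phi> w \<in> (if adj v w then L w - {c} else L w)"
          using \<phi>(1) c(2) by (auto simp: nb_def)
      qed (use \<phi>(2) in blast)
      then show ?thesis using lcol_extend v(1) c(1) by metis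
    qed (simp add: lcol_def)
  qed
qed

definition tight :: "'a set \<Rightarrow> ('a \<Rightarrow> 'c set) \<Rightarrow> bool" where
  "tight Q L \<longleftrightarrow> Q \<subseteq> V \<and> (\<forall>v\<in>Q. finite (L v) \<and> card (nb Q v) \<le> card (L v))"

text \<open>A nonempty set that is not a union of components has a vertex with a neighbour in
  \<open>Q\<close> outside it, whose list therefore exceeds its degree in the set. For the greedy
  argument only unions of components need a spare colour of their own.\<close>

lemma lcol_surplus:
  assumes t: "tight Q L"
    and s: "\<And>A. closed_in Q A \<Longrightarrow> A \<noteq> {} \<Longrightarrow> \<exists>v\<in>A. card (nb Q v) < card (L v)"
  shows "lcol Q L"
proof (rule lcol_degenerate)
  show Q: "Q \<subseteq> V" using t by (simp add: tight_def)
  fix A assume A: "A \<subseteq> Q" "A \<noteq> {}"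
  show "\<exists>v\<in>A. card (nb A v) < card (L v)"
  proof (cases "closed_in Q A")
    case True
    then obtain v where "v \<in> A" "card (nb Q v) < card (L v)" using s A(2) by blast
    then show ?thesis using card_nb_mono[OF A(1) Q, of v] by (intro bexI[of _ v]) auto
  next
    case False
    then obtain x y where xy: "x \<in> A" "y \<in> Q" "adj x y" "y \<notin> A"
      using A(1) by (auto simp: closed_in_def)
    have "nb A x \<subset> nb Q x" using A(1) xy by (auto simp: nb_def)
    then have "card (nb A x) < card (nb Q x)" by (rule psubset_card_mono[OF finite_nb[OF Q]])
    also have "\<dots> \<le> card (L x)" using t xy(1) A(1) by (auto simp: tight_def)
    finally show ?thesis using xy(1) by blast
  qed
qed

lemma lcol_surplus_conn:
  assumes "tight Q L" "conn Q" "v \<in> Q" "card (nb Q v) < card (L v)"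
  shows "lcol Q L"
proof (rule lcol_surplus[OF assms(1)])
  fix A assume "closed_in Q A" "A \<noteq> {}"
  then have "A = Q" using connD[OF assms(2)] by blast
  then show "\<exists>v\<in>A. card (nb Q v) < card (L v)" using assms(3,4) by blast
qed

lemma tight_remove:
  assumes "tight Q L" "u \<in> Q"
  shows "tight (Q - {u}) (\<lambda>v. if adj u v then L v - {c} else L v)"
proof -
  have Q: "Q \<subseteq> V" using assms(1) by (simp add: tight_def)
  have "finite (L v) \<and> card (nb Q v) \<le> card (L v)" if "v \<in> Q" for v
    using assms(1) that by (auto simp: tight_def)
  moreover have "adj v u \<longleftrightarrow> adj u v" for v using adj_sym by blast
  moreover have "card (L v) - 1 \<le> card (L v - {c})" if "v \<in> Q" for v
    using calculation(1)[OF that] by (simp add: card_Diff_singleton_if)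
  ultimately show ?thesis
    using Q unfolding tight_def by (auto simp: card_nb_remove[OF Q assms(2)]) fastforce
qed

text \<open>Giving \<open>u\<close> a colour that \<open>y\<close> lacks takes nothing from the list
  of \<open>y\<close> but lowers its degree, so the connected rest has a spare colour.\<close>

lemma noncut_list_subset:
  assumes t: "tight Q L" and no: "\<not> lcol Q L" and u: "u \<in> Q" "conn (Q - {u})"
    and y: "y \<in> Q" "adj u y"
  shows "L u \<subseteq> L y"
proof
  fix c assume c: "c \<in> L u"
  show "c \<in> L y"
  proof (rule ccontr)
    assume "c \<notin> L y"
    have Q: "Q \<subseteq> V" using t by (simp add: tight_def)
    have "y \<noteq> u" using y(2) adj_irrefl by auto
    have "card (nb Q y) \<le> card (L y)" "0 < card (nb Q y)"
      using t y u nb_pos[OF Q u(1) adj_sym[OF y(2)]] by (auto simp: tight_def)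
    then have "lcol (Q - {u}) (\<lambda>v. if adj u v then L v - {c} else L v)"
      using y \<open>c \<notin> L y\<close> \<open>y \<noteq> u\<close> adj_sym[OF y(2)]
      by (intro lcol_surplus_conn[OF tight_remove[OF t u(1)] u(2), of y])
        (auto simp: card_nb_remove[OF Q u(1)])
    then show False using lcol_extend[of u Q c L] u(1) c no by blast
  qed
qed

text \<open>Two non-adjacent vertices given the same colour leave a spare colour at each of their common
  neighbours.\<close>
lemma lcol_common_colour:
  assumes t: "tight Q L" and y: "y \<in> Q" "c \<in> L y" and z: "z \<in> Q" "c \<in> L z"
    and yz: "y \<noteq> z" "\<not> adj y z"
    and cm: "\<And>A. closed_in (Q - {y} - {z}) A \<Longrightarrow> A \<noteq> {} \<Longrightarrow> \<exists>x\<in>A. adj y x \<and> adj z x"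
  shows "lcol Q L"
proof -
  let ?L1 = "\<lambda>v. if adj y v then L v - {c} else L v"
  let ?L2 = "\<lambda>v. if adj z v then ?L1 v - {c} else ?L1 v"
  have Q: "Q \<subseteq> V" "Q - {y} \<subseteq> V" using t by (auto simp: tight_def)
  have z1: "z \<in> Q - {y}" using z yz by auto
  have t1: "tight (Q - {y}) ?L1" by (rule tight_remove[OF t y(1)])
  have "lcol (Q - {y} - {z}) ?L2"
  proof (rule lcol_surplus[OF tight_remove[OF t1 z1]])
    fix A assume A: "closed_in (Q - {y} - {z}) A" "A \<noteq> {}"
    then obtain x where x: "x \<in> A" "adj y x" "adj z x" using cm by blast
    have xQ: "x \<in> Q" using x(1) closed_in_subset[OF A(1)] by auto
    have "card (nb Q x) \<le> card (L x)" using t xQ by (auto simp: tight_def)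
    moreover have "0 < card (nb (Q - {y}) x)" using nb_pos[OF Q(2) z1 adj_sym[OF x(3)]] .
    moreover have "card (nb (Q - {y} - {z}) x) = card (nb Q x) - 1 - 1"
      using card_nb_remove[OF Q(2) z1, of x] card_nb_remove[OF Q(1) y(1), of x]
        adj_sym[OF x(2)] adj_sym[OF x(3)] by simp
    moreover have "card (nb (Q - {y}) x) = card (nb Q x) - 1"
      using card_nb_remove[OF Q(1) y(1), of x] adj_sym[OF x(2)] by simp
    moreover have "card (L x) - 1 \<le> card (?L2 x)"
      using x t xQ by (auto simp: card_Diff_singleton_if tight_def)
    ultimately show "\<exists>v\<in>A. card (nb (Q - {y} - {z}) v) < card (?L2 v)"
      using x(1) by (intro bexI[of _ x]) linarith+
  qed
  then have "lcol (Q - {y}) ?L1"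
    using lcol_extend[of z "Q - {y}" c ?L1] z1 z yz by auto
  then show ?thesis using lcol_extend[of y Q c L] y by blast
qed

section \<open>Ends of a connected graph\<close>

definition bd :: "'a set \<Rightarrow> 'a set \<Rightarrow> 'a set" where
  "bd Q U = {y \<in> Q - U. \<exists>u\<in>U. adj u y}"

text \<open>Describes a leaf block without its cut vertex in terms of connectedness alone. A
  nonempty connected \<open>Q\<close> without cut vertex is itself an end, with empty
  boundary.\<close>

definition is_end :: "'a set \<Rightarrow> 'a set \<Rightarrow> bool" where
  "is_end Q U \<longleftrightarrow> U \<subseteq> Q \<and> U \<noteq> {} \<and> conn U \<and> (\<forall>u\<in>U. conn (Q - {u})) \<and> (\<exists>w. bd Q U \<subseteq> {w})"

lemma end_nb:
  assumes "is_end Q U" "u \<in> U"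
  shows "nb Q u \<subseteq> (U - {u}) \<union> bd Q U"
  using assms adj_irrefl by (auto simp: nb_def bd_def)

text \<open>A union of components of \<open>Q - U\<close> either avoids the only attachment
  \<open>w\<close> and is one of \<open>Q\<close>, or contains \<open>w\<close> and becomes one of
  \<open>Q\<close> together with \<open>U\<close>.\<close>

lemma conn_Diff:
  assumes "conn Q" and U: "U \<subseteq> Q" "U \<noteq> {}" and bdw: "bd Q U \<subseteq> {w}"
  shows "conn (Q - U)"
  unfolding conn_closed_in
proof (intro allI impI)
  fix A assume A: "closed_in (Q - U) A" "A \<noteq> {}"
  have AQ: "A \<subseteq> Q - U" by (rule closed_in_subset[OF A(1)])
  show "A = Q - U"
  proof (cases "bd Q U \<inter> A = {}")
    case True
    have "closed_in Q A"
      unfolding closed_in_def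
    proof (intro conjI ballI impI)
      fix x y assume xy: "x \<in> A" "y \<in> Q" "adj x y"
      have "y \<notin> U"
      proof
        assume "y \<in> U"
        then have "x \<in> bd Q U" using xy AQ adj_sym by (auto simp: bd_def)
        then show False using True xy(1) by auto
      qed
      then show "y \<in> A" using closed_inD[OF A(1) xy(1)] xy by auto
    qed (use AQ in auto)
    then have "A = Q" using connD[OF assms(1)] A(2) by blast
    then show ?thesis using AQ U by auto
  next
    case False
    then have w: "w \<in> A" "bd Q U \<subseteq> {w}" using bdw by auto
    have "closed_in Q (A \<union> U)"
      unfolding closed_in_def
    proof (intro conjI ballI impI)
      fix x y assume xy: "x \<in> A \<union> U" "y \<in> Q" "adj x y"
      show "y \<in> A \<union> U"
      proof (cases "x \<in> U \<and> y \<notin> U")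
        case True
        then have "y \<in> bd Q U" using xy by (auto simp: bd_def)
        then show ?thesis using w by auto
      next
        case False
        then show ?thesis using closed_inD[OF A(1)] xy by auto
      qed
    qed (use AQ U in auto)
    then have "A \<union> U = Q" using connD[OF assms(1)] A(2) by blast
    then show ?thesis using AQ by auto
  qed
qed

lemma conn_Diff_end: "conn Q \<Longrightarrow> is_end Q U \<Longrightarrow> conn (Q - U)"
  using conn_Diff unfolding is_end_def by blast

lemma conn_singleton: "conn {x}"
  by (auto simp: conn_closed_in closed_in_def)

text \<open>By descent: if \<open>C\<close> is not an end, then it contains a smaller set of the
  same kind, either because it is disconnected or because a cut vertex \<open>u\<close> of
  \<open>Q\<close> in \<open>C\<close> cuts off a set \<open>D\<close> that avoids \<open>w\<close>
  and therefore lies in \<open>C\<close>.\<close>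

lemma end_exists_within:
  assumes "conn Q" "Q \<subseteq> V" "w \<in> Q" "closed_in (Q - {w}) C" "C \<noteq> {}" "C \<noteq> Q - {w}"
  shows "\<exists>U\<subseteq>C. is_end Q U"
  using assms(3-)
proof (induction "card C" arbitrary: w C rule: less_induct)
  case less
  have CQ: "C \<subseteq> Q - {w}" using closed_in_subset[OF less.prems(2)] .
  then have finC: "finite C" using assms(2) by (intro finite_subV) auto
  have bdC: "bd Q C \<subseteq> {w}"
    using less.prems(2) by (auto simp: bd_def closed_in_def)
  consider "conn C" "\<forall>u\<in>C. conn (Q - {u})" | "\<not> conn C" | u where "u \<in> C" "\<not> conn (Q - {u})"
    by blast
  then show ?case
  proof cases
    case 1
    then have "is_end Q C" using CQ less.prems(3) bdC by (auto simp: is_end_def)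
    then show ?thesis by blast
  next
    case 2
    then obtain A where A: "closed_in C A" "A \<noteq> {}" "A \<noteq> C" by (auto simp: conn_closed_in)
    have AC: "A \<subset> C" using closed_in_subset[OF A(1)] A(3) by auto
    have "closed_in (Q - {w}) A"
      using A(1) less.prems(2) unfolding closed_in_def by blast
    moreover have "card A < card C" by (rule psubset_card_mono[OF finC AC])
    moreover have "A \<noteq> Q - {w}" using AC CQ by auto
    ultimately obtain U where "U \<subseteq> A" "is_end Q U" using less.hyps[of A w] A(2) less.prems(1) by blast
    then show ?thesis using AC by blast
  next
    case 3
    then obtain A where A: "closed_in (Q - {u}) A" "A \<noteq> {}" "A \<noteq> Q - {u}" by (auto simp: conn_closed_in)
    have "\<exists>A. closed_in (Q - {u}) A \<and> A \<noteq> {} \<and> A \<noteq> Q - {u} \<and> w \<notin> A"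
    proof (cases "w \<in> A")
      case True
      have "closed_in (Q - {u}) (Q - {u} - A)" by (rule closed_in_Diff[OF A(1)])
      moreover have "Q - {u} - A \<noteq> {}" using A(3) closed_in_subset[OF A(1)] by auto
      moreover have "Q - {u} - A \<noteq> Q - {u}" using True closed_in_subset[OF A(1)] by auto
      moreover have "w \<notin> Q - {u} - A" using True by auto
      ultimately show ?thesis by blast
    qed (use A in blast)
    then obtain D where D: "closed_in (Q - {u}) D" "D \<noteq> {}" "D \<noteq> Q - {u}" "w \<notin> D" by blast
    have uw: "u \<noteq> w" using 3(1) CQ by auto
    have DQ: "D \<subseteq> Q - {u}" by (rule closed_in_subset[OF D(1)])
    \<comment> \<open>No edge leaves \<open>D - C\<close>: entering \<open>C\<close> is possible
      only from \<open>w\<close>, which is not in \<open>D\<close>, and leaving \<open>D\<close>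
      only through \<open>u\<close>, which is in \<open>C\<close>.\<close>
    have "closed_in Q (D - C)"
      unfolding closed_in_def
    proof (intro conjI ballI impI)
      fix x y assume xy: "x \<in> D - C" "y \<in> Q" "adj x y"
      have xw: "x \<in> Q - {w}" using xy(1) DQ D(4) by auto
      have nC: "y \<notin> C"
      proof
        assume "y \<in> C"
        then have "x \<in> C" using closed_inD[OF less.prems(2) _ xw adj_sym[OF xy(3)]] by blast
        then show False using xy(1) by auto
      qed
      then have "y \<noteq> u" using 3(1) by auto
      then have "y \<in> D" using closed_inD[OF D(1), of x y] xy by auto
      then show "y \<in> D - C" using nC by auto
    qed (use DQ in auto)
    then have "D - C = {}" using connD[OF assms(1)] D(4) less.prems(1) by blast
    then have DC: "D \<subset> C" using DQ 3(1) by auto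
    have "card D < card C" by (rule psubset_card_mono[OF finC DC])
    then obtain U where "U \<subseteq> D" "is_end Q U"
      using less.hyps[of D u] D 3(1) CQ by blast
    then show ?thesis using DC by blast
  qed
qed

text \<open>Inclusion of lists holds in both directions along each edge of the end. As the list
  sizes are degrees in \<open>Q\<close>, an end of an uncolourable graph is also regular in
  \<open>Q\<close>.\<close>

lemma end_lists:
  assumes t: "tight Q L" and no: "\<not> lcol Q L" and Q: "conn Q" and U: "is_end Q U"
    and uv: "u \<in> U" "v \<in> U"
  shows "L v = L u" "card (L u) = card (nb Q u)"
proof -
  have UQ: "U \<subseteq> Q" and conU: "conn U" and ncut: "\<And>x. x \<in> U \<Longrightarrow> conn (Q - {x})"
    using U by (auto simp: is_end_def)
  have "L x = L y" if "x \<in> U" "y \<in> U" "adj x y" for x y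
    using noncut_list_subset[OF t no _ ncut, of x y] noncut_list_subset[OF t no _ ncut, of y x]
      that UQ adj_sym[OF that(3)] by blast
  then have "closed_in U {x \<in> U. L x = L u}" by (auto simp: closed_in_def)
  then have "{x \<in> U. L x = L u} = U" using connD[OF conU] uv(1) by blast
  then show "L v = L u" using uv(2) by blast
  have "\<not> card (nb Q u) < card (L u)" using lcol_surplus_conn[OF t Q] no uv(1) UQ by blast
  moreover have "card (nb Q u) \<le> card (L u)" using t uv(1) UQ by (auto simp: tight_def)
  ultimately show "card (L u) = card (nb Q u)" by simp
qed

definition clique :: "'a set \<Rightarrow> bool" where
  "clique C \<longleftrightarrow> (\<forall>x\<in>C. \<forall>y\<in>C. x \<noteq> y \<longrightarrow> adj x y)"

text \<open>\<open>z\<close> and \<open>t\<close> receive the same colour and \<open>x\<close> sees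
  both. A union of components of the rest that avoids \<open>x\<close> also avoids \<open>C\<close>
  and \<open>v\<close>, so it is not adjacent to \<open>z\<close> and is closed in
  \<open>Q - {t}\<close>, which is connected. In \<open>end_clique\<close> the lemma is used twice,
  with \<open>x\<close> and \<open>v\<close> exchanged.\<close>

lemma hub_contradiction:
  assumes t: "tight Q L" and no: "\<not> lcol Q L" and Q: "conn Q"
    and lists: "z \<in> Q" "t \<in> Q" "c \<in> L z" "c \<in> L t" "z \<noteq> t" "\<not> adj z t"
    and cut: "conn (Q - {t})"
    and x: "x \<in> Q" "adj x z" "adj x t"
    and nbz: "nb Q z \<subseteq> (C - {z}) \<union> {v, x}"
    and C: "C \<subseteq> Q" "\<And>y. y \<in> C \<Longrightarrow> adj y x" "\<And>y. y \<in> C \<Longrightarrow> adj y v"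
    and C': "y0 \<in> C" "y0 \<noteq> z" "y0 \<noteq> t" and v: "v \<in> Q" "t \<notin> C"
  shows False
proof -
  have "lcol Q L"
  proof (rule lcol_common_colour[OF t lists(1,3) lists(2,4) lists(5,6)])
    fix A assume A: "closed_in (Q - {z} - {t}) A" "A \<noteq> {}"
    have xQ: "x \<in> Q - {z} - {t}" using x adj_irrefl by auto
    have AQ: "A \<subseteq> Q - {z} - {t}" by (rule closed_in_subset[OF A(1)])
    have "x \<in> A"
    proof (rule ccontr)
      assume nx: "x \<notin> A"
      have nC: "y \<notin> A" if "y \<in> C" for y
        using closed_inD[OF A(1) _ xQ C(2)[OF that]] nx by blast
      have nv: "v \<notin> A"
      proof
        assume "v \<in> A"
        then have "y0 \<in> A"
          using closed_inD[OF A(1), of v y0] C' C(1) adj_sym[OF C(3)[OF C'(1)]] by auto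
        then show False using nC C'(1) by auto
      qed
      have "closed_in (Q - {t}) A"
        unfolding closed_in_def
      proof (intro conjI ballI impI)
        fix a b assume ab: "a \<in> A" "b \<in> Q - {t}" "adj a b"
        have "b \<noteq> z"
        proof
          assume "b = z"
          then have "a \<in> nb Q z" using ab adj_sym AQ by (auto simp: nb_def)
          then have "a \<in> C \<or> a = v \<or> a = x" using nbz by auto
          then show False using ab(1) nC nv nx by auto
        qed
        then show "b \<in> A" using closed_inD[OF A(1) ab(1)] ab by auto
      qed (use AQ in auto)
      then have "A = Q - {t}" using connD[OF cut] A(2) by blast
      then show False using AQ lists by auto
    qed
    then show "\<exists>x\<in>A. adj z x \<and> adj t x" using x adj_sym by blast
  qed
  then show False using no by blast
qed

text \<open>The argument colours a vertex \<open>x\<close> of the end first and looks at an end of the rest.\<close>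
lemma end_clique:
  assumes "tight Q L" "\<not> lcol Q L" "conn Q" "is_end Q U" "u \<in> U" "3 \<le> card (nb Q u)"
  shows "clique (U \<union> bd Q U)"
  using assms
proof (induction "card Q" arbitrary: Q L U u rule: less_induct)
  case less
  note t = less.prems(1) and no = less.prems(2) and conQ = less.prems(3) and U = less.prems(4)
  define r where "r = card (nb Q u)"
  have r3: "3 \<le> r" using less.prems(6) by (simp add: r_def)
  have QV: "Q \<subseteq> V" using t by (simp add: tight_def)
  have finQ: "finite Q" using finite_subV[OF QV] .
  have UQ: "U \<subseteq> Q" and conU: "conn U" and ncut: "\<And>x. x \<in> U \<Longrightarrow> conn (Q - {x})"
    using U by (auto simp: is_end_def)
  obtain w0 where w0: "bd Q U \<subseteq> {w0}" using U by (auto simp: is_end_def)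
  have Lu: "L x = L u" if "x \<in> U" for x using end_lists(1)[OF t no conQ U less.prems(5) that] .
  have deg: "card (nb Q x) = r" if "x \<in> U" for x
    using end_lists(2)[OF t no conQ U that less.prems(5)] end_lists(2)[OF t no conQ U less.prems(5,5)]
      Lu[OF that] by (simp add: r_def)
  have "L u \<noteq> {}" using end_lists(2)[OF t no conQ U less.prems(5,5)] r3 by (auto simp: r_def)
  then obtain c where c: "c \<in> L u" by auto
  have cL: "c \<in> L x" if "x \<in> U" for x using c Lu[OF that] by simp
  have nbU: "nb Q x \<subseteq> (U - {x}) \<union> bd Q U" if "x \<in> U" for x by (rule end_nb[OF U that])
  have conR: "conn (Q - U)" by (rule conn_Diff_end[OF conQ U])
  show ?case
  proof (cases "\<forall>x\<in>U. \<forall>v\<in>U - {x}. conn (Q - {x} - {v})")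
    case True
    have adjU: "adj x y" if xy: "x \<in> U" "y \<in> U" "x \<noteq> y" for x y
    proof (rule ccontr)
      assume nxy: "\<not> adj x y"
      \<comment> \<open>A vertex \<open>b\<close> at distance two from \<open>x\<close>, via
        \<open>a\<close>, could receive the same colour as \<open>x\<close>, which leaves a spare
        colour at \<open>a\<close> in the connected rest. So the closed neighbourhood of
        \<open>x\<close> is all of \<open>U\<close>.\<close>
      have "closed_in U {z \<in> U. z = x \<or> adj x z}"
        unfolding closed_in_def
      proof (intro conjI ballI impI)
        fix a b assume ab: "a \<in> {z \<in> U. z = x \<or> adj x z}" "b \<in> U" "adj a b"
        show "b \<in> {z \<in> U. z = x \<or> adj x z}"
        proof (rule ccontr)
          assume "b \<notin> {z \<in> U. z = x \<or> adj x z}"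
          then have b: "b \<noteq> x" "\<not> adj x b" using ab(2) by auto
          then have a: "a \<noteq> x" "adj x a" "a \<in> U" using ab by auto
          have "lcol Q L"
          proof (rule lcol_common_colour[OF t, of x c b])
            fix A assume A: "closed_in (Q - {x} - {b}) A" "A \<noteq> {}"
            have "conn (Q - {x} - {b})" using True xy(1) ab(2) b UQ by auto
            then have "A = Q - {x} - {b}" using connD A by blast
            moreover have "a \<noteq> b" using ab(3) adj_irrefl by auto
            ultimately have "a \<in> A" using a UQ by auto
            then show "\<exists>x'\<in>A. adj x x' \<and> adj b x'" using a(2) adj_sym[OF ab(3)] by blast
          qed (use xy ab b cL UQ in auto)
          then show False using no by blast
        qed
      qed auto
      then have "{z \<in> U. z = x \<or> adj x z} = U" using connD[OF conU] xy(1) by blast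
      then have "y \<in> {z \<in> U. z = x \<or> adj x z}" using xy(2) by simp
      then show False using xy(3) nxy by simp
    qed
    \<comment> \<open>The neighbour \<open>a\<close> of \<open>w\<close> has degree
      \<open>card U\<close>; since the end is regular, no vertex of it can do without
      \<open>w\<close>.\<close>
    have "adj x w" if x: "x \<in> U" and w: "w \<in> bd Q U" for x w
    proof -
      have bdw: "bd Q U = {w}" using w w0 by auto
      obtain a where a: "a \<in> U" "adj a w" using w by (auto simp: bd_def)
      have wQ: "w \<in> Q" "w \<notin> U" using w by (auto simp: bd_def)
      have finU: "finite U" using UQ finQ finite_subset by blast
      have "nb Q a = (U - {a}) \<union> {w}"
        using nbU[OF a(1)] adjU[OF a(1)] a wQ UQ bdw by (auto simp: nb_def)
      then have "r = card ((U - {a}) \<union> {w})" using deg[OF a(1)] by simp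
      also have "\<dots> = card U" using card_Suc_Diff1[OF finU a(1)] wQ finU by simp
      finally have rU: "r = card U" .
      show ?thesis
      proof (rule ccontr)
        assume "\<not> adj x w"
        then have "nb Q x \<subseteq> U - {x}" using nbU[OF x] bdw by (auto simp: nb_def)
        then have "card (nb Q x) \<le> card (U - {x})" using finU by (intro card_mono) auto
        also have "\<dots> < card U" using x finU by (intro psubset_card_mono) auto
        finally show False using deg[OF x] rU by simp
      qed
    qed
    then show ?thesis
      using adjU adj_sym w0 unfolding clique_def by blast
  next
    case False
    then obtain x v0 where x: "x \<in> U" and v0: "v0 \<in> U - {x}" "\<not> conn (Q - {x} - {v0})" by blast
    define Q' where "Q' = Q - {x}"
    define L' where "L' = (\<lambda>v. if adj x v then L v - {c} else L v)"
    have xQ: "x \<in> Q" using x UQ by auto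
    have conQ': "conn Q'" using ncut[OF x] by (simp add: Q'_def)
    have QV': "Q' \<subseteq> V" using QV by (auto simp: Q'_def)
    have t': "tight Q' L'" unfolding Q'_def L'_def by (rule tight_remove[OF t xQ])
    have no': "\<not> lcol Q' L'"
      using lcol_extend[of x Q c L] xQ cL[OF x] no unfolding Q'_def L'_def by blast
    obtain A where A: "closed_in (Q' - {v0}) A" "A \<noteq> {}" "A \<noteq> Q' - {v0}"
      using v0(2) by (auto simp: conn_closed_in Q'_def)
    have AQ: "A \<subseteq> Q' - {v0}" by (rule closed_in_subset[OF A(1)])
    have RQ: "Q - U \<subseteq> Q' - {v0}" using x v0 by (auto simp: Q'_def)
    \<comment> \<open>\<open>Q - U\<close> is connected and so lies on one side of the cut vertex
      \<open>v0\<close> of \<open>Q'\<close>; the other side is contained in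
      \<open>U\<close>.\<close>
    have "closed_in (Q - U) (A \<inter> (Q - U))"
      using A(1) RQ unfolding closed_in_def by blast
    then have "A \<inter> (Q - U) = {} \<or> Q - U \<subseteq> A" using connD[OF conR] by blast
    then have "\<exists>D. closed_in (Q' - {v0}) D \<and> D \<noteq> {} \<and> D \<noteq> Q' - {v0} \<and> D \<subseteq> U"
    proof
      assume "A \<inter> (Q - U) = {}"
      then have "A \<subseteq> U" using AQ by (auto simp: Q'_def)
      then show ?thesis using A by blast
    next
      assume R: "Q - U \<subseteq> A"
      have "closed_in (Q' - {v0}) (Q' - {v0} - A)" by (rule closed_in_Diff[OF A(1)])
      moreover have "Q' - {v0} - A \<noteq> {}" "Q' - {v0} - A \<noteq> Q' - {v0}" using A AQ by auto
      moreover have "Q' - {v0} - A \<subseteq> U" using R by (auto simp: Q'_def)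
      ultimately show ?thesis by blast
    qed
    then obtain D where D: "closed_in (Q' - {v0}) D" "D \<noteq> {}" "D \<noteq> Q' - {v0}" "D \<subseteq> U" by blast
    have v0Q': "v0 \<in> Q'" using v0 UQ by (auto simp: Q'_def)
    obtain C where CD: "C \<subseteq> D" and C: "is_end Q' C"
      using end_exists_within[OF conQ' QV' v0Q' D(1-3)] by blast
    have v0D: "v0 \<notin> D" using closed_in_subset[OF D(1)] by auto
    have CU: "C \<subseteq> U - {x}" using CD D(4) closed_in_subset[OF D(1)] by (auto simp: Q'_def)
    have CQ: "C \<subseteq> Q" "C \<subseteq> Q'" using CU UQ by (auto simp: Q'_def)
    have C0: "C \<noteq> {}" and conC: "conn C" using C by (auto simp: is_end_def)
    have finC: "finite C" using CQ finQ finite_subset by blast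
    have "bd Q' C \<noteq> {}"
    proof
      assume e: "bd Q' C = {}"
      have "closed_in Q' C" using e CQ by (auto simp: closed_in_def bd_def)
      then have "C = Q'" using connD[OF conQ'] C0 by blast
      then show False using v0Q' v0D CD by auto
    qed
    then obtain v where v: "bd Q' C = {v}" using C by (auto simp: is_end_def)
    then have vQ': "v \<in> Q'" "v \<notin> C" by (auto simp: bd_def)
    then have vQ: "v \<in> Q" "v \<noteq> x" by (auto simp: Q'_def)
    \<comment> \<open>The lists \<open>L'\<close> agree on the end \<open>C\<close> and lack
      \<open>c\<close> exactly at the neighbours of \<open>x\<close>, so \<open>x\<close> sees all
      of \<open>C\<close> or nothing of it. In the latter case \<open>C\<close> would be attached to
      \<open>Q\<close> at \<open>v\<close> only, and either \<open>v\<close> would be a cut vertex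
      in \<open>U\<close> or \<open>U\<close> would be disconnected.\<close>
    have C1: "adj x z" if "z \<in> C" for z
    proof -
      have "closed_in C {z \<in> C. adj x z}"
        unfolding closed_in_def
      proof (intro conjI ballI impI)
        fix a b assume ab: "a \<in> {z \<in> C. adj x z}" "b \<in> C" "adj a b"
        have "L' a = L' b" using end_lists(1)[OF t' no' conQ' C] ab by blast
        moreover have "c \<in> L b" using cL CU ab(2) by auto
        ultimately show "b \<in> {z \<in> C. adj x z}" using ab by (auto simp: L'_def split: if_splits)
      qed auto
      moreover have "{z \<in> C. adj x z} \<noteq> {}"
      proof
        assume e: "{z \<in> C. adj x z} = {}"
        have nx: "\<not> adj z x" if "z \<in> C" for z using e that adj_sym[of z x] by blast
        have bdz: "b = v" if "z \<in> C" "b \<in> Q" "b \<notin> C" "adj z b" for z b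
        proof -
          have "b \<in> bd Q' C" using that nx[OF that(1)] by (auto simp: bd_def Q'_def)
          then show ?thesis using v by simp
        qed
        show False
        proof (cases "v \<in> U")
          case True
          have "closed_in (Q - {v}) C"
            using bdz CQ vQ' unfolding closed_in_def by blast
          then have "C = Q - {v}" using connD[OF ncut[OF True]] C0 by blast
          then show ?thesis using xQ vQ CU by auto
        next
          case False
          have "closed_in U C" using bdz CU UQ False unfolding closed_in_def by blast
          then have "C = U" using connD[OF conU] C0 by blast
          then show ?thesis using x CU by auto
        qed
      qed
      ultimately have "{z \<in> C. adj x z} = C" using connD[OF conC] by blast
      then show ?thesis using that by blast
    qed
    have nbC: "nb Q z \<subseteq> (C - {z}) \<union> {v, x}" if "z \<in> C" for z
      using end_nb[OF C that] v by (auto simp: nb_def Q'_def)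
    have degC: "card (nb Q' z) = r - 1" if "z \<in> C" for z
      using card_nb_remove[OF QV xQ, of z] adj_sym[OF C1[OF that]] deg[of z] that CU
      by (auto simp: Q'_def)
    have nbC': "nb Q' z \<subseteq> (C - {z}) \<union> {v}" if "z \<in> C" for z
      using end_nb[OF C that] v by simp
    have CN: "C \<subseteq> nb Q x" using C1 CQ by (auto simp: nb_def)
    have finN: "finite (nb Q x)" by (rule finite_nb[OF QV])
    have conR': "conn (Q' - C)" by (rule conn_Diff_end[OF conQ' C])
    \<comment> \<open>The end \<open>C\<close> has degree \<open>r - 1\<close> in \<open>Q'\<close>,
      so the induction hypothesis covers \<open>r \<ge> 4\<close>. Degree 2 would also allow odd
      cycles, hence \<open>r = 3\<close> is treated by hand.\<close>
    have cliqueC: "clique (C \<union> {v})"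
    proof (cases "r = 3")
      case False
      obtain z where z: "z \<in> C" using C0 by auto
      have "card Q' < card Q" unfolding Q'_def using finQ xQ by (rule card_Diff1_less)
      moreover have "3 \<le> card (nb Q' z)" using degC[OF z] r3 False by simp
      ultimately show ?thesis using less.hyps[OF _ t' no' conQ' C z] v by simp
    next
      case r: True
      have full: "nb Q' z = (C - {z}) \<union> {v}" if "z \<in> C" "card C \<le> 2" for z
      proof (rule card_seteq)
        have "card ((C - {z}) \<union> {v}) \<le> card (C - {z}) + card {v}" by (rule card_Un_le)
        also have "\<dots> \<le> 2" using that finC by simp
        finally show "card ((C - {z}) \<union> {v}) \<le> card (nb Q' z)" using degC[OF that(1)] r by simp
      qed (use finC nbC'[OF that(1)] in auto)
      have "card C \<le> 3" using card_mono[OF finN CN] deg[OF x] r by simp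
      show ?thesis
      proof (cases "card C \<le> 2")
        case True
        have "adj z y" if "z \<in> C" "y \<in> (C - {z}) \<union> {v}" for z y
          using full[OF that(1) True] that(2) by (auto simp: nb_def)
        then show ?thesis using adj_sym unfolding clique_def by blast
      next
        case False
        then have C3: "card C = 3" using \<open>card C \<le> 3\<close> by simp
        then have NC: "nb Q x = C" using card_seteq[OF finN CN] deg[OF x] r by simp
        obtain z where z: "z \<in> C" "adj z v" using v by (auto simp: bd_def)
        have "\<not> C - {z} \<subseteq> nb Q' z"
        proof
          assume "C - {z} \<subseteq> nb Q' z"
          then have "insert v (C - {z}) \<subseteq> nb Q' z" using z(2) vQ' by (auto simp: nb_def)
          then have "card (insert v (C - {z})) \<le> card (nb Q' z)"
            by (rule card_mono[OF finite_nb[OF QV']])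
          moreover have "card (insert v (C - {z})) = 3" using C3 finC z(1) vQ'(2) by simp
          ultimately show False using degC[OF z(1)] r by simp
        qed
        then obtain y where y: "y \<in> C" "y \<noteq> z" "\<not> adj z y" using CQ by (auto simp: nb_def)
        have vy: "adj y v"
        proof (rule ccontr)
          assume "\<not> adj y v"
          then have "nb Q' y \<subseteq> C - {y} - {z}"
            using nbC'[OF y(1)] y(3) adj_sym[of y z] by (auto simp: nb_def)
          then have "card (nb Q' y) \<le> card (C - {y} - {z})" using finC by (intro card_mono) auto
          also have "\<dots> = 1" using C3 finC y z by simp
          finally show False using degC[OF y(1)] r by simp
        qed
        \<comment> \<open>\<open>z\<close> and \<open>y\<close> have the common neighbours
          \<open>x\<close> and \<open>v\<close>. A union of components that avoids \<open>x\<close>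
          avoids the rest of \<open>C\<close> as well, so it is all of \<open>Q' - C\<close> and
          contains \<open>v\<close>.\<close>
        have "lcol Q L"
        proof (rule lcol_common_colour[OF t, of z c y])
          fix A assume A: "closed_in (Q - {z} - {y}) A" "A \<noteq> {}"
          have AQ: "A \<subseteq> Q - {z} - {y}" by (rule closed_in_subset[OF A(1)])
          show "\<exists>a\<in>A. adj z a \<and> adj y a"
          proof (cases "x \<in> A")
            case True
            then show ?thesis using adj_sym C1 z(1) y(1) by blast
          next
            case False
            have "a \<notin> C" if "a \<in> A" for a
              using closed_inD[OF A(1) that, of x] False xQ CU y(1) z(1) adj_sym[OF C1[of a]] by auto
            then have sub: "A \<subseteq> Q' - C" using AQ False by (auto simp: Q'_def)
            have "closed_in (Q' - C) A"
              using A(1) sub z(1) y(1) unfolding closed_in_def Q'_def by blast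
            then have "A = Q' - C" using connD[OF conR'] A(2) by blast
            then have "v \<in> A" using vQ' by auto
            then show ?thesis using z(2) vy by blast
          qed
        qed (use y z cL CU CQ in auto)
        then show ?thesis using no by blast
      qed
    qed
    have adjC: "adj z y" if "z \<in> C" "y \<in> C \<union> {v}" "z \<noteq> y" for z y
      using cliqueC that by (auto simp: clique_def)
    have vC: "adj z v" if "z \<in> C" for z using adjC[OF that, of v] that vQ' by auto
    obtain z where z: "z \<in> C" using C0 by auto
    have "nb Q' z = (C - {z}) \<union> {v}"
      using nbC'[OF z] adjC[OF z] vC[OF z] CQ vQ' by (auto simp: nb_def)
    then have "r - 1 = card ((C - {z}) \<union> {v})" using degC[OF z] by simp
    also have "\<dots> = card C" using card_Suc_Diff1[OF finC z] vQ' finC by simp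
    finally have cC: "card C = r - 1" by simp
    have "C \<noteq> {z}" using cC r3 by auto
    then obtain y0 where y0: "y0 \<in> C" "y0 \<noteq> z" using z by auto
    show ?thesis
    proof (cases "adj x v")
      \<comment> \<open>\<open>C\<close>, \<open>x\<close> and \<open>v\<close> form a clique, and
        edges leave \<open>insert x C\<close> only towards \<open>v\<close>. So nothing of the end
        or its boundary is left over.\<close>
      case xv: True
      have "insert v C = nb Q x"
      proof (rule card_seteq[OF finN])
        show "insert v C \<subseteq> nb Q x" using CN xv vQ by (auto simp: nb_def)
        show "card (nb Q x) \<le> card (insert v C)" using deg[OF x] cC vQ' finC r3 by simp
      qed
      then have Nx: "nb Q x = insert v C" by simp
      have cl: "clique (insert v (insert x C))"
        using cliqueC C1 xv adj_sym unfolding clique_def by blast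
      have out: "b \<in> insert x C" if "a \<in> insert x C" "b \<in> Q" "b \<noteq> v" "adj a b" for a b
      proof (cases "a = x")
        case True
        then have "b \<in> nb Q x" using that by (simp add: nb_def)
        then show ?thesis using Nx that(3) by auto
      next
        case False
        then have "a \<in> C" using that(1) by auto
        then have "b \<in> (C - {a}) \<union> {v, x}" using nbC[of a] that by (auto simp: nb_def)
        then show ?thesis using that(3) by auto
      qed
      have "U \<union> bd Q U \<subseteq> insert v (insert x C)"
      proof (cases "v \<in> U")
        case True
        have "closed_in (Q - {v}) (insert x C)"
          using out CQ xQ vQ vQ' unfolding closed_in_def by blast
        then have "insert x C = Q - {v}" using connD[OF ncut[OF True]] by blast
        then have "Q \<subseteq> insert v (insert x C)" by auto
        moreover have "U \<union> bd Q U \<subseteq> Q" using UQ by (auto simp: bd_def)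
        ultimately show ?thesis by blast
      next
        case False
        have "closed_in U (insert x C)"
          using out CU x UQ False unfolding closed_in_def by blast
        then have "insert x C = U" using connD[OF conU] by blast
        moreover have "v \<in> bd Q U" using False vQ vC[OF z] z CU by (auto simp: bd_def)
        ultimately show ?thesis using w0 by auto
      qed
      then show ?thesis using cl unfolding clique_def by blast
    next
      \<comment> \<open>\<open>x\<close> has exactly one further neighbour \<open>t\<close>. Neither
        \<open>t\<close> nor the corresponding neighbour \<open>t'\<close> of \<open>v\<close> lies
        in \<open>U\<close>, so both are the boundary vertex and \<open>U\<close> consists of
        \<open>C\<close>, \<open>x\<close> and \<open>v\<close>. Giving the non-adjacent
        \<open>x\<close> and \<open>v\<close> one colour then leaves a spare one in every component,
        at a vertex of \<open>C\<close> or at \<open>t\<close>.\<close>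
      case xv: False
      have "\<exists>t. nb Q x = insert t C \<and> t \<notin> C"
      proof -
        have "card (nb Q x - C) = 1" using card_Diff_subset[OF finC CN] deg[OF x] cC r3 by simp
        then obtain t where "nb Q x - C = {t}" by (auto simp: card_1_singleton_iff)
        then show ?thesis using CN by (intro exI[of _ t]) auto
      qed
      then obtain t where Nx: "nb Q x = insert t C" and tC: "t \<notin> C" by blast
      have xt: "adj x t" "t \<in> Q" using Nx by (auto simp: nb_def)
      have tne: "t \<noteq> x" "t \<noteq> v" using xt xv adj_irrefl by auto
      have zt: "\<not> adj z t" using nbC[OF z] tC tne xt(2) by (auto simp: nb_def)
      have tU: "t \<notin> U"
      proof
        assume tU: "t \<in> U"
        show False
        proof (rule hub_contradiction[OF t no conQ, of z t c x C v y0])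
          show "c \<in> L z" "c \<in> L t" using cL CU z tU by auto
        qed (use ncut[OF tU] z xt zt tC tne nbC[OF z] C1 vC y0 CQ vQ xQ adj_sym in auto)
      qed
      then have "t \<in> bd Q U" using xt x by (auto simp: bd_def)
      then have bdt: "bd Q U = {t}" using w0 by auto
      have vU: "v \<in> U"
      proof (rule ccontr)
        assume "v \<notin> U"
        then have "v \<in> bd Q U" using vQ vC[OF z] z CU by (auto simp: bd_def)
        then show False using bdt tne by auto
      qed
      have Cv: "C \<subseteq> nb Q v" using vC CQ adj_sym by (auto simp: nb_def)
      have "\<exists>t'. nb Q v = insert t' C \<and> t' \<notin> C"
      proof -
        have "card (nb Q v - C) = 1" using card_Diff_subset[OF finC Cv] deg[OF vU] cC r3 by simp
        then obtain t where "nb Q v - C = {t}" by (auto simp: card_1_singleton_iff)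
        then show ?thesis using Cv by (intro exI[of _ t]) auto
      qed
      then obtain t' where Nv: "nb Q v = insert t' C" and tC': "t' \<notin> C" by blast
      have vt: "adj v t'" "t' \<in> Q" using Nv by (auto simp: nb_def)
      have tne': "t' \<noteq> x" "t' \<noteq> v" using vt xv adj_irrefl adj_sym by blast+
      have zt': "\<not> adj z t'" using nbC[OF z] tC' tne' vt(2) by (auto simp: nb_def)
      have tU': "t' \<notin> U"
      proof
        assume tU: "t' \<in> U"
        show False
        proof (rule hub_contradiction[OF t no conQ, of z t' c v C x y0])
          show "c \<in> L z" "c \<in> L t'" using cL CU z tU by auto
          show "nb Q z \<subseteq> C - {z} \<union> {x, v}" using nbC[OF z] by auto
        qed (use ncut[OF tU] z vt zt' tC' tne' C1 vC y0 CQ vQ xQ adj_sym in auto)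
      qed
      then have "t' \<in> bd Q U" using vt vU by (auto simp: bd_def)
      then have tt: "t' = t" using bdt by auto
      have "closed_in U (insert v (insert x C))"
        unfolding closed_in_def
      proof (intro conjI ballI impI)
        fix a b assume ab: "a \<in> insert v (insert x C)" "b \<in> U" "adj a b"
        then have "b \<in> nb Q a" using UQ by (auto simp: nb_def)
        then show "b \<in> insert v (insert x C)"
          using ab Nx Nv nbC[of a] tU tt by auto
      qed (use vU x CU in auto)
      then have Ueq: "insert v (insert x C) = U" using connD[OF conU] by blast
      have "lcol Q L"
      proof (rule lcol_common_colour[OF t, of x c v])
        fix A assume A: "closed_in (Q - {x} - {v}) A" "A \<noteq> {}"
        have AQ: "A \<subseteq> Q - {x} - {v}" by (rule closed_in_subset[OF A(1)])
        show "\<exists>a\<in>A. adj x a \<and> adj v a"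
        proof (cases "A \<inter> C = {}")
          case False
          then show ?thesis using C1 vC adj_sym by blast
        next
          case True
          then have sub: "A \<subseteq> Q - U" using AQ Ueq by auto
          have "closed_in (Q - U) A"
            using A(1) sub x vU unfolding closed_in_def by blast
          then have "A = Q - U" using connD[OF conR] A(2) by blast
          then have "t \<in> A" using xt tU by auto
          then show ?thesis using xt vt tt by blast
        qed
      qed (use x vU cL vQ xQ xv in auto)
      then show ?thesis using no by blast
    qed
  qed
qed

lemma is_end_exists:
  assumes "conn Q" "Q \<subseteq> V" "Q \<noteq> {}"
  obtains U where "is_end Q U"
proof (cases "\<forall>v\<in>Q. conn (Q - {v})")
  case True
  then have "is_end Q Q" using assms by (auto simp: is_end_def bd_def)
  then show ?thesis by (rule that)
next
  case False
  then obtain w A where "w \<in> Q" "closed_in (Q - {w}) A" "A \<noteq> {}" "A \<noteq> Q - {w}"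
    by (auto simp: conn_closed_in)
  then show ?thesis using end_exists_within[OF assms(1,2)] that by blast
qed

text \<open>With a larger degree the end would be a clique by \<open>end_clique\<close>, and a
  vertex of it with its neighbours in \<open>Q\<close> would contain a
  \<open>K\<^sub>5\<close>.\<close>

lemma end_degree_le_3:
  assumes K5: "\<And>C. C \<subseteq> V \<Longrightarrow> clique C \<Longrightarrow> card C \<le> 4"
    and "tight Q L" "\<not> lcol Q L" "conn Q" "is_end Q U" "u \<in> U"
  shows "card (nb Q u) \<le> 3"
proof (rule ccontr)
  assume H: "\<not> card (nb Q u) \<le> 3"
  have Q: "Q \<subseteq> V" and UQ: "U \<subseteq> Q" using assms by (auto simp: tight_def is_end_def)
  have S: "insert u (nb Q u) \<subseteq> U \<union> bd Q U" using end_nb[OF assms(5,6)] assms(6) by auto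
  have "clique (U \<union> bd Q U)" using end_clique[OF assms(2-6)] H by simp
  then have "clique (insert u (nb Q u))" using S unfolding clique_def by blast
  moreover have "insert u (nb Q u) \<subseteq> V" using S UQ Q by (auto simp: bd_def)
  ultimately have "card (insert u (nb Q u)) \<le> 4" using K5 by blast
  moreover have "u \<notin> nb Q u" using adj_irrefl by (auto simp: nb_def)
  ultimately show False using H finite_nb[OF Q] by simp
qed

text \<open>Ends that do not meet \<open>T\<close> are peeled off: the colours at the boundary vertex that
  block the end are deleted, and there are at most as many of them as edges into the end.\<close>
lemma few_blocking_colours:
  assumes K5: "\<And>C. C \<subseteq> V \<Longrightarrow> clique C \<Longrightarrow> card C \<le> 4"
    and "Q \<subseteq> V" "conn Q" "T \<subseteq> Q" "T \<noteq> {}"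
    and "\<And>v. v \<in> Q \<Longrightarrow> finite (M v) \<and> card (nb Q v) + (if v \<in> T then 1 else 0) \<le> card (M v)"
  shows "\<exists>F. finite F \<and> card F \<le> 4 \<and>
    (\<forall>c. c \<notin> F \<longrightarrow> lcol Q (\<lambda>v. if v \<in> T then M v - {c} else M v))"
  using assms(2-)
proof (induction "card Q" arbitrary: Q M rule: less_induct)
  case less
  note QV = less.prems(1) and conQ = less.prems(2) and TQ = less.prems(3) and M = less.prems(5)
  have finQ: "finite Q" by (rule finite_subV[OF QV])
  let ?L = "\<lambda>c v. if v \<in> T then M v - {c} else M v"
  have t: "tight Q (?L c)" for c
    unfolding tight_def
  proof (intro conjI ballI)
    fix v assume v: "v \<in> Q"
    show "finite (?L c v)" using M[OF v] by simp
    have "card (M v) - 1 \<le> card (M v - {c})" using M[OF v] by (simp add: card_Diff_singleton_if)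
    then show "card (nb Q v) \<le> card (?L c v)" using M[OF v] by auto
  qed (rule QV)
  have "Q \<noteq> {}" using TQ less.prems(4) by auto
  then obtain U where U: "is_end Q U" using is_end_exists[OF conQ QV] by blast
  have UQ: "U \<subseteq> Q" and U0: "U \<noteq> {}" and conU: "conn U" using U by (auto simp: is_end_def)
  show ?case
  proof (cases "U \<inter> T = {}")
    case False
    then obtain x where x: "x \<in> U" "x \<in> T" by auto
    have xQ: "x \<in> Q" using x UQ by auto
    have Mx: "finite (M x)" "card (nb Q x) + 1 \<le> card (M x)" using M[OF xQ] x(2) by auto
    \<comment> \<open>A short list is forbidden as a whole, so that \<open>x\<close> keeps its
      surplus. A list of at least 5 colours exceeds, even after the loss of one, the degree 3 that
      \<open>x\<close> could have if \<open>Q\<close> were uncolourable.\<close>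
    show ?thesis
    proof (cases "card (M x) \<le> 4")
      case True
      have "lcol Q (?L c)" if "c \<notin> M x" for c
      proof (rule lcol_surplus_conn[OF t conQ xQ])
        have "M x - {c} = M x" using that by auto
        then show "card (nb Q x) < card (?L c x)" using Mx x(2) by simp
      qed
      then show ?thesis using True Mx by (intro exI[of _ "M x"]) auto
    next
      case False
      have "lcol Q (?L c)" for c
      proof (rule ccontr)
        assume no: "\<not> lcol Q (?L c)"
        have d: "card (nb Q x) \<le> 3" by (rule end_degree_le_3[OF K5 t no conQ U x(1)])
        have "card (M x) - 1 \<le> card (M x - {c})" using Mx by (simp add: card_Diff_singleton_if)
        then have "card (nb Q x) < card (?L c x)" using d False x(2) by auto
        then show False using lcol_surplus_conn[OF t conQ xQ] no by blast
      qed
      then show ?thesis by (intro exI[of _ "{}"]) auto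
    qed
  next
    case UT: True
    have UneQ: "U \<noteq> Q" using UT TQ less.prems(4) by auto
    have "bd Q U \<noteq> {}"
    proof
      assume e: "bd Q U = {}"
      have "closed_in Q U" using e UQ by (auto simp: closed_in_def bd_def)
      then show False using connD[OF conQ] U0 UneQ by blast
    qed
    then obtain w where w: "bd Q U = {w}" using U by (auto simp: is_end_def)
    then have wQ: "w \<in> Q" "w \<notin> U" by (auto simp: bd_def)
    obtain u0 where u0: "u0 \<in> U" "adj u0 w" using w by (auto simp: bd_def)
    have only_w: "y = w" if "u \<in> U" "y \<in> Q - U" "adj u y" for u y
    proof -
      have "y \<in> bd Q U" using that by (auto simp: bd_def)
      then show ?thesis using w by simp
    qed
    define N where "N = (\<lambda>c u. if adj w u then M u - {c} else M u)"
    define KU where "KU = {c \<in> M w. \<not> lcol U (N c)}"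
    have finKU: "finite KU" "KU \<subseteq> M w" using M[OF wQ(1)] by (auto simp: KU_def)
    have nbU: "nb U w \<subseteq> U" "finite (nb U w)" using UQ QV by (auto simp: nb_def intro: finite_subV)
    \<comment> \<open>With more blocking colours than edges from \<open>w\<close> into
      \<open>U\<close>, the list \<open>KU\<close> would give \<open>w\<close> a spare colour in the
      connected graph on \<open>insert w U\<close>, and the colour assigned to \<open>w\<close>
      would not block.\<close>
    have cKU: "card KU \<le> card (nb U w)"
    proof (rule ccontr)
      assume H: "\<not> card KU \<le> card (nb U w)"
      let ?Q1 = "insert w U"
      let ?N = "\<lambda>v. if v = w then KU else M v"
      have "lcol ?Q1 ?N"
      proof (rule lcol_surplus_conn[of _ _ w])
        have nbw: "nb ?Q1 w = nb U w" using adj_irrefl by (auto simp: nb_def)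
        show "card (nb ?Q1 w) < card (?N w)" using H nbw by simp
        show "tight ?Q1 ?N"
          unfolding tight_def
        proof (intro conjI ballI)
          show Q1V: "?Q1 \<subseteq> V" using UQ QV wQ by auto
          fix v assume v: "v \<in> ?Q1"
          show "finite (?N v)" using v finKU M UQ by auto
          show "card (nb ?Q1 v) \<le> card (?N v)"
          proof (cases "v = w")
            case False
            then have vQ: "v \<in> Q" using v UQ by auto
            have "card (nb ?Q1 v) \<le> card (nb Q v)" using UQ wQ QV by (intro card_nb_mono) auto
            then show ?thesis using M[OF vQ] False by simp
          qed (use H nbw in simp)
        qed
        show "conn ?Q1"
          unfolding conn_closed_in
        proof (intro allI impI)
          fix A assume A: "closed_in ?Q1 A" "A \<noteq> {}"
          have AQ: "A \<subseteq> ?Q1" by (rule closed_in_subset[OF A(1)])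
          have AU: "A \<inter> U \<noteq> {}"
          proof
            assume e: "A \<inter> U = {}"
            then have "w \<in> A" using A(2) AQ by auto
            then have "u0 \<in> A" using closed_inD[OF A(1)] u0 adj_sym by blast
            then show False using e u0 by auto
          qed
          have "closed_in U (A \<inter> U)" using A(1) unfolding closed_in_def by blast
          then have "A \<inter> U = U" using connD[OF conU] AU by blast
          then have UA: "U \<subseteq> A" by auto
          then have "w \<in> A" using closed_inD[OF A(1), of u0 w] u0 by auto
          then show "A = ?Q1" using UA AQ by auto
        qed
      qed simp
      then obtain \<phi> where \<phi>: "\<forall>v\<in>?Q1. \<phi> v \<in> ?N v" "\<forall>u\<in>?Q1. \<forall>v\<in>?Q1. adj u v \<longrightarrow> \<phi> u \<noteq> \<phi> v"
        unfolding lcol_def by blast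
      have "\<phi> w \<in> KU" using \<phi>(1) by simp
      moreover have "lcol U (N (\<phi> w))"
        unfolding lcol_def
      proof (intro exI[of _ \<phi>] conjI ballI)
        fix v assume v: "v \<in> U"
        have "v \<noteq> w" using v wQ(2) by auto
        then have "\<phi> v \<in> M v" using bspec[OF \<phi>(1), of v] v by simp
        moreover have "adj w v \<longrightarrow> \<phi> w \<noteq> \<phi> v" using \<phi>(2) v by simp
        ultimately show "\<phi> v \<in> N (\<phi> w) v" by (auto simp: N_def)
      qed (use \<phi>(2) in simp)
      ultimately show False by (simp add: KU_def)
    qed
    define Q' where "Q' = Q - U"
    \<comment> \<open>Deleting \<open>KU\<close> costs \<open>w\<close> no more than it gains by
      losing its neighbours in \<open>U\<close>, so the assumption on list sizes passes to
      \<open>Q'\<close>.\<close>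
    define M' where "M' = (\<lambda>v. if v = w then M w - KU else M v)"
    have wQ': "w \<in> Q'" using wQ by (simp add: Q'_def)
    have "\<exists>F. finite F \<and> card F \<le> 4 \<and> (\<forall>c. c \<notin> F \<longrightarrow> lcol Q' (\<lambda>v. if v \<in> T then M' v - {c} else M' v))"
    proof (rule less.hyps)
      show "card Q' < card Q" unfolding Q'_def using U0 UQ finQ by (intro psubset_card_mono) auto
      show "Q' \<subseteq> V" using QV by (auto simp: Q'_def)
      show "conn Q'" unfolding Q'_def by (rule conn_Diff_end[OF conQ U])
      show "T \<subseteq> Q'" "T \<noteq> {}" using TQ UT less.prems(4) by (auto simp: Q'_def)
      fix v assume v: "v \<in> Q'"
      then have vQ: "v \<in> Q" by (simp add: Q'_def)
      show "finite (M' v) \<and> card (nb Q' v) + (if v \<in> T then 1 else 0) \<le> card (M' v)"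
      proof (cases "v = w")
        case True
        have "nb Q w = nb Q' w \<union> nb U w" "nb Q' w \<inter> nb U w = {}"
          using UQ by (auto simp: nb_def Q'_def)
        moreover have "finite (nb Q' w)" using QV by (intro finite_nb) (auto simp: Q'_def)
        ultimately have "card (nb Q w) = card (nb Q' w) + card (nb U w)"
          using nbU(2) by (simp add: card_Un_disjoint)
        moreover have "card (M w - KU) = card (M w) - card KU"
          by (rule card_Diff_subset[OF finKU])
        ultimately show ?thesis using M[OF wQ(1)] cKU True by (auto simp: M'_def)
      next
        case False
        have "card (nb Q' v) \<le> card (nb Q v)" using QV by (intro card_nb_mono) (auto simp: Q'_def)
        then show ?thesis using M[OF vQ] False by (auto simp: M'_def)
      qed
    qed
    then obtain F where F: "finite F" "card F \<le> 4"
      "\<And>c. c \<notin> F \<Longrightarrow> lcol Q' (\<lambda>v. if v \<in> T then M' v - {c} else M' v)" by blast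
    have "lcol Q (?L c)" if c: "c \<notin> F" for c
    proof -
      obtain \<phi> where \<phi>: "\<forall>v\<in>Q'. \<phi> v \<in> (if v \<in> T then M' v - {c} else M' v)"
        "\<forall>u\<in>Q'. \<forall>v\<in>Q'. adj u v \<longrightarrow> \<phi> u \<noteq> \<phi> v"
        using F(3)[OF c] unfolding lcol_def by blast
      have "\<phi> w \<in> M w - KU" using bspec[OF \<phi>(1) wQ'] by (auto simp: M'_def split: if_splits)
      then have "lcol U (N (\<phi> w))" by (auto simp: KU_def)
      then obtain \<eta> where \<eta>: "\<forall>v\<in>U. \<eta> v \<in> N (\<phi> w) v" "\<forall>u\<in>U. \<forall>v\<in>U. adj u v \<longrightarrow> \<eta> u \<noteq> \<eta> v"
        unfolding lcol_def by blast
      have cross: "\<eta> u \<noteq> \<phi> v" if "u \<in> U" "v \<in> Q'" "adj u v" for u v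
      proof -
        have "v = w" using only_w that by (simp add: Q'_def)
        then show ?thesis using bspec[OF \<eta>(1) that(1)] adj_sym[OF that(3)] by (auto simp: N_def)
      qed
      show ?thesis
        unfolding lcol_def
      proof (intro exI[of _ "\<lambda>v. if v \<in> U then \<eta> v else \<phi> v"] conjI ballI impI)
        fix v assume v: "v \<in> Q"
        show "(if v \<in> U then \<eta> v else \<phi> v) \<in> ?L c v"
        proof (cases "v \<in> U")
          case True
          then have "v \<notin> T" using UT by auto
          then show ?thesis using True bspec[OF \<eta>(1) True] by (auto simp: N_def split: if_splits)
        next
          case False
          then have "v \<in> Q'" using v by (simp add: Q'_def)
          then show ?thesis
            using bspec[OF \<phi>(1), of v] False by (auto simp: M'_def split: if_splits)
        qed
      next
        fix u v assume uv: "u \<in> Q" "v \<in> Q" "adj u v"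
        consider "u \<in> U" "v \<in> U" | "u \<in> U" "v \<in> Q'" "v \<notin> U" | "u \<in> Q'" "u \<notin> U" "v \<in> U" |
          "u \<in> Q'" "v \<in> Q'" "u \<notin> U" "v \<notin> U" using uv by (auto simp: Q'_def)
        then show "(if u \<in> U then \<eta> u else \<phi> u) \<noteq> (if v \<in> U then \<eta> v else \<phi> v)"
        proof cases
          case 1 then show ?thesis using \<eta>(2) uv(3) by simp
        next
          case 2 then show ?thesis using cross[of u v] uv(3) by simp
        next
          case 3 then show ?thesis using cross[of v u] adj_sym[OF uv(3)] by auto
        next
          case 4 then show ?thesis using \<phi>(2) uv(3) by simp
        qed
      qed
    qed
    then show ?thesis using F(1,2) by blast
  qed
qed

section \<open>Vertices that save a piece\<close>

definition rest :: "('a \<Rightarrow> 'c set) \<Rightarrow> 'a set \<Rightarrow> ('a \<Rightarrow> 'c) \<Rightarrow> 'a \<Rightarrow> 'c set" where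
  "rest L B \<psi> v = L v - \<psi> ` nb B v"

text \<open>\<open>F\<close> depends only on the colours \<open>\<phi>\<close> of the vertices before \<open>a\<close>, while the colours after \<open>a\<close> are
  arbitrary; the colouring \<open>\<psi>\<close> of \<open>B\<close> is not required to be proper.\<close>
definition saves :: "('a \<Rightarrow> 'c set) \<Rightarrow> 'a set \<Rightarrow> ('a \<Rightarrow> nat) \<Rightarrow> 'a set \<Rightarrow> 'a \<Rightarrow> bool" where
  "saves L B f Q a \<longleftrightarrow> (\<forall>\<phi>. \<exists>F. finite F \<and> card F \<le> 5 \<and>
     (\<forall>\<psi>. (\<forall>u\<in>B. f u < f a \<longrightarrow> \<psi> u = \<phi> u) \<longrightarrow> \<psi> a \<notin> F \<longrightarrow> lcol Q (rest L B \<psi>)))"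

definition later :: "'a set \<Rightarrow> ('a \<Rightarrow> nat) \<Rightarrow> 'a \<Rightarrow> 'a \<Rightarrow> 'a set" where
  "later B f a x = {b \<in> nb B x. f a \<le> f b}"

end

locale list_piece = sgraph V adj
  for V :: "'a set" and adj :: "'a \<Rightarrow> 'a \<Rightarrow> bool" +
  fixes B Q :: "'a set" and L :: "'a \<Rightarrow> 'c set" and f :: "'a \<Rightarrow> nat"
  assumes B: "B \<subseteq> V" and Q: "Q \<subseteq> V - B" "conn Q" "closed_in (V - B) Q"
    and L: "v \<in> Q \<Longrightarrow> finite (L v) \<and> card (L v) = card (nb V v)"
    and f: "inj_on f B"
begin

lemma QV: "Q \<subseteq> V"
  using Q by auto

lemma finite_nbB: "finite (nb B v)"
  by (rule finite_nb[OF B])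

lemma card_L:
  assumes "v \<in> Q"
  shows "card (L v) = card (nb Q v) + card (nb B v)"
proof -
  have "nb V v = nb Q v \<union> nb B v"
    using closed_inD[OF Q(3) assms] QV B by (auto simp: nb_def)
  moreover have "nb Q v \<inter> nb B v = {}" using Q(1) by (auto simp: nb_def)
  ultimately show ?thesis
    using L[OF assms] finite_nb[OF QV] finite_nbB by (simp add: card_Un_disjoint)
qed

lemma tight_rest: "tight Q (rest L B \<psi>)"
  unfolding tight_def
proof (intro conjI ballI)
  fix v assume v: "v \<in> Q"
  show "finite (rest L B \<psi> v)" using L[OF v] by (simp add: rest_def)
  have "card (L v) - card (\<psi> ` nb B v) \<le> card (rest L B \<psi> v)"
    unfolding rest_def by (rule diff_card_le_card_Diff) (simp add: finite_nbB)
  moreover have "card (\<psi> ` nb B v) \<le> card (nb B v)" by (rule card_image_le[OF finite_nbB])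
  ultimately show "card (nb Q v) \<le> card (rest L B \<psi> v)" using card_L[OF v] by simp
qed (rule QV)

lemma lcol_rest: "v \<in> Q \<Longrightarrow> card (nb Q v) < card (rest L B \<psi> v) \<Longrightarrow> lcol Q (rest L B \<psi>)"
  using lcol_surplus_conn[OF tight_rest Q(2)] .

text \<open>The list left at \<open>v\<close> when the turn of \<open>a\<close> comes. It depends
  only on colours given before \<open>a\<close> and may therefore determine the forbidden colours in
  \<open>saves\<close>.\<close>

definition M :: "('a \<Rightarrow> 'c) \<Rightarrow> 'a \<Rightarrow> 'a \<Rightarrow> 'c set" where
  "M \<phi> a v = L v - \<phi> ` (nb B v - later B f a v)"

lemma later_subset: "later B f a v \<subseteq> nb B v" "finite (later B f a v)"
  using finite_nbB[of v] finite_subset by (auto simp: later_def)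

lemma M_finite: "v \<in> Q \<Longrightarrow> finite (M \<phi> a v)"
  using L by (simp add: M_def)

lemma card_M: "v \<in> Q \<Longrightarrow> card (nb Q v) + card (later B f a v) \<le> card (M \<phi> a v)"
proof -
  assume v: "v \<in> Q"
  have "card (L v) - card (\<phi> ` (nb B v - later B f a v)) \<le> card (M \<phi> a v)"
    unfolding M_def by (rule diff_card_le_card_Diff) (simp add: finite_nbB)
  moreover have "card (\<phi> ` (nb B v - later B f a v)) \<le> card (nb B v - later B f a v)"
    by (rule card_image_le) (simp add: finite_nbB)
  moreover have "card (nb B v - later B f a v) = card (nb B v) - card (later B f a v)"
    by (rule card_Diff_subset) (rule later_subset)+
  moreover have "card (later B f a v) \<le> card (nb B v)" by (rule card_mono[OF finite_nbB later_subset(1)])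
  ultimately show ?thesis using card_L[OF v] by linarith
qed

lemma rest_M:
  assumes "\<forall>u\<in>B. f u < f a \<longrightarrow> \<psi> u = \<phi> u"
  shows "rest L B \<psi> v = M \<phi> a v - \<psi> ` later B f a v"
proof -
  have "\<psi> u = \<phi> u" if "u \<in> nb B v - later B f a v" for u
    using that assms by (auto simp: later_def nb_def)
  then have "\<psi> ` (nb B v - later B f a v) = \<phi> ` (nb B v - later B f a v)" by (rule image_cong[OF refl])
  moreover have "nb B v = (nb B v - later B f a v) \<union> later B f a v" using later_subset by auto
  then have "\<psi> ` nb B v = \<psi> ` (nb B v - later B f a v) \<union> \<psi> ` later B f a v"
    by (metis image_Un)
  ultimately show ?thesis by (auto simp: rest_def M_def)
qed

text \<open>\<open>S\<close> is a set of later neighbours that accounts for all colours still lost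
  at \<open>v\<close>. It is used with all of them, and with all but \<open>a\<close> when the
  colour of \<open>a\<close> is absent or repeated, which gains the one spare colour that is
  wanted.\<close>

lemma card_rest:
  assumes "\<forall>u\<in>B. f u < f a \<longrightarrow> \<psi> u = \<phi> u" "S \<subseteq> later B f a v"
    "M \<phi> a v - \<psi> ` later B f a v = M \<phi> a v - \<psi> ` S"
  shows "card (M \<phi> a v) - card S \<le> card (rest L B \<psi> v)"
proof -
  have finS: "finite S" using assms(2) later_subset finite_subset by blast
  have "card (M \<phi> a v) - card (\<psi> ` S) \<le> card (M \<phi> a v - \<psi> ` S)"
    by (rule diff_card_le_card_Diff) (simp add: finS)
  moreover have "card (\<psi> ` S) \<le> card S" by (rule card_image_le[OF finS])
  ultimately show ?thesis using rest_M[OF assms(1), of v] assms(3) by simp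
qed

lemma saves_always: "(\<And>\<psi>. lcol Q (rest L B \<psi>)) \<Longrightarrow> saves L B f Q a"
  unfolding saves_def by (intro allI exI[of _ "{}"]) simp

lemma card_later_pos: "a \<in> later B f a x \<Longrightarrow> card (later B f a x - {a}) < card (later B f a x)"
  using later_subset by (intro psubset_card_mono) auto

text \<open>If the list left at \<open>x\<close> has at most 5 colours, all of them are forbidden
  and \<open>a\<close> costs \<open>x\<close> nothing. A longer list has a spare colour whatever
  happens.\<close>

lemma saves_small:
  assumes x: "x \<in> Q" "a \<in> nb B x" "card (nb Q x) + card (later B f a x) \<le> 5"
  shows "saves L B f Q a"
  unfolding saves_def
proof
  fix \<phi>
  let ?M = "M \<phi> a x"
  have a: "a \<in> later B f a x" using x(2) by (simp add: later_def)
  have M: "card (nb Q x) + card (later B f a x) \<le> card ?M" by (rule card_M[OF x(1)])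
  show "\<exists>F. finite F \<and> card F \<le> 5 \<and>
     (\<forall>\<psi>. (\<forall>u\<in>B. f u < f a \<longrightarrow> \<psi> u = \<phi> u) \<longrightarrow> \<psi> a \<notin> F \<longrightarrow> lcol Q (rest L B \<psi>))"
  proof (cases "card ?M \<le> 5")
    case True
    have "lcol Q (rest L B \<psi>)" if \<psi>: "\<forall>u\<in>B. f u < f a \<longrightarrow> \<psi> u = \<phi> u" "\<psi> a \<notin> ?M" for \<psi>
    proof (rule lcol_rest[OF x(1)])
      have "?M - \<psi> ` later B f a x = ?M - \<psi> ` (later B f a x - {a})" using \<psi>(2) by auto
      then have "card ?M - card (later B f a x - {a}) \<le> card (rest L B \<psi> x)"
        by (intro card_rest[OF \<psi>(1)]) auto
      then show "card (nb Q x) < card (rest L B \<psi> x)" using M card_later_pos[OF a] by linarith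
    qed
    then show ?thesis using True M_finite[OF x(1)] by (intro exI[of _ ?M]) auto
  next
    case False
    have "lcol Q (rest L B \<psi>)" if \<psi>: "\<forall>u\<in>B. f u < f a \<longrightarrow> \<psi> u = \<phi> u" for \<psi>
    proof (rule lcol_rest[OF x(1)])
      have "card ?M - card (later B f a x) \<le> card (rest L B \<psi> x)" by (intro card_rest[OF \<psi>]) auto
      then show "card (nb Q x) < card (rest L B \<psi> x)" using x(3) False by linarith
    qed
    then show ?thesis by (intro exI[of _ "{}"]) auto
  qed
qed

text \<open>In an end all remaining lists must agree for \<open>Q\<close> to be uncolourable, which is impossible once a
  colour shared by the lists of \<open>x\<close> and \<open>y\<close> disappears from only one of them.\<close>
lemma saves_pair:
  assumes U: "is_end Q U" and xy: "x \<in> U" "y \<in> U" and a: "a \<in> nb B x" "a \<notin> nb B y"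
    and later: "later B f a y \<subseteq> later B f a x"
    and d: "0 < card (nb Q x)" "card (nb Q x) + card (later B f a x) \<le> 6"
  shows "saves L B f Q a"
  unfolding saves_def
proof
  fix \<phi>
  let ?X = "M \<phi> a x" and ?Y = "M \<phi> a y"
  have UQ: "U \<subseteq> Q" using U by (simp add: is_end_def)
  have xQ: "x \<in> Q" and yQ: "y \<in> Q" using xy UQ by auto
  have al: "a \<in> later B f a x" using a(1) by (simp add: later_def)
  have M: "card (nb Q x) + card (later B f a x) \<le> card ?X" by (rule card_M[OF xQ])
  \<comment> \<open>In the last case \<open>?X\<close> has at most 6 colours and shares one with
    \<open>?Y\<close>, so at most 5 are forbidden. A surplus at \<open>x\<close>, or disjoint lists,
    already prevents the lists in the end from agreeing as they must.\<close>
  define F where "F = (if card (nb Q x) + card (later B f a x) < card ?X \<or> ?X \<inter> ?Y = {} then {} else ?X - ?Y)"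
  have "card F \<le> 5"
  proof (cases "F = {}")
    case False
    then have "F = ?X - ?Y" "?X \<inter> ?Y \<noteq> {}" "card ?X \<le> 6" using d(2) by (auto simp: F_def split: if_splits)
    moreover from this have "card (?X - ?Y) < card ?X"
      using M_finite[OF xQ] by (intro psubset_card_mono) auto
    ultimately show ?thesis by simp
  qed simp
  moreover have "finite F" using M_finite[OF xQ] by (simp add: F_def)
  moreover have "lcol Q (rest L B \<psi>)" if \<psi>: "\<forall>u\<in>B. f u < f a \<longrightarrow> \<psi> u = \<phi> u" "\<psi> a \<notin> F" for \<psi>
  proof (rule ccontr)
    assume no: "\<not> lcol Q (rest L B \<psi>)"
    have eq: "rest L B \<psi> y = rest L B \<psi> x" "card (rest L B \<psi> x) = card (nb Q x)"
      using end_lists[OF tight_rest no Q(2) U xy] by auto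
    note rx = rest_M[OF \<psi>(1), of x] and ry = rest_M[OF \<psi>(1), of y]
    have drop: False if "?X - \<psi> ` later B f a x = ?X - \<psi> ` (later B f a x - {a})"
    proof -
      have "card ?X - card (later B f a x - {a}) \<le> card (rest L B \<psi> x)"
        using that by (intro card_rest[OF \<psi>(1)]) auto
      then show False using M card_later_pos[OF al] eq(2) by linarith
    qed
    have "card ?X - card (later B f a x) \<le> card (rest L B \<psi> x)" by (rule card_rest[OF \<psi>(1)]) auto
    then have "\<not> card (nb Q x) + card (later B f a x) < card ?X" using eq(2) by linarith
    moreover have "?X \<inter> ?Y \<noteq> {}"
    proof -
      have "rest L B \<psi> x \<noteq> {}" using eq(2) d(1) by auto
      then obtain c where "c \<in> rest L B \<psi> x" by auto
      then have "c \<in> ?X" "c \<in> ?Y" using rx ry eq(1) by auto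
      then show ?thesis by auto
    qed
    ultimately have FX: "F = ?X - ?Y" by (simp add: F_def)
    have "\<psi> a \<in> ?X"
    proof (rule ccontr)
      assume "\<psi> a \<notin> ?X"
      then have "?X - \<psi> ` later B f a x = ?X - \<psi> ` (later B f a x - {a})" by auto
      then show False by (rule drop)
    qed
    \<comment> \<open>The colour of \<open>a\<close> lies in both lists and is gone at
      \<open>x\<close>, so it must be gone at \<open>y\<close>, where only a later neighbour
      \<open>b \<noteq> a\<close> can have removed it. As \<open>b\<close> is a later neighbour of
      \<open>x\<close> too, the colour is used twice at \<open>x\<close>, which leaves a spare
      one.\<close>
    then have "\<psi> a \<in> ?Y" using \<psi>(2) FX by auto
    moreover have "\<psi> a \<notin> rest L B \<psi> y" using eq(1) rx al by auto
    ultimately have "\<psi> a \<in> \<psi> ` later B f a y" using ry by auto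
    then obtain b where b: "b \<in> later B f a y" "\<psi> b = \<psi> a" by auto
    have "b \<noteq> a" using b(1) a(2) by (auto simp: later_def)
    then have "b \<in> later B f a x - {a}" using b(1) later by auto
    then have "\<psi> ` later B f a x = \<psi> ` (later B f a x - {a})" using b(2) by (metis image_eqI insert_Diff al image_insert insert_absorb)
    then show False using drop by simp
  qed
  ultimately show "\<exists>F. finite F \<and> card F \<le> 5 \<and>
     (\<forall>\<psi>. (\<forall>u\<in>B. f u < f a \<longrightarrow> \<psi> u = \<phi> u) \<longrightarrow> \<psi> a \<notin> F \<longrightarrow> lcol Q (rest L B \<psi>))"
    by blast
qed

text \<open>After \<open>a\<close> no list in \<open>Q\<close> changes any more, so it suffices to
  forbid the colours that block \<open>Q\<close> outright. They are few by
  \<open>few_blocking_colours\<close>, with the neighbourhood of \<open>a\<close> in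
  \<open>Q\<close> as \<open>T\<close>.\<close>

lemma saves_last:
  assumes K5: "\<And>C. C \<subseteq> V \<Longrightarrow> clique C \<Longrightarrow> card C \<le> 4"
    and a: "a \<in> B" "nb Q a \<noteq> {}" and last: "\<And>b v. v \<in> Q \<Longrightarrow> b \<in> nb B v \<Longrightarrow> f b \<le> f a"
  shows "saves L B f Q a"
  unfolding saves_def
proof
  fix \<phi>
  have lat: "later B f a v = (if v \<in> nb Q a then {a} else {})" if v: "v \<in> Q" for v
  proof -
    have "b = a" if "b \<in> later B f a v" for b
    proof -
      have "f b = f a" "b \<in> B" using that last[OF v, of b] by (auto simp: later_def nb_def)
      then show ?thesis using a(1) f by (simp add: inj_on_eq_iff)
    qed
    moreover have "a \<in> later B f a v \<longleftrightarrow> v \<in> nb Q a"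
      using v a(1) adj_sym by (auto simp: later_def nb_def)
    ultimately show ?thesis by auto
  qed
  have "\<exists>F. finite F \<and> card F \<le> 4 \<and>
    (\<forall>c. c \<notin> F \<longrightarrow> lcol Q (\<lambda>v. if v \<in> nb Q a then M \<phi> a v - {c} else M \<phi> a v))"
  proof (rule few_blocking_colours[OF K5 QV Q(2) nb_subset a(2)])
    fix v assume v: "v \<in> Q"
    show "finite (M \<phi> a v) \<and> card (nb Q v) + (if v \<in> nb Q a then 1 else 0) \<le> card (M \<phi> a v)"
      using card_M[OF v, of a \<phi>] lat[OF v] M_finite[OF v] by (auto split: if_splits)
  qed
  then obtain F where F: "finite F" "card F \<le> 4"
    "\<And>c. c \<notin> F \<Longrightarrow> lcol Q (\<lambda>v. if v \<in> nb Q a then M \<phi> a v - {c} else M \<phi> a v)" by blast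
  have "lcol Q (rest L B \<psi>)" if \<psi>: "\<forall>u\<in>B. f u < f a \<longrightarrow> \<psi> u = \<phi> u" "\<psi> a \<notin> F" for \<psi>
  proof (rule lcol_mono[OF F(3)[OF \<psi>(2)]])
    fix v assume "v \<in> Q"
    then show "(if v \<in> nb Q a then M \<phi> a v - {\<psi> a} else M \<phi> a v) \<subseteq> rest L B \<psi> v"
      using rest_M[OF \<psi>(1), of v] lat by auto
  qed
  then show "\<exists>F. finite F \<and> card F \<le> 5 \<and>
     (\<forall>\<psi>. (\<forall>u\<in>B. f u < f a \<longrightarrow> \<psi> u = \<phi> u) \<longrightarrow> \<psi> a \<notin> F \<longrightarrow> lcol Q (rest L B \<psi>))"
    using F(1,2) by (intro exI[of _ F]) auto
qed

text \<open>In the worst case all vertices of the end have degree 3 in \<open>Q\<close> and see all three vertices of \<open>A\<close>;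
  this is excluded by \<open>K33\<close>.\<close>
lemma saves_end:
  assumes K5: "\<And>C. C \<subseteq> V \<Longrightarrow> clique C \<Longrightarrow> card C \<le> 4"
    and K33: "\<And>S T. S \<subseteq> V \<Longrightarrow> T \<subseteq> V \<Longrightarrow> S \<inter> T = {} \<Longrightarrow> card S = 3 \<Longrightarrow> card T = 3 \<Longrightarrow>
        \<exists>s\<in>S. \<exists>t\<in>T. \<not> adj s t"
    and U: "is_end Q U" "x0 \<in> U" "a \<in> nb B x0"
    and A: "a \<in> A" "card A \<le> 3" "finite A" "\<And>x. x \<in> U \<Longrightarrow> later B f a x \<subseteq> A"
  shows "saves L B f Q a"
proof (cases "\<forall>\<psi>. lcol Q (rest L B \<psi>)")
  case True
  then show ?thesis by (intro saves_always) blast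
next
  case False
  then obtain \<psi>0 where no: "\<not> lcol Q (rest L B \<psi>0)" by blast
  have UQ: "U \<subseteq> Q" using U by (simp add: is_end_def)
  have deg: "card (nb Q x) = card (nb Q x0)" if "x \<in> U" for x
  proof -
    note el = end_lists[OF tight_rest no Q(2) U(1)]
    show ?thesis using el(2)[OF that U(2)] el(2)[OF U(2) U(2)] el(1)[OF U(2) that] by simp
  qed
  define d where "d = card (nb Q x0)"
  have d3: "d \<le> 3" unfolding d_def by (rule end_degree_le_3[OF K5 tight_rest no Q(2) U(1,2)])
  have l3: "card (later B f a x) \<le> 3" if "x \<in> U" for x
    using card_mono[OF A(3) A(4)[OF that]] A(2) by simp
  show ?thesis
  proof (cases "\<exists>x\<in>U. a \<in> nb B x \<and> d + card (later B f a x) \<le> 5")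
    case True
    then show ?thesis using saves_small[of _ a] deg UQ d_def by (metis subsetD)
  next
    case False
    \<comment> \<open>Both summands are at most 3, so a sum above 5 forces \<open>3 + 3\<close>, and
      the later neighbours are all of \<open>A\<close>.\<close>
    then have big: "d = 3" "later B f a x = A" "card A = 3" if "x \<in> U" "a \<in> nb B x" for x
    proof -
      have "\<not> d + card (later B f a x) \<le> 5" using False that by blast
      then show "d = 3" "card A = 3" using d3 l3[OF that(1)] card_mono[OF A(3) A(4)[OF that(1)]] A(2) by auto
      have "card A \<le> card (later B f a x)" using \<open>\<not> d + card (later B f a x) \<le> 5\<close> d3 A(2) by simp
      then show "later B f a x = A" using card_seteq[OF A(3) A(4)[OF that(1)]] by blast
    qed
    show ?thesis
    proof (cases "\<exists>y\<in>U. a \<notin> nb B y")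
      case True
      then obtain y where y: "y \<in> U" "a \<notin> nb B y" by blast
      show ?thesis
        by (rule saves_pair[OF U(1,2) y(1) U(3) y(2)])
          (use A(4)[OF y(1)] big[OF U(2,3)] d_def in auto)
    next
      case False
      have d: "d = 3" by (rule big(1)[OF U(2,3)])
      \<comment> \<open>At most one of the three neighbours of \<open>x0\<close> in \<open>Q\<close>
        lies outside the end, so the end has at least three vertices.\<close>
      have "nb Q x0 \<subseteq> (U - {x0}) \<union> bd Q U" by (rule end_nb[OF U(1,2)])
      moreover obtain w where "bd Q U \<subseteq> {w}" using U(1) by (auto simp: is_end_def)
      ultimately have "nb Q x0 \<subseteq> insert w (U - {x0})" by auto
      moreover have finU: "finite U" using UQ QV finite_subV by blast
      ultimately have "card (nb Q x0) \<le> card (insert w (U - {x0}))" by (intro card_mono) auto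
      also have "\<dots> \<le> card (U - {x0}) + 1" by (simp add: card_insert_if finU)
      finally have "2 \<le> card (U - {x0})" using d d_def by simp
      then have "3 \<le> card U" using U(2) finU by simp
      then obtain S where S: "S \<subseteq> U" "card S = 3" by (metis obtain_subset_with_card_n)
      have AB: "A \<subseteq> B" using big(2)[OF U(2,3)] by (auto simp: later_def nb_def)
      have "adj s t" if "s \<in> S" "t \<in> A" for s t
      proof -
        have "later B f a s = A" using big(2) S(1) that(1) False by blast
        then show ?thesis using that(2) by (auto simp: later_def nb_def)
      qed
      moreover have "S \<subseteq> V" "A \<subseteq> V" "S \<inter> A = {}" using S(1) UQ Q(1) AB B by auto
      ultimately show ?thesis using K33[of S A] S(2) big(3)[OF U(2,3)] by blast
    qed
  qed
qed

end

section \<open>Hall's theorem and elimination orders\<close>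

text \<open>The induction of Halmos and Vaughan: a critical proper subset is matched within its own
  neighbourhood and the rest outside it; if there is none, an arbitrary first choice does no
  harm.\<close>

lemma hall:
  assumes "finite S" "\<And>q. q \<in> S \<Longrightarrow> finite (A q)"
    and "\<And>T. T \<subseteq> S \<Longrightarrow> card T \<le> card (\<Union> (A ` T))"
  shows "\<exists>g. inj_on g S \<and> (\<forall>q\<in>S. g q \<in> A q)"
  using assms
proof (induction "card S" arbitrary: S A rule: less_induct)
  case less
  note finS = less.prems(1) and finA = less.prems(2) and H = less.prems(3)
  have finU: "finite (\<Union> (A ` T))" if "T \<subseteq> S" for T
    using that finS finA by (intro finite_UN_I) (auto intro: finite_subset)
  show ?case
  proof (cases "\<exists>T\<subset>S. T \<noteq> {} \<and> card (\<Union> (A ` T)) = card T")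
    case True
    then obtain T where T: "T \<subset> S" "T \<noteq> {}" "card (\<Union> (A ` T)) = card T" by blast
    have finT: "finite T" using T(1) finS finite_subset by blast
    obtain g1 where g1: "inj_on g1 T" "\<forall>q\<in>T. g1 q \<in> A q"
      using less.hyps[of T A] psubset_card_mono[OF finS T(1)] finT finA H T(1) by (meson order_trans psubsetD psubset_imp_subset)
    let ?N = "\<Union> (A ` T)"
    let ?A = "\<lambda>q. A q - ?N"
    have "\<exists>g. inj_on g (S - T) \<and> (\<forall>q\<in>S - T. g q \<in> ?A q)"
    proof (rule less.hyps)
      show "card (S - T) < card S" using T finS by (intro psubset_card_mono) auto
      fix R assume R: "R \<subseteq> S - T"
      have finR: "finite R" using R finS finite_subset by blast
      have "card R + card T = card (R \<union> T)" using R finR finT by (subst card_Un_disjoint) auto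
      also have "\<dots> \<le> card (\<Union> (A ` (R \<union> T)))" using R T(1) by (intro H) auto
      also have "\<Union> (A ` (R \<union> T)) = \<Union> (?A ` R) \<union> ?N" by auto
      also have "card \<dots> \<le> card (\<Union> (?A ` R)) + card ?N" by (rule card_Un_le)
      finally show "card R \<le> card (\<Union> (?A ` R))" using T(3) by simp
    qed (use finS finA in auto)
    then obtain g2 where g2: "inj_on g2 (S - T)" "\<forall>q\<in>S - T. g2 q \<in> ?A q" by blast
    let ?g = "\<lambda>q. if q \<in> T then g1 q else g2 q"
    have "inj_on ?g S"
    proof (rule inj_onI)
      fix q q' assume q: "q \<in> S" "q' \<in> S" "?g q = ?g q'"
      have mix: False if "x \<in> T" "y \<in> S - T" "g1 x = g2 y" for x y
        using bspec[OF g1(2) that(1)] bspec[OF g2(2) that(2)] that by auto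
      show "q = q'"
        using q mix[of q q'] mix[of q' q] inj_onD[OF g1(1), of q q'] inj_onD[OF g2(1), of q q']
        by (auto split: if_splits)
    qed
    moreover have "\<forall>q\<in>S. ?g q \<in> A q" using g1(2) g2(2) by auto
    ultimately show ?thesis by (intro exI[of _ ?g] conjI)
  next
    case False
    show ?thesis
    proof (cases "S = {}")
      case ne: False
      then obtain q where q: "q \<in> S" by auto
      have "1 \<le> card (A q)" using H[of "{q}"] q by simp
      then obtain a where a: "a \<in> A q" by (metis card.empty ex_in_conv not_one_le_zero)
      let ?A = "\<lambda>x. A x - {a}"
      have "\<exists>g. inj_on g (S - {q}) \<and> (\<forall>x\<in>S - {q}. g x \<in> ?A x)"
      proof (rule less.hyps)
        show "card (S - {q}) < card S" using q finS by (intro psubset_card_mono) auto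
        fix R assume R: "R \<subseteq> S - {q}"
        show "card R \<le> card (\<Union> (?A ` R))"
        proof (cases "R = {}")
          case R0: False
          have RS: "R \<subset> S" using R q by auto
          have "card R \<le> card (\<Union> (A ` R))" using RS by (intro H) auto
          moreover have "card (\<Union> (A ` R)) \<noteq> card R" using False RS R0 by blast
          moreover have "\<Union> (?A ` R) = \<Union> (A ` R) - {a}" by auto
          moreover have "card (\<Union> (A ` R)) - 1 \<le> card (\<Union> (A ` R) - {a})"
            by (simp add: card_Diff_singleton_if)
          ultimately show ?thesis by simp
        qed simp
      qed (use finS finA in auto)
      then obtain g where g: "inj_on g (S - {q})" "\<forall>x\<in>S - {q}. g x \<in> ?A x" by blast
      have ga: "g x \<noteq> a" if "x \<in> S - {q}" for x using bspec[OF g(2) that] by simp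
      have "inj_on (g(q := a)) S"
      proof (rule inj_onI)
        fix x y assume xy: "x \<in> S" "y \<in> S" "(g(q := a)) x = (g(q := a)) y"
        show "x = y"
          using xy ga[of x] ga[of y] inj_onD[OF g(1), of x y] by (auto split: if_splits)
      qed
      moreover have "\<forall>x\<in>S. (g(q := a)) x \<in> A x" using g(2) a by auto
      ultimately show ?thesis by blast
    qed simp
  qed
qed

text \<open>Each element is doubled by a \<open>bool\<close>, and Hall's theorem is applied to the
  copies.\<close>

lemma hall_capacity_two:
  assumes "finite S" "\<And>q. q \<in> S \<Longrightarrow> finite (A q)"
    and "\<And>T. T \<subseteq> S \<Longrightarrow> card T \<le> 2 * card (\<Union> (A ` T))"
  obtains g where "\<And>q. q \<in> S \<Longrightarrow> g q \<in> A q" "\<And>b. card {q \<in> S. g q = b} \<le> 2"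
proof -
  have "\<exists>g. inj_on g S \<and> (\<forall>q\<in>S. g q \<in> A q \<times> (UNIV :: bool set))"
  proof (rule hall[OF assms(1)])
    fix T assume T: "T \<subseteq> S"
    have "\<Union> ((\<lambda>q. A q \<times> (UNIV :: bool set)) ` T) = \<Union> (A ` T) \<times> UNIV" by auto
    then have "card (\<Union> ((\<lambda>q. A q \<times> (UNIV :: bool set)) ` T)) = card (\<Union> (A ` T)) * 2"
      by (simp add: card_cartesian_product)
    then show "card T \<le> card (\<Union> ((\<lambda>q. A q \<times> (UNIV :: bool set)) ` T))" using assms(3)[OF T] by simp
  qed (use assms(2) in auto)
  then obtain g where g: "inj_on g S" "\<forall>q\<in>S. g q \<in> A q \<times> (UNIV :: bool set)" by blast
  have two: "card {q \<in> S. fst (g q) = b} \<le> 2" for b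
  proof -
    have "card {q \<in> S. fst (g q) = b} \<le> card ({b} \<times> (UNIV :: bool set))"
    proof (rule card_inj_on_le)
      show "inj_on g {q \<in> S. fst (g q) = b}" using g(1) by (rule inj_on_subset) auto
      show "g ` {q \<in> S. fst (g q) = b} \<subseteq> {b} \<times> UNIV"
        by (simp add: image_subset_iff mem_Times_iff)
    qed simp
    then show ?thesis by (simp add: card_cartesian_product)
  qed
  show ?thesis
  proof (rule that[OF _ two])
    show "fst (g q) \<in> A q" if "q \<in> S" for q
      using bspec[OF g(2) that] by (simp add: mem_Times_iff)
  qed
qed

text \<open>The element picked from the whole set goes last, so the set it was picked from is the
  set of elements up to it. \<open>P\<close> may depend on this set; \<open>good_order\<close> uses
  that for more than degeneracy.\<close>

lemma elimination_order:
  assumes "finite B" "\<And>X. X \<subseteq> B \<Longrightarrow> X \<noteq> {} \<Longrightarrow> \<exists>c\<in>X. P c X"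
  shows "\<exists>f :: 'a \<Rightarrow> nat. inj_on f B \<and> (\<forall>v\<in>B. P v {u \<in> B. f u \<le> f v})"
  using assms
proof (induction B rule: finite_psubset_induct)
  case (psubset B)
  show ?case
  proof (cases "B = {}")
    case False
    then obtain c where c: "c \<in> B" "P c B" using psubset.prems by blast
    have "B - {c} \<subset> B" using c(1) by auto
    moreover have "\<exists>d\<in>X. P d X" if "X \<subseteq> B - {c}" "X \<noteq> {}" for X
      using psubset.prems[of X] that by auto
    ultimately obtain f :: "'a \<Rightarrow> nat" where f: "inj_on f (B - {c})"
      "\<forall>v\<in>B - {c}. P v {u \<in> B - {c}. f u \<le> f v}"
      using psubset.IH[of "B - {c}"] by blast
    define m where "m = Suc (sum f (B - {c}))"
    have lt: "f u < m" if "u \<in> B - {c}" for u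
      using member_le_sum[OF that, of f] psubset.hyps by (simp add: m_def)
    let ?f = "f(c := m)"
    have "inj_on ?f B"
    proof (rule inj_onI)
      fix x y assume xy: "x \<in> B" "y \<in> B" "?f x = ?f y"
      show "x = y"
        using xy lt[of x] lt[of y] inj_onD[OF f(1), of x y] by (auto split: if_splits)
    qed
    moreover have "P v {u \<in> B. ?f u \<le> ?f v}" if v: "v \<in> B" for v
    proof (cases "v = c")
      case True
      then have "{u \<in> B. ?f u \<le> ?f v} = B" using lt less_imp_le by auto
      then show ?thesis using c True by simp
    next
      case False
      then have "{u \<in> B. ?f u \<le> ?f v} = {u \<in> B - {c}. f u \<le> f v}"
        using lt[of v] v by auto
      then show ?thesis using f(2) False v by simp
    qed
    ultimately show ?thesis by blast
  qed simp
qed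

section \<open>Components and the greedy colouring\<close>

context sgraph
begin

definition pieces :: "'a set \<Rightarrow> 'a set set" where
  "pieces S = {Q. Q \<noteq> {} \<and> conn Q \<and> closed_in S Q}"

lemma pieces_subset: "Q \<in> pieces S \<Longrightarrow> Q \<subseteq> S"
  by (simp add: pieces_def closed_in_def)

lemma finite_pieces: "S \<subseteq> V \<Longrightarrow> finite (pieces S)"
  by (rule finite_subset[of _ "Pow V"]) (use pieces_subset finite_V in auto)

lemma closed_in_piece:
  assumes "Q \<in> pieces S" "closed_in S A" "Q \<inter> A \<noteq> {}"
  shows "Q \<subseteq> A"
proof -
  have "closed_in Q (Q \<inter> A)"
    using assms(2) pieces_subset[OF assms(1)] unfolding closed_in_def by blast
  then have "Q \<inter> A = Q" using connD assms(1,3) by (simp add: pieces_def)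
  then show ?thesis by auto
qed

lemma pieces_eq:
  assumes "Q \<in> pieces S" "Q' \<in> pieces S" "Q \<inter> Q' \<noteq> {}"
  shows "Q = Q'"
  using closed_in_piece[OF assms(1), of Q'] closed_in_piece[OF assms(2), of Q] assms
  by (auto simp: pieces_def)

text \<open>A smallest union of components containing \<open>v\<close> is connected, since otherwise
  a proper part of it would do.\<close>

lemma piece_exists:
  assumes "S \<subseteq> V" "v \<in> S"
  shows "\<exists>Q\<in>pieces S. v \<in> Q"
proof -
  have "\<exists>Q. closed_in S Q \<and> v \<in> Q" using assms(2) by (intro exI[of _ S]) (auto simp: closed_in_def)
  then obtain Q where Q: "closed_in S Q" "v \<in> Q"
    and mn: "\<And>Q'. closed_in S Q' \<Longrightarrow> v \<in> Q' \<Longrightarrow> card Q \<le> card Q'"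
    using ex_has_least_nat[of "\<lambda>Q. closed_in S Q \<and> v \<in> Q" _ card] by blast
  have QS: "Q \<subseteq> S" by (rule closed_in_subset[OF Q(1)])
  have finQ: "finite Q" using QS assms(1) by (intro finite_subV) auto
  have "conn Q"
    unfolding conn_closed_in
  proof (intro allI impI)
    fix A assume A: "closed_in Q A" "A \<noteq> {}"
    have AQ: "A \<subseteq> Q" by (rule closed_in_subset[OF A(1)])
    have up: "closed_in S A'" if "closed_in Q A'" for A'
      using that Q(1) QS unfolding closed_in_def by blast
    show "A = Q"
    proof (cases "v \<in> A")
      case True
      then show ?thesis using mn[OF up[OF A(1)]] card_seteq[OF finQ AQ] by blast
    next
      case False
      then have "card Q \<le> card (Q - A)" using mn[OF up[OF closed_in_Diff[OF A(1)]]] Q(2) by blast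
      moreover have "card (Q - A) < card Q" using A(2) AQ finQ by (intro psubset_card_mono) auto
      ultimately show ?thesis by simp
    qed
  qed
  then show ?thesis using Q by (auto simp: pieces_def)
qed

lemma lcol_pieces:
  assumes B: "B \<subseteq> V" "\<And>a. a \<in> B \<Longrightarrow> \<psi> a \<in> L a"
      "\<And>a b. a \<in> B \<Longrightarrow> b \<in> B \<Longrightarrow> adj a b \<Longrightarrow> \<psi> a \<noteq> \<psi> b"
    and Q: "\<And>Q. Q \<in> pieces (V - B) \<Longrightarrow> lcol Q (rest L B \<psi>)"
  shows "lcol V L"
proof -
  have "\<exists>\<phi>. (\<forall>v\<in>Q. \<phi> v \<in> rest L B \<psi> v) \<and> (\<forall>u\<in>Q. \<forall>v\<in>Q. adj u v \<longrightarrow> \<phi> u \<noteq> \<phi> v)"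
    if "Q \<in> pieces (V - B)" for Q using Q[OF that] by (simp add: lcol_def)
  then obtain \<phi> where \<phi>: "\<And>Q. Q \<in> pieces (V - B) \<Longrightarrow> \<forall>v\<in>Q. \<phi> Q v \<in> rest L B \<psi> v"
    "\<And>Q. Q \<in> pieces (V - B) \<Longrightarrow> \<forall>u\<in>Q. \<forall>v\<in>Q. adj u v \<longrightarrow> \<phi> Q u \<noteq> \<phi> Q v" by metis
  have "\<exists>Q\<in>pieces (V - B). v \<in> Q" if "v \<in> V - B" for v by (rule piece_exists) (use that in auto)
  then obtain h where h: "\<And>v. v \<in> V - B \<Longrightarrow> h v \<in> pieces (V - B)" "\<And>v. v \<in> V - B \<Longrightarrow> v \<in> h v" by metis
  define \<eta> where "\<eta> v = (if v \<in> B then \<psi> v else \<phi> (h v) v)" for v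
  have \<eta>1: "\<eta> v \<in> rest L B \<psi> v" if "v \<in> V - B" for v
    using \<phi>(1)[OF h(1)[OF that]] h(2)[OF that] that by (simp add: \<eta>_def)
  have cross: "\<eta> u \<noteq> \<eta> v" if "u \<in> B" "v \<in> V - B" "adj u v" for u v
  proof -
    have "u \<in> nb B v" using that adj_sym by (simp add: nb_def)
    then have "\<psi> u \<in> \<psi> ` nb B v" by (rule imageI)
    moreover have "\<eta> v \<notin> \<psi> ` nb B v" using \<eta>1[OF that(2)] by (simp add: rest_def)
    ultimately show ?thesis using that(1) by (auto simp: \<eta>_def)
  qed
  show ?thesis
    unfolding lcol_def
  proof (intro exI[of _ \<eta>] conjI ballI impI)
    show "\<eta> v \<in> L v" if "v \<in> V" for v
      using B(2)[of v] \<eta>1[of v] that by (cases "v \<in> B") (auto simp: \<eta>_def rest_def)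
    fix u v assume uv: "u \<in> V" "v \<in> V" "adj u v"
    consider "u \<in> B" "v \<in> B" | "u \<in> B" "v \<in> V - B" | "u \<in> V - B" "v \<in> B" | "u \<in> V - B" "v \<in> V - B"
      using uv by auto
    then show "\<eta> u \<noteq> \<eta> v"
    proof cases
      case 1 then show ?thesis using B(3) uv(3) by (simp add: \<eta>_def)
    next
      case 2 then show ?thesis using cross uv(3) by blast
    next
      case 3 then show ?thesis using cross[of v u] adj_sym[OF uv(3)] by metis
    next
      case 4
      have "v \<in> h u"
        using closed_inD[of "V - B" "h u" u v] h[OF 4(1)] 4(2) uv(3) by (simp add: pieces_def)
      then have "h u = h v" using pieces_eq[OF h(1)[OF 4(1)] h(1)[OF 4(2)]] h(2)[OF 4(2)] by blast
      then show ?thesis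
        using \<phi>(2)[OF h(1)[OF 4(1)]] h(2)[OF 4(1)] \<open>v \<in> h u\<close> uv(3) 4 by (simp add: \<eta>_def)
    qed
  qed
qed

text \<open>A vertex of \<open>B\<close> avoids at most 5 colours of earlier neighbours and 5 more for each of the at most
  two pieces it has to save.\<close>
lemma colouring_from_savers:
  assumes B: "B \<subseteq> V" and f: "inj_on f B"
    and early: "\<And>a. a \<in> B \<Longrightarrow> card {u \<in> nb B a. f u < f a} \<le> 5"
    and L: "\<And>a. a \<in> B \<Longrightarrow> finite (L a) \<and> 16 \<le> card (L a)"
    and g: "\<And>Q. Q \<in> pieces (V - B) \<Longrightarrow> g Q \<in> B \<and> saves L B f Q (g Q)"
    and load: "\<And>a. card {Q \<in> pieces (V - B). g Q = a} \<le> 2"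
  shows "lcol V L"
proof -
  let ?P = "pieces (V - B)"
  have finP: "finite ?P" by (rule finite_pieces) auto
  have finB: "finite B" by (rule finite_subV[OF B])
  have "\<exists>F. finite F \<and> card F \<le> 5 \<and>
     (\<forall>\<psi>. (\<forall>u\<in>B. f u < f (g Q) \<longrightarrow> \<psi> u = \<phi> u) \<longrightarrow> \<psi> (g Q) \<notin> F \<longrightarrow> lcol Q (rest L B \<psi>))"
    if "Q \<in> ?P" for Q \<phi>
    using conjunct2[OF g[OF that]] unfolding saves_def by blast
  then obtain F where F: "\<And>Q \<phi>. Q \<in> ?P \<Longrightarrow> finite (F Q \<phi>) \<and> card (F Q \<phi>) \<le> 5 \<and>
     (\<forall>\<psi>. (\<forall>u\<in>B. f u < f (g Q) \<longrightarrow> \<psi> u = \<phi> u) \<longrightarrow> \<psi> (g Q) \<notin> F Q \<phi> \<longrightarrow> lcol Q (rest L B \<psi>))"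
    by metis
  \<comment> \<open>Colours from \<open>a\<close> on are replaced by a default, so that
    \<open>F Q (cut \<psi> a)\<close> does not change when \<open>a\<close> and later vertices are
    coloured.\<close>
  define cut where "cut \<psi> a = (\<lambda>u. if f u < f a then \<psi> u else undefined)" for \<psi> :: "'a \<Rightarrow> 'b" and a
  define good where "good \<psi> b \<longleftrightarrow> \<psi> b \<in> L b \<and> (\<forall>u\<in>nb B b. f u < f b \<longrightarrow> \<psi> u \<noteq> \<psi> b) \<and>
    (\<forall>Q\<in>?P. g Q = b \<longrightarrow> \<psi> b \<notin> F Q (cut \<psi> b))" for \<psi> b
  have "\<exists>\<psi>. \<forall>b\<in>B. f b < n \<longrightarrow> good \<psi> b" for n
  proof (induction n)
    case (Suc n)
    then obtain \<psi> where \<psi>: "\<forall>b\<in>B. f b < n \<longrightarrow> good \<psi> b" by blast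
    show ?case
    proof (cases "\<exists>a\<in>B. f a = n")
      case False
      then show ?thesis using \<psi> by (metis less_Suc_eq)
    next
      case True
      then obtain a where a: "a \<in> B" "f a = n" by blast
      let ?N = "{u \<in> nb B a. f u < f a}"
      let ?G = "{Q \<in> ?P. g Q = a}"
      let ?X = "\<psi> ` ?N \<union> (\<Union>Q\<in>?G. F Q (cut \<psi> a))"
      have finN: "finite ?N" using finite_nb[OF B, of a] by simp
      have finG: "finite ?G" using finP by simp
      have "card (\<Union>Q\<in>?G. F Q (cut \<psi> a)) \<le> (\<Sum>Q\<in>?G. card (F Q (cut \<psi> a)))"
        by (rule card_UN_le[OF finG])
      also have "\<dots> \<le> (\<Sum>Q\<in>?G. 5)" using F by (intro sum_mono) auto
      also have "\<dots> \<le> 10" using load[of a] by simp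
      finally have "card (\<Union>Q\<in>?G. F Q (cut \<psi> a)) \<le> 10" .
      moreover have "card (\<psi> ` ?N) \<le> 5" using card_image_le[OF finN, of \<psi>] early[OF a(1)] by simp
      moreover have "card ?X \<le> card (\<psi> ` ?N) + card (\<Union>Q\<in>?G. F Q (cut \<psi> a))" by (rule card_Un_le)
      ultimately have cX: "card ?X < card (L a)" using L[OF a(1)] by simp
      have "finite ?X" using finN finG F by auto
      then have "\<not> L a \<subseteq> ?X" using card_mono[of ?X "L a"] cX by auto
      then obtain c where c: "c \<in> L a" "c \<notin> ?X" by auto
      have "good (\<psi>(a := c)) b" if b: "b \<in> B" "f b < Suc n" for b
      proof (cases "b = a")
        case True
        have "cut (\<psi>(a := c)) a = cut \<psi> a" by (auto simp: cut_def)
        then show ?thesis using c True by (auto simp: good_def)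
      next
        case False
        then have lt: "f b < n" using b a f by (metis inj_onD less_SucE)
        then have "cut (\<psi>(a := c)) b = cut \<psi> b" using a(2) by (auto simp: cut_def)
        moreover have "u \<noteq> a" if "f u < f b" for u using that lt a(2) by auto
        ultimately show ?thesis using \<psi> b(1) lt False by (auto simp: good_def)
      qed
      then show ?thesis by blast
    qed
  qed simp
  then obtain \<psi> where \<psi>: "\<forall>b\<in>B. f b < Suc (sum f B) \<longrightarrow> good \<psi> b" by blast
  have good: "good \<psi> b" if "b \<in> B" for b
    using \<psi> that member_le_sum[OF that, of f] finB by auto
  show ?thesis
  proof (rule lcol_pieces[OF B])
    show "\<psi> a \<in> L a" if "a \<in> B" for a using good[OF that] by (simp add: good_def)
    show "\<psi> a \<noteq> \<psi> b" if ab: "a \<in> B" "b \<in> B" "adj a b" for a b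
    proof -
      have "a \<noteq> b" using ab(3) adj_irrefl by auto
      then have "f a \<noteq> f b" using ab f by (auto dest: inj_onD)
      then consider "f a < f b" | "f b < f a" by linarith
      then show ?thesis
      proof cases
        case 1 then show ?thesis using good[OF ab(2)] ab adj_sym by (auto simp: good_def nb_def)
      next
        case 2 then show ?thesis using good[OF ab(1)] ab by (auto simp: good_def nb_def)
      qed
    qed
    fix Q assume Q: "Q \<in> ?P"
    have "\<psi> (g Q) \<notin> F Q (cut \<psi> (g Q))" using good g[OF Q] Q by (auto simp: good_def)
    then show "lcol Q (rest L B \<psi>)" using F[OF Q, of "cut \<psi> (g Q)"] by (auto simp: cut_def)
  qed
qed

end

section \<open>Consequences of planarity and 3-connectivity\<close>

context plane_graph
begin

lemma parts_singletons: "X \<subseteq> V \<Longrightarrow> parts ((\<lambda>x. {x}) ` X)"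
  by (auto simp: parts_def conn_singleton)

lemma card_singletons: "card ((\<lambda>x. {x}) ` X) = card X"
  by (rule card_image) (auto simp: inj_on_def)

lemma clique_card_le_4:
  assumes "C \<subseteq> V" "clique C"
  shows "card C \<le> 4"
proof (rule ccontr)
  assume "\<not> card C \<le> 4"
  then have "5 \<le> card C" by simp
  then obtain D where D: "D \<subseteq> C" "card D = 5" by (metis obtain_subset_with_card_n)
  let ?P = "(\<lambda>x. {x}) ` D"
  have finD: "finite D" using D(2) by (metis card.infinite zero_neq_numeral)
  have P: "parts ?P" using D(1) assms(1) by (intro parts_singletons) auto
  have cP: "card ?P = 5" using D(2) card_singletons by metis
  have "{{A, B} |A B. A \<in> ?P \<and> B \<in> ?P \<and> A \<noteq> B \<and> touch A B} = {e. e \<subseteq> ?P \<and> card e = 2}" (is "?E = ?E2")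
  proof
    show "?E \<subseteq> ?E2"
    proof
      fix e assume "e \<in> ?E"
      then obtain A B where "A \<in> ?P" "B \<in> ?P" "A \<noteq> B" "e = {A, B}" by blast
      then show "e \<in> ?E2" by simp
    qed
    show "?E2 \<subseteq> ?E"
    proof
      fix e assume e: "e \<in> ?E2"
      then obtain A B where AB: "e = {A, B}" "A \<noteq> B" by (auto simp: card_2_iff)
      then obtain x y where "A = {x}" "B = {y}" "x \<in> D" "y \<in> D" using e by auto
      moreover from this have "adj x y" using AB D(1) assms(2) by (auto simp: clique_def)
      ultimately show "e \<in> ?E" using AB by (auto simp: touch_def)
    qed
  qed
  moreover have "card ?E2 = 5 choose 2" using n_subsets[of ?P 2] finD cP by simp
  moreover have "(5::nat) choose 2 = 10" by (simp add: choose_two)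
  ultimately show False using parts_edges[OF P] cP by simp
qed

text \<open>Stated for branch sets, so that \<open>K\<^sub>3\<^sub>,\<^sub>3\<close> is excluded as
  a minor: nine touching pairs exceed \<open>2 * 6 - 4\<close>.\<close>

lemma no_K33:
  assumes P: "parts (\<A> \<union> \<B>)" "\<A> \<inter> \<B> = {}" "card \<A> = 3" "card \<B> = 3"
  shows "\<exists>A\<in>\<A>. \<exists>B\<in>\<B>. \<not> touch A B"
proof (rule ccontr)
  assume "\<not> ?thesis"
  then have "card (\<A> \<times> \<B>) + 4 \<le> 2 * (card \<A> + card \<B>)"
    using P by (intro parts_bipartite) auto
  then show False using P by (simp add: card_cartesian_product)
qed

lemma no_K33_verts:
  assumes "S \<subseteq> V" "T \<subseteq> V" "S \<inter> T = {}" "card S = 3" "card T = 3"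
  shows "\<exists>s\<in>S. \<exists>t\<in>T. \<not> adj s t"
proof -
  have "\<exists>A\<in>(\<lambda>x. {x}) ` S. \<exists>B\<in>(\<lambda>x. {x}) ` T. \<not> touch A B"
  proof (rule no_K33)
    have "parts ((\<lambda>x. {x}) ` (S \<union> T))" using assms by (intro parts_singletons) auto
    then show "parts ((\<lambda>x. {x}) ` S \<union> (\<lambda>x. {x}) ` T)" by (simp add: image_Un)
    show "(\<lambda>x. {x}) ` S \<inter> (\<lambda>x. {x}) ` T = {}" using assms(3) by auto
  qed (use assms card_singletons in metis)+
  then show ?thesis by (auto simp: touch_def)
qed

lemma degree_sum:
  assumes X: "X \<subseteq> V" "3 \<le> card X"
  shows "(\<Sum>x\<in>X. card (nb X x)) + 12 \<le> 6 * card X"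
proof -
  let ?P = "(\<lambda>x. {x}) ` X"
  let ?E = "{{A, B} |A B. A \<in> ?P \<and> B \<in> ?P \<and> A \<noteq> B \<and> touch A B}"
  let ?f = "\<lambda>e. {(x, y). e = {{x}, {y}}}"
  have P: "parts ?P" "card ?P = card X" using parts_singletons[OF X(1)] card_singletons by auto
  have finX: "finite X" by (rule finite_subV[OF X(1)])
  have finE: "finite ?E" by (rule finite_subset[of _ "Pow ?P"]) (use finX in auto)
  have two: "finite (?f e) \<and> card (?f e) \<le> 2" if "e \<in> ?E" for e
  proof -
    obtain x y where e: "e = {{x}, {y}}" using \<open>e \<in> ?E\<close> by auto
    have "(u, v) \<in> {(x, y), (y, x)}" if "e = {{u}, {v}}" for u v
      using that unfolding e by (simp add: doubleton_eq_iff) blast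
    then have sub: "?f e \<subseteq> {(x, y), (y, x)}" by blast
    have fin: "finite {(x, y), (y, x)}" by simp
    have "card (?f e) \<le> card {(x, y), (y, x)}" by (rule card_mono[OF fin sub])
    also have "\<dots> \<le> Suc (card {(y, x)})" by (rule card_insert_le_m1) simp_all
    also have "\<dots> = 2" by simp
    finally have "card (?f e) \<le> 2" .
    moreover have "finite (?f e)" by (rule finite_subset[OF sub fin])
    ultimately show ?thesis by (rule conjI[rotated])
  qed
  have "(\<Sum>x\<in>X. card (nb X x)) = card (SIGMA x:X. nb X x)"
    by (rule card_SigmaI[symmetric]) (use finX finite_nb[OF X(1)] in auto)
  also have "\<dots> \<le> card (\<Union>e\<in>?E. ?f e)"
  proof (rule card_mono)
    show "finite (\<Union>e\<in>?E. ?f e)" by (rule finite_UN_I[OF finE conjunct1[OF two]])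
    show "(SIGMA x:X. nb X x) \<subseteq> (\<Union>e\<in>?E. ?f e)"
    proof
      fix z assume "z \<in> (SIGMA x:X. nb X x)"
      then obtain x y where z: "z = (x, y)" "x \<in> X" "y \<in> X" "adj x y" by (auto simp: nb_def)
      have "x \<noteq> y" using z(4) adj_irrefl by auto
      then have "{{x}, {y}} \<in> ?E" using z by (auto simp: touch_def)
      moreover have "z \<in> ?f {{x}, {y}}" using z by simp
      ultimately show "z \<in> (\<Union>e\<in>?E. ?f e)" by blast
    qed
  qed
  also have "\<dots> \<le> (\<Sum>e\<in>?E. card (?f e))" by (rule card_UN_le[OF finE])
  also have "\<dots> \<le> (\<Sum>e\<in>?E. 2)" by (rule sum_mono[OF conjunct2[OF two]])
  finally have "(\<Sum>x\<in>X. card (nb X x)) \<le> 2 * card ?E" by simp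
  then show ?thesis using parts_edges[OF P(1)] P(2) X(2) by simp
qed

text \<open>The degree of the foreign vertex \<open>a\<close> is not controlled, but the count still
  works, because \<open>6 * card Y\<close> exceeds \<open>6 * (card Y + 1) - 12\<close>. With two
  foreign vertices both sides would be equal.\<close>

lemma low_degree:
  assumes "Y \<subseteq> V" "Y \<noteq> {}" "a \<in> V"
  shows "\<exists>c\<in>Y. card (nb (insert a Y) c) \<le> 5"
proof (rule ccontr)
  assume "\<not> ?thesis"
  then have big: "6 \<le> card (nb (insert a Y) c)" if "c \<in> Y" for c using that by force
  let ?X = "insert a Y"
  have XV: "?X \<subseteq> V" using assms by auto
  have fin: "finite ?X" "finite Y" using finite_subV[OF XV] by auto
  obtain c where c: "c \<in> Y" using assms(2) by auto
  have "6 \<le> card ?X" using big[OF c] card_mono[OF fin(1) nb_subset[of ?X c]] by simp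
  then have "(\<Sum>x\<in>?X. card (nb ?X x)) + 12 \<le> 6 * card ?X" using XV by (intro degree_sum) auto
  moreover have "(\<Sum>x\<in>Y. 6) \<le> (\<Sum>x\<in>Y. card (nb ?X x))" using big by (intro sum_mono)
  moreover have "(\<Sum>x\<in>Y. card (nb ?X x)) \<le> (\<Sum>x\<in>?X. card (nb ?X x))" using fin by (intro sum_mono2) auto
  moreover have "card ?X \<le> card Y + 1" by (simp add: card_insert_if fin)
  ultimately show False by simp
qed

end

text \<open>With \<open>k = 3\<close> this provides the last three candidates: a candidate that is
  not earlier than one of them is one of them.\<close>

lemma top_subset:
  fixes f :: "'a \<Rightarrow> nat"
  assumes "finite T" "inj_on f T" "k \<le> card T"
  shows "\<exists>A\<subseteq>T. card A = k \<and> (\<forall>a\<in>A. \<forall>t\<in>T. f a \<le> f t \<longrightarrow> t \<in> A)"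
  using assms(3)
proof (induction k)
  case 0
  then show ?case by (intro exI[of _ "{}"]) auto
next
  case (Suc k)
  then obtain A where A: "A \<subseteq> T" "card A = k" "\<forall>a\<in>A. \<forall>t\<in>T. f a \<le> f t \<longrightarrow> t \<in> A" by auto
  have finA: "finite A" using A(1) assms(1) finite_subset by blast
  have "T - A \<noteq> {}" using A(1,2) Suc.prems by auto
  then have "Max (f ` (T - A)) \<in> f ` (T - A)" using assms(1) by (intro Max_in) auto
  then obtain m where m0: "m \<in> T - A" "f m = Max (f ` (T - A))" by auto
  have m: "m \<in> T - A" "\<And>t. t \<in> T - A \<Longrightarrow> f t \<le> f m"
    using m0 assms(1) by auto
  have "t \<in> insert m A" if "a \<in> insert m A" "t \<in> T" "f a \<le> f t" for a t
  proof (cases "a = m \<and> t \<notin> A")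
    case True
    then have "f t = f m" using m(2)[of t] that by auto
    then have "t = m" using inj_onD[OF assms(2)] m(1) that(2) by blast
    then show ?thesis by simp
  qed (use A(3) that in blast)
  then show ?case using A m(1) finA by (intro exI[of _ "insert m A"]) auto
qed

locale three_connected_plane_graph = plane_graph V adj p \<gamma>
  for V :: "'a set" and adj :: "'a \<Rightarrow> 'a \<Rightarrow> bool" and p \<gamma> +
  assumes card_V: "3 < card V"
    and conn3: "S \<subseteq> V \<Longrightarrow> card S < 3 \<Longrightarrow> conn (V - S)"
begin

lemma no_small_cut:
  assumes "U \<subseteq> V" "U \<noteq> {}" "S \<subseteq> V" "U \<inter> S = {}" "V - U - S \<noteq> {}"
    and "\<And>u y. u \<in> U \<Longrightarrow> y \<in> V \<Longrightarrow> adj u y \<Longrightarrow> y \<in> U \<union> S"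
  shows "3 \<le> card S"
proof (rule ccontr)
  assume "\<not> 3 \<le> card S"
  then have "conn (V - S)" using conn3 assms(3) by simp
  moreover have "closed_in (V - S) U" using assms unfolding closed_in_def by blast
  ultimately have "U = V - S" using connD assms(2) by blast
  then show False using assms(5) by auto
qed

text \<open>The case without vertices of large degree. By 3-connectivity \<open>V\<close> is an end
  of itself and has degree at least 3, so it would be a clique if it were uncolourable.\<close>

lemma lcol_no_big:
  assumes L: "tight V L" and nc: "\<not> clique V"
  shows "lcol V L"
proof (rule ccontr)
  assume no: "\<not> lcol V L"
  have V0: "V \<noteq> {}" using card_V by auto
  then obtain u where u: "u \<in> V" by auto
  have cV: "conn V" using conn3[of "{}"] by simp
  have "is_end V V" using V0 cV conn3 by (auto simp: is_end_def bd_def)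
  moreover have "3 \<le> card (nb V u)"
  proof (cases "V - {u} - nb V u = {}")
    case True
    then have "V \<subseteq> insert u (nb V u)" by auto
    then have "card V \<le> card (insert u (nb V u))"
      using finite_nb[of V u] by (intro card_mono) auto
    then show ?thesis using card_V finite_nb[of V u] by (simp add: card_insert_if split: if_splits)
  next
    case False
    then show ?thesis
      using u adj_irrefl by (intro no_small_cut[of "{u}"]) (auto simp: nb_def)
  qed
  ultimately have "clique (V \<union> bd V V)" using end_clique[OF L no cV _ u] by blast
  then show False using nc by (auto simp: clique_def)
qed

end

section \<open>Neighbours of pieces and of their ends\<close>

locale big_vertices = three_connected_plane_graph V adj p \<gamma>
  for V :: "'a set" and adj :: "'a \<Rightarrow> 'a \<Rightarrow> bool" and p \<gamma> +
  fixes B :: "'a set"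
  assumes B: "B \<subseteq> V" "B \<noteq> {}"
begin

abbreviation \<Q> :: "'a set set" where "\<Q> \<equiv> pieces (V - B)"

definition nbB :: "'a set \<Rightarrow> 'a set" where
  "nbB U = {b \<in> B. \<exists>u\<in>U. adj u b}"

text \<open>Vertices of \<open>B\<close> that see \<open>Q\<close> only outside its ends are left
  out, because \<open>saves_end\<close> works with the lists in an end.\<close>

definition star :: "'a set \<Rightarrow> 'a set" where
  "star Q = \<Union> {nbB U |U. is_end Q U}"

lemma finB: "finite B"
  by (rule finite_subV[OF B(1)])

lemma nbB_subset: "nbB U \<subseteq> B" "finite (nbB U)"
  using finB finite_subset by (auto simp: nbB_def)

lemma star_subset: "star Q \<subseteq> nbB Q" "finite (star Q)"
proof -
  show "star Q \<subseteq> nbB Q" by (auto simp: star_def is_end_def nbB_def)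
  then show "finite (star Q)" using nbB_subset(2) finite_subset by blast
qed

lemma piece:
  assumes "Q \<in> \<Q>"
  shows "Q \<subseteq> V - B" "Q \<subseteq> V" "Q \<noteq> {}" "conn Q" "closed_in (V - B) Q"
  using assms by (auto simp: pieces_def closed_in_def)

lemma piece_boundary:
  assumes "Q \<in> \<Q>" "U \<subseteq> Q" "u \<in> U" "y \<in> V" "adj u y"
  shows "y \<in> U \<union> (nbB U \<union> bd Q U)"
  using assms closed_inD[OF piece(5)[OF assms(1)], of u y] by (auto simp: nbB_def bd_def)

text \<open>The neighbours of \<open>U\<close> separate it from a vertex of \<open>B\<close> that
  has no neighbour in \<open>U\<close>, so 3-connectivity applies.\<close>

lemma end_boundary:
  assumes Q: "Q \<in> \<Q>" and U: "U \<subseteq> Q" "U \<noteq> {}" and ne: "B - nbB U \<noteq> {}"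
  shows "3 \<le> card (nbB U \<union> bd Q U)"
proof (rule no_small_cut)
  show "U \<subseteq> V" "nbB U \<union> bd Q U \<subseteq> V" using U piece[OF Q] B by (auto simp: nbB_def bd_def)
  show "U \<inter> (nbB U \<union> bd Q U) = {}" using U piece[OF Q] by (auto simp: nbB_def bd_def)
  obtain b where b: "b \<in> B" "b \<notin> nbB U" using ne by auto
  then have "b \<notin> Q" "b \<in> V" using piece(1)[OF Q] B(1) by auto
  then have "b \<in> V - U - (nbB U \<union> bd Q U)" using b U(1) by (auto simp: bd_def)
  then show "V - U - (nbB U \<union> bd Q U) \<noteq> {}" by blast
qed (use piece_boundary[OF Q U(1)] U in auto)

text \<open>At most one vertex of the separator in \<open>end_boundary\<close> lies in
  \<open>Q\<close>. If \<open>U\<close> sees all of \<open>B\<close>, the bounds come from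
  \<open>3 \<le> card B\<close> instead.\<close>

lemma end_nbB:
  assumes Q: "Q \<in> \<Q>" and U: "is_end Q U" and B3: "3 \<le> card B"
  shows "2 \<le> card (nbB U)" "nbB U \<subseteq> star Q" "bd Q U = {} \<Longrightarrow> 3 \<le> card (nbB U)"
proof -
  show "nbB U \<subseteq> star Q" using U by (auto simp: star_def)
  have U': "U \<subseteq> Q" "U \<noteq> {}" using U by (auto simp: is_end_def)
  obtain w where w: "bd Q U \<subseteq> {w}" using U by (auto simp: is_end_def)
  show "2 \<le> card (nbB U)"
  proof (rule ccontr)
    assume H: "\<not> 2 \<le> card (nbB U)"
    have "B - nbB U \<noteq> {}"
    proof
      assume "B - nbB U = {}"
      then have "card B \<le> card (nbB U)" by (intro card_mono nbB_subset(2)) auto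
      then show False using B3 H by simp
    qed
    then have "3 \<le> card (nbB U \<union> bd Q U)" by (rule end_boundary[OF Q U'])
    also have "\<dots> \<le> card (nbB U) + card (bd Q U)" by (rule card_Un_le)
    also have "card (bd Q U) \<le> 1" using card_mono[OF _ w] by simp
    finally show False using H by simp
  qed
  assume bd0: "bd Q U = {}"
  show "3 \<le> card (nbB U)"
  proof (cases "B - nbB U = {}")
    case True
    then have "card B \<le> card (nbB U)" by (intro card_mono nbB_subset(2)) auto
    then show ?thesis using B3 by simp
  next
    case False
    then show ?thesis using end_boundary[OF Q U'] bd0 by simp
  qed
qed

lemma star_nonempty:
  assumes Q: "Q \<in> \<Q>"
  shows "star Q \<noteq> {}"
proof
  assume e: "star Q = {}"
  obtain U where U: "is_end Q U" using is_end_exists[OF piece(4,2,3)[OF Q]] by blast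
  then have e': "nbB U = {}" using e by (auto simp: star_def)
  have U': "U \<subseteq> Q" "U \<noteq> {}" using U by (auto simp: is_end_def)
  obtain w where w: "bd Q U \<subseteq> {w}" using U by (auto simp: is_end_def)
  have "3 \<le> card (nbB U \<union> bd Q U)" using e' B by (intro end_boundary[OF Q U']) simp
  moreover have "card (bd Q U) \<le> 1" using card_mono[OF _ w] by simp
  ultimately show False using e' by simp
qed

definition special :: "'a set \<Rightarrow> bool" where
  "special Q \<longleftrightarrow> Q \<in> \<Q> \<and> card (star Q) \<le> 2"

abbreviation sides :: "'a set \<Rightarrow> 'a set set" where
  "sides Q \<equiv> pieces (V - Q - star Q)"

text \<open>Otherwise the at most two vertices of \<open>star Q\<close> would separate
  \<open>D\<close> from \<open>Q\<close>. A neighbour of \<open>Q\<close> outside \<open>Q\<close>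
  always belongs to \<open>B\<close>.\<close>

lemma side_meets:
  assumes Q: "Q \<in> \<Q>" and st: "card (star Q) \<le> 2" and D: "D \<in> sides Q"
  obtains v d where "v \<in> Q" "d \<in> D" "d \<in> B" "adj v d"
proof -
  have DV: "D \<subseteq> V - Q - star Q" using pieces_subset[OF D] .
  have clD: "closed_in (V - Q - star Q) D" and D0: "D \<noteq> {}" using D by (auto simp: pieces_def)
  have stV: "star Q \<subseteq> V" "star Q \<inter> Q = {}"
    using star_subset[of Q] nbB_subset(1)[of Q] B piece[OF Q] by auto
  have "\<exists>d\<in>D. \<exists>v\<in>Q. adj d v"
  proof (rule ccontr)
    assume H: "\<not> ?thesis"
    have "3 \<le> card (star Q)"
    proof (rule no_small_cut[of D])
      show "V - D - star Q \<noteq> {}" using piece[OF Q] DV stV by auto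
      fix u y assume uy: "u \<in> D" "y \<in> V" "adj u y"
      then have "y \<notin> Q" using H by blast
      then show "y \<in> D \<union> star Q" using closed_inD[OF clD uy(1)] uy by auto
    qed (use DV D0 stV in auto)
    then show False using st by simp
  qed
  then obtain d v where dv: "d \<in> D" "v \<in> Q" "adj d v" by blast
  have "d \<in> B"
  proof (rule ccontr)
    assume "d \<notin> B"
    then have "d \<in> V - B" using dv(1) DV by auto
    then have "d \<in> Q" using closed_inD[OF piece(5)[OF Q] dv(2) _ adj_sym[OF dv(3)]] by blast
    then show False using dv(1) DV by auto
  qed
  then show ?thesis using that dv adj_sym by blast
qed

text \<open>All ends of a special piece see exactly \<open>star Q\<close> in \<open>B\<close> and
  have a boundary vertex in \<open>Q\<close>, so \<open>Q\<close> has a cut vertex and two disjoint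
  ends \<open>U1\<close> and \<open>U2\<close>. The rest \<open>R\<close> of \<open>Q\<close> is
  connected, and the neighbour of \<open>D\<close> in \<open>Q\<close> from
  \<open>side_meets\<close> lies in \<open>R\<close>. If \<open>D\<close> saw both \<open>a\<close>
  and \<open>b\<close>, then \<open>U1\<close>, \<open>U2\<close>, \<open>D\<close> on one side and
  \<open>{a}\<close>, \<open>{b}\<close>, \<open>R\<close> on the other would form a
  \<open>K\<^sub>3\<^sub>,\<^sub>3\<close>.\<close>

lemma special_structure:
  assumes sp: "special Q" and B3: "3 \<le> card B"
  obtains a b where "star Q = {a, b}" "a \<noteq> b"
    "\<And>D. D \<in> sides Q \<Longrightarrow> touch D {a} \<Longrightarrow> touch D {b} \<Longrightarrow> False"
proof -
  have Q: "Q \<in> \<Q>" and st: "card (star Q) \<le> 2" using sp by (auto simp: special_def)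
  note pQ = piece[OF Q]
  have nbU: "nbB U = star Q" if "is_end Q U" for U
    using card_seteq[OF star_subset(2) end_nbB(2)[OF Q that B3]] end_nbB(1)[OF Q that B3] st by simp
  obtain U0 where U0: "is_end Q U0" using is_end_exists[OF pQ(4,2,3)] by blast
  have "card (star Q) = 2" using end_nbB(1)[OF Q U0 B3] nbU[OF U0] st by simp
  then obtain a b where ab: "star Q = {a, b}" "a \<noteq> b" by (auto simp: card_2_iff)
  have abV: "a \<in> B" "b \<in> B" using star_subset(1)[of Q] nbB_subset(1)[of Q] ab by auto
  have bdne: "bd Q U \<noteq> {}" if "is_end Q U" for U
    using end_nbB(3)[OF Q that B3] nbU[OF that] st by force
  have "\<not> (\<forall>v\<in>Q. conn (Q - {v}))"
  proof
    assume "\<forall>v\<in>Q. conn (Q - {v})"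
    then have "is_end Q Q" using pQ by (auto simp: is_end_def bd_def)
    then show False using bdne[of Q] by (auto simp: bd_def)
  qed
  then obtain w A where w: "w \<in> Q" and A: "closed_in (Q - {w}) A" "A \<noteq> {}" "A \<noteq> Q - {w}"
    by (auto simp: conn_closed_in)
  let ?A = "Q - {w} - A"
  have AQ: "A \<subseteq> Q - {w}" by (rule closed_in_subset[OF A(1)])
  have A': "closed_in (Q - {w}) ?A" "?A \<noteq> {}" "?A \<noteq> Q - {w}"
    using closed_in_Diff[OF A(1)] A AQ by auto
  obtain U1 where U1: "U1 \<subseteq> A" "is_end Q U1" using end_exists_within[OF pQ(4,2) w A] by blast
  obtain U2 where U2: "U2 \<subseteq> ?A" "is_end Q U2" using end_exists_within[OF pQ(4,2) w A'] by blast
  have U1Q: "U1 \<subseteq> Q" "U1 \<noteq> {}" "conn U1" and U2Q: "U2 \<subseteq> Q" "U2 \<noteq> {}" "conn U2"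
    using U1(2) U2(2) by (auto simp: is_end_def)
  have dis: "U1 \<inter> U2 = {}" using U1(1) U2(1) by auto
  define R where "R = Q - U1 - U2"
  have bdR: "bd Q U1 \<subseteq> R" "bd Q U2 \<subseteq> R"
  proof -
    have "y \<notin> U2" if "u \<in> U1" "y \<in> Q" "adj u y" for u y
      using closed_inD[OF A(1), of u y] that U1(1) U2(1) by auto
    then show "bd Q U1 \<subseteq> R" by (auto simp: R_def bd_def)
    have "y \<notin> U1" if "u \<in> U2" "y \<in> Q" "adj u y" for u y
      using closed_inD[OF A'(1), of u y] that U1(1) U2(1) AQ by auto
    then show "bd Q U2 \<subseteq> R" by (auto simp: R_def bd_def)
  qed
  have wR: "w \<in> R" using w U1(1) U2(1) AQ by (auto simp: R_def)
  have conR: "conn R"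
  proof -
    obtain w2 where "bd Q U2 \<subseteq> {w2}" using U2(2) by (auto simp: is_end_def)
    then have "bd (Q - U1) U2 \<subseteq> {w2}" by (auto simp: bd_def)
    then show ?thesis
      unfolding R_def using U2Q dis by (intro conn_Diff[OF conn_Diff_end[OF pQ(4) U1(2)]]) auto
  qed
  have False if D: "D \<in> sides Q" and t: "touch D {a}" "touch D {b}" for D
  proof -
    have DV: "D \<subseteq> V - Q - star Q" using pieces_subset[OF D] .
    have D0: "D \<noteq> {}" "conn D" using D by (auto simp: pieces_def)
    obtain v d where vd: "v \<in> Q" "d \<in> D" "d \<in> B" "adj v d" using side_meets[OF Q st D] by blast
    have "v \<notin> U" if "is_end Q U" for U
    proof
      assume "v \<in> U"
      then have "d \<in> nbB U" using vd by (auto simp: nbB_def)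
      then show False using nbU[OF that] DV vd(2) by auto
    qed
    then have "v \<in> R" using vd(1) U1(2) U2(2) by (auto simp: R_def)
    then have DR: "touch D R" using vd adj_sym by (auto simp: touch_def)
    have UR: "touch U1 R" "touch U2 R"
      using bdne[OF U1(2)] bdne[OF U2(2)] bdR unfolding touch_def bd_def by blast+
    have Uab: "touch U {a}" "touch U {b}" if "is_end Q U" for U
    proof -
      have "a \<in> nbB U" "b \<in> nbB U" using nbU[OF that] ab by auto
      then show "touch U {a}" "touch U {b}" by (auto simp: nbB_def touch_def)
    qed
    let ?\<A> = "{U1, U2, D}" and ?\<B> = "{{a}, {b}, R}"
    have abQ: "a \<notin> Q" "b \<notin> Q" "a \<notin> D" "b \<notin> D" "a \<in> V" "b \<in> V"
      using abV pQ B ab DV by auto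
    have RQ: "R \<subseteq> Q" by (auto simp: R_def)
    have DQ: "D \<inter> Q = {}" using DV by auto
    have "parts (?\<A> \<union> ?\<B>)"
      unfolding parts_def
    proof (intro conjI ballI impI)
      show "X \<subseteq> V" "X \<noteq> {}" "conn X" if "X \<in> ?\<A> \<union> ?\<B>" for X
        using that U1Q U2Q D0 DV RQ pQ wR conR conn_singleton abQ by auto
      have d: "U1 \<inter> D = {}" "U2 \<inter> D = {}" "R \<inter> D = {}" "U1 \<inter> R = {}" "U2 \<inter> R = {}"
        using U1Q U2Q RQ DQ by (auto simp: R_def)
      have e: "a \<notin> U1" "a \<notin> U2" "a \<notin> R" "b \<notin> U1" "b \<notin> U2" "b \<notin> R"
        using abQ U1Q U2Q RQ by auto
      show "X \<inter> Y = {}" if "X \<in> ?\<A> \<union> ?\<B>" "Y \<in> ?\<A> \<union> ?\<B>" "X \<noteq> Y" for X Y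
        using that d e dis abQ ab(2) by (elim UnE insertE emptyE) (auto simp: Int_commute)
    qed
    moreover have ne: "U1 \<noteq> U2" "U1 \<noteq> D" "U2 \<noteq> D" "{a} \<noteq> R" "{b} \<noteq> R" "{a} \<noteq> {b}"
      using dis U1Q U2Q D0 DQ RQ abQ ab(2) wR by auto
    moreover have "?\<A> \<inter> ?\<B> = {}"
    proof -
      have "R \<noteq> U1" "R \<noteq> U2" "R \<noteq> D" using wR U1(1) U2(1) AQ w DQ by auto
      moreover have "{a} \<noteq> U1" "{a} \<noteq> U2" "{a} \<noteq> D" "{b} \<noteq> U1" "{b} \<noteq> U2" "{b} \<noteq> D"
        using abQ U1Q U2Q by auto
      ultimately show ?thesis by auto
    qed
    ultimately have "\<exists>A\<in>?\<A>. \<exists>B\<in>?\<B>. \<not> touch A B" by (intro no_K33) auto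
    then show False using DR UR Uab[OF U1(2)] Uab[OF U2(2)] t by auto
  qed
  then show ?thesis using that ab by blast
qed

end

section \<open>The colouring order\<close>

context big_vertices
begin

lemma star_nb:
  assumes "x \<in> star Q"
  obtains v where "v \<in> Q" "adj v x" "adj x v" "x \<in> B"
proof -
  obtain v where "v \<in> Q" "adj v x" "x \<in> B"
    using assms star_subset(1)[of Q] by (auto simp: nbB_def)
  then show ?thesis using that adj_sym by blast
qed

text \<open>With a root \<open>\<rho>\<close> fixed, the chosen sides are nested wherever they could block each other, so an
  innermost one can be placed last in the order.\<close>
definition movable :: "'a \<Rightarrow> 'a set \<Rightarrow> bool" where
  "movable \<rho> Q \<longleftrightarrow> (\<exists>D\<in>sides Q. \<rho> \<notin> D)"

definition side :: "'a \<Rightarrow> 'a set \<Rightarrow> 'a set" where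
  "side \<rho> Q = (SOME D. D \<in> sides Q \<and> \<rho> \<notin> D)"

lemma side:
  assumes "movable \<rho> Q"
  shows "side \<rho> Q \<in> sides Q" "\<rho> \<notin> side \<rho> Q"
  using assms someI_ex[of "\<lambda>D. D \<in> sides Q \<and> \<rho> \<notin> D"] unfolding movable_def side_def by blast+

text \<open>All sides contain \<open>\<rho>\<close>, so there is only one. It misses one of the two
  vertices of \<open>star Q\<close>, whose neighbours then have nowhere else to be.\<close>

lemma not_movable:
  assumes sp: "special Q" and B3: "3 \<le> card B" and nm: "\<not> movable \<rho> Q"
  obtains b where "b \<in> star Q" "nb V b \<subseteq> Q \<union> star Q"
proof -
  have Q: "Q \<in> \<Q>" using sp by (simp add: special_def)
  obtain a b where ab: "star Q = {a, b}" "a \<noteq> b"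
    and no: "\<And>D. D \<in> sides Q \<Longrightarrow> touch D {a} \<Longrightarrow> touch D {b} \<Longrightarrow> False"
    using special_structure[OF sp B3] by blast
  have "\<not> B \<subseteq> star Q"
  proof
    assume "B \<subseteq> star Q"
    then have "card B \<le> card (star Q)" by (rule card_mono[OF star_subset(2)])
    then show False using B3 sp by (simp add: special_def)
  qed
  then obtain c where c: "c \<in> B" "c \<notin> star Q" by auto
  then have "c \<in> V - Q - star Q" using B piece(1)[OF Q] by auto
  then obtain D where D: "D \<in> sides Q" using piece_exists[of "V - Q - star Q" c] by blast
  have rho: "\<rho> \<in> D'" if "D' \<in> sides Q" for D' using nm that by (auto simp: movable_def)
  have all: "v \<in> D" if "v \<in> V - Q - star Q" for v
  proof -
    obtain D' where D': "D' \<in> sides Q" "v \<in> D'"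
      using piece_exists[of "V - Q - star Q" v] \<open>v \<in> V - Q - star Q\<close> by blast
    then show ?thesis using pieces_eq[OF D'(1) D] rho[OF D] rho[OF D'(1)] by blast
  qed
  have "nb V x \<subseteq> Q \<union> star Q" if "\<not> touch D {x}" for x
  proof
    fix y assume y: "y \<in> nb V x"
    show "y \<in> Q \<union> star Q"
    proof (rule ccontr)
      assume "y \<notin> Q \<union> star Q"
      then have "y \<in> D" using y all by (auto simp: nb_def)
      then show False using that y adj_sym by (auto simp: touch_def nb_def)
    qed
  qed
  then show ?thesis using that[of a] that[of b] no[OF D] ab by blast
qed

text \<open>\<open>\<rho>\<close> lies in \<open>Q\<close> or in a side of \<open>Q\<close> other
  than the chosen one. If \<open>side \<rho> Q'\<close> left \<open>side \<rho> Q\<close>, it would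
  meet \<open>star Q\<close>, \<open>Q\<close> or another side, hence contain \<open>Q\<close>,
  hence all other sides too, and with them \<open>\<rho>\<close>. Being outside \<open>B\<close>
  keeps \<open>\<rho>\<close> off \<open>star Q\<close>.\<close>

lemma side_nested:
  assumes sp: "special Q" "special Q'" and mv: "movable \<rho> Q" "movable \<rho> Q'" and B3: "3 \<le> card B"
    and rho: "\<rho> \<in> V - B" and c: "c \<in> side \<rho> Q" "c \<in> star Q'"
  shows "side \<rho> Q' \<subseteq> side \<rho> Q - {c}"
proof -
  let ?D = "side \<rho> Q" and ?D' = "side \<rho> Q'"
  note D = side[OF mv(1)] and D' = side[OF mv(2)]
  have Q: "Q \<in> \<Q>" and Q': "Q' \<in> \<Q>" and st: "card (star Q) \<le> 2" using sp by (auto simp: special_def)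
  have DV: "?D \<subseteq> V - Q - star Q" using pieces_subset[OF D(1)] .
  have clD: "closed_in (V - Q - star Q) ?D" using D(1) by (simp add: pieces_def)
  have D'V: "?D' \<subseteq> V - Q' - star Q'" using pieces_subset[OF D'(1)] .
  have clD': "closed_in (V - Q' - star Q') ?D'" using D'(1) by (simp add: pieces_def)
  obtain a b where ab: "star Q = {a, b}" "a \<noteq> b"
    and no: "\<And>D. D \<in> sides Q \<Longrightarrow> touch D {a} \<Longrightarrow> touch D {b} \<Longrightarrow> False"
    using special_structure[OF sp(1) B3] by blast
  have abB: "a \<in> B" "b \<in> B" using star_subset(1)[of Q] nbB_subset(1)[of Q] ab by auto
  have ab_adj: "\<exists>v\<in>Q. adj x v" if "x \<in> star Q" for x
    using star_nb[OF that] by blast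
  have "Q \<inter> Q' = {}"
  proof (rule ccontr)
    assume "Q \<inter> Q' \<noteq> {}"
    then have "Q = Q'" by (rule pieces_eq[OF Q Q'])
    then show False using c DV by auto
  qed
  have "Q' \<subseteq> ?D"
  proof -
    obtain v where v: "v \<in> Q'" "adj c v" using star_nb[OF c(2)] by blast
    have sub: "Q' \<subseteq> V - Q - star Q" using piece[OF Q'] \<open>Q \<inter> Q' = {}\<close> abB ab(1) by auto
    then have "v \<in> ?D" using closed_inD[OF clD c(1) _ v(2)] v(1) by blast
    moreover have "closed_in Q' (Q' \<inter> ?D)" using clD sub unfolding closed_in_def by blast
    ultimately have "Q' \<inter> ?D = Q'" using connD[OF piece(4)[OF Q']] v(1) by blast
    then show ?thesis by auto
  qed
  have Q_in: "Q \<subseteq> ?D'" if "z \<in> ?D'" "z \<in> Q \<or> (\<exists>v\<in>Q. adj z v)" for z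
  proof -
    have sub: "Q \<subseteq> V - Q' - star Q'"
    proof -
      have "star Q' \<subseteq> B" using star_subset(1)[of Q'] nbB_subset(1)[of Q'] by auto
      then show ?thesis using piece[OF Q] \<open>Q \<inter> Q' = {}\<close> by auto
    qed
    have "Q \<inter> ?D' \<noteq> {}" using that closed_inD[OF clD'] sub by blast
    moreover have "closed_in Q (Q \<inter> ?D')" using clD' sub unfolding closed_in_def by blast
    ultimately have "Q \<inter> ?D' = Q" using connD[OF piece(4)[OF Q]] by blast
    then show ?thesis by auto
  qed
  have side_in: "E \<subseteq> ?D' \<longleftrightarrow> E \<inter> ?D' \<noteq> {}" "E \<inter> ?D' \<noteq> {} \<longleftrightarrow> Q \<subseteq> ?D'"
    if E: "E \<in> sides Q" "E \<noteq> ?D" for E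
  proof -
    have EV: "E \<subseteq> V - Q - star Q" using pieces_subset[OF E(1)] .
    have ED: "E \<inter> ?D = {}" using pieces_eq[OF E(1) D(1)] E(2) by blast
    have E0: "E \<noteq> {}" "conn E" using E(1) by (auto simp: pieces_def)
    have st': "x \<notin> E" if "x \<in> star Q'" for x
    proof
      assume x: "x \<in> E"
      obtain v where "v \<in> Q'" "adj x v"
        using star_nb[OF \<open>x \<in> star Q'\<close>] by blast
      then have "x \<in> ?D" using closed_inD[OF clD, of v x] \<open>Q' \<subseteq> ?D\<close> adj_sym x EV by blast
      then show False using x ED by auto
    qed
    have sub: "E \<subseteq> V - Q' - star Q'" using EV ED \<open>Q' \<subseteq> ?D\<close> st' by auto
    have "closed_in E (E \<inter> ?D')" using clD' sub unfolding closed_in_def by blast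
    then have 1: "E \<subseteq> ?D'" if "E \<inter> ?D' \<noteq> {}" using connD[OF E0(2)] that by blast
    then show "E \<subseteq> ?D' \<longleftrightarrow> E \<inter> ?D' \<noteq> {}" using E0(1) by blast
    obtain v d where vd: "v \<in> Q" "d \<in> E" "adj v d" using side_meets[OF Q st E(1)] by blast
    show "E \<inter> ?D' \<noteq> {} \<longleftrightarrow> Q \<subseteq> ?D'"
    proof
      assume "E \<inter> ?D' \<noteq> {}"
      then have "d \<in> ?D'" using 1 vd(2) by blast
      then show "Q \<subseteq> ?D'" using Q_in vd adj_sym by blast
    next
      assume "Q \<subseteq> ?D'"
      then have "d \<in> ?D'" using closed_inD[OF clD', of v d] vd sub by blast
      then show "E \<inter> ?D' \<noteq> {}" using vd(2) by blast
    qed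
  qed
  have rhoV: "\<rho> \<in> Q \<or> (\<exists>E\<in>sides Q. E \<noteq> ?D \<and> \<rho> \<in> E)"
  proof (cases "\<rho> \<in> Q")
    case False
    then have "\<rho> \<in> V - Q - star Q" using rho abB ab(1) by auto
    then obtain E where E: "E \<in> sides Q" "\<rho> \<in> E" using piece_exists[of "V - Q - star Q" \<rho>] by blast
    then show ?thesis using D(2) by blast
  qed simp
  have nQ: "\<not> Q \<subseteq> ?D'"
  proof
    assume QD: "Q \<subseteq> ?D'"
    from rhoV have "\<rho> \<in> ?D'"
    proof
      assume "\<exists>E\<in>sides Q. E \<noteq> ?D \<and> \<rho> \<in> E"
      then obtain E where E: "E \<in> sides Q" "E \<noteq> ?D" "\<rho> \<in> E" by blast
      then have "E \<inter> ?D' \<noteq> {}" using side_in(2)[OF E(1,2)] QD by simp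
      then have "E \<subseteq> ?D'" using side_in(1)[OF E(1,2)] by simp
      then show ?thesis using E(3) by (rule subsetD)
    qed (rule subsetD[OF QD])
    then show False using D'(2) by simp
  qed
  have "z \<in> ?D" if z: "z \<in> ?D'" for z
  proof (rule ccontr)
    assume nz: "z \<notin> ?D"
    consider "z \<in> Q" | "z \<in> star Q" | "z \<in> V - Q - star Q" using z D'V by auto
    then show False
    proof cases
      case 1 then show ?thesis using Q_in[OF z] nQ by simp
    next
      case 2 then show ?thesis using Q_in[OF z] ab_adj[OF 2] nQ by simp
    next
      case 3
      then obtain E where E: "E \<in> sides Q" "z \<in> E" using piece_exists[of "V - Q - star Q" z] by blast
      then have "E \<noteq> ?D" using nz by auto
      moreover have "E \<inter> ?D' \<noteq> {}" using E(2) z by auto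
      ultimately show ?thesis using side_in(2)[OF E(1)] nQ by simp
    qed
  qed
  moreover have "c \<notin> ?D'" using c(2) D'V by auto
  ultimately show ?thesis by blast
qed

lemma card_earlier_le:
  fixes f :: "'a \<Rightarrow> nat"
  shows "card {u \<in> nb B a. f u < f a} \<le> card (nb {u \<in> B. f u \<le> f a} a)"
  using B(1) by (intro card_mono finite_nb) (auto simp: nb_def)

text \<open>The order is built from its end. By the second half of \<open>P\<close>, a vertex of a
  star is not picked as long as the chosen side of that piece meets \<open>X\<close>. If some chosen
  side meets \<open>X\<close>, then one with the smallest intersection supplies \<open>c\<close>:
  its degree is low since the side sees at most one star vertex, and it is admissible since by
  \<open>side_nested\<close> a side that blocks \<open>c\<close> would have a smaller
  intersection.\<close>

lemma good_order:
  assumes B3: "3 \<le> card B" and rho: "\<rho> \<in> V - B"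
  shows "\<exists>f :: 'a \<Rightarrow> nat. inj_on f B \<and> (\<forall>a\<in>B. card {u \<in> nb B a. f u < f a} \<le> 5) \<and>
    (\<forall>Q a d. special Q \<longrightarrow> movable \<rho> Q \<longrightarrow> a \<in> star Q \<longrightarrow> d \<in> side \<rho> Q \<inter> B \<longrightarrow> f a < f d)"
proof -
  let ?S = "{Q. special Q \<and> movable \<rho> Q}"
  define P where "P c X \<longleftrightarrow> card (nb X c) \<le> 5 \<and> (\<forall>Q\<in>?S. c \<in> star Q \<longrightarrow> side \<rho> Q \<inter> X = {})" for c X
  have "\<exists>c\<in>X. P c X" if X: "X \<subseteq> B" "X \<noteq> {}" for X
  proof (cases "\<exists>Q\<in>?S. side \<rho> Q \<inter> X \<noteq> {}")
    case False
    obtain a where a: "a \<in> X" using X(2) by auto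
    have "X \<subseteq> V" using X(1) B(1) by auto
    then obtain c where "c \<in> X" "card (nb (insert a X) c) \<le> 5"
      using low_degree[of X a] a X(2) by auto
    then show ?thesis using False a unfolding P_def by (metis insert_absorb)
  next
    case True
    have finX: "finite X" using X(1) finB finite_subset by blast
    obtain Q where Q: "Q \<in> ?S" "side \<rho> Q \<inter> X \<noteq> {}"
      and mn: "\<And>Q'. Q' \<in> ?S \<Longrightarrow> side \<rho> Q' \<inter> X \<noteq> {} \<Longrightarrow> card (side \<rho> Q \<inter> X) \<le> card (side \<rho> Q' \<inter> X)"
      using True ex_has_least_nat[of "\<lambda>Q. Q \<in> ?S \<and> side \<rho> Q \<inter> X \<noteq> {}" _ "\<lambda>Q. card (side \<rho> Q \<inter> X)"]
      by blast
    have sp: "special Q" and mv: "movable \<rho> Q" using Q(1) by auto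
    have QQ: "Q \<in> \<Q>" using sp by (simp add: special_def)
    note D = side[OF mv]
    let ?D = "side \<rho> Q"
    obtain a b where ab: "star Q = {a, b}" and "a \<noteq> b"
      and no: "\<And>D. D \<in> sides Q \<Longrightarrow> touch D {a} \<Longrightarrow> touch D {b} \<Longrightarrow> False"
      using special_structure[OF sp B3] by blast
    have abB: "a \<in> B" "b \<in> B" using star_subset(1)[of Q] nbB_subset(1)[of Q] ab by auto
    have clD: "closed_in (V - Q - star Q) ?D" using D(1) by (simp add: pieces_def)
    \<comment> \<open>\<open>x\<close> is the one star vertex that the side may see; it is the
      foreign vertex in \<open>low_degree\<close>.\<close>
    have "\<exists>x\<in>B. \<forall>c\<in>?D. nb X c \<subseteq> nb (insert x (?D \<inter> X)) c"
    proof -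
      have nbD: "y \<in> ?D \<or> y = a \<or> y = b" if "c \<in> ?D" "y \<in> X" "adj c y" for c y
      proof -
        have "y \<in> V - Q" using that(2) X(1) B(1) piece(1)[OF QQ] by auto
        then show ?thesis using closed_inD[OF clD that(1) _ that(3)] ab by auto
      qed
      have "\<not> touch ?D {a} \<or> \<not> touch ?D {b}" using no[OF D(1)] by blast
      then show ?thesis
      proof
        assume "\<not> touch ?D {a}"
        then have "\<forall>c\<in>?D. nb X c \<subseteq> nb (insert b (?D \<inter> X)) c"
          using nbD by (auto simp: nb_def touch_def)
        then show ?thesis using abB by blast
      next
        assume "\<not> touch ?D {b}"
        then have "\<forall>c\<in>?D. nb X c \<subseteq> nb (insert a (?D \<inter> X)) c"
          using nbD by (auto simp: nb_def touch_def)
        then show ?thesis using abB by blast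
      qed
    qed
    then obtain x where x: "x \<in> B" "\<And>c. c \<in> ?D \<Longrightarrow> nb X c \<subseteq> nb (insert x (?D \<inter> X)) c" by blast
    have YV: "?D \<inter> X \<subseteq> V" "x \<in> V" using X(1) B(1) x(1) by auto
    obtain c where c: "c \<in> ?D \<inter> X" "card (nb (insert x (?D \<inter> X)) c) \<le> 5"
      using low_degree[OF YV(1) Q(2) YV(2)] by blast
    have "card (nb X c) \<le> card (nb (insert x (?D \<inter> X)) c)"
      using c(1) YV by (intro card_mono finite_nb x(2)) auto
    then have "card (nb X c) \<le> 5" using c(2) by simp
    moreover have "side \<rho> Q' \<inter> X = {}" if Q': "Q' \<in> ?S" "c \<in> star Q'" for Q'
    proof (rule ccontr)
      assume ne: "side \<rho> Q' \<inter> X \<noteq> {}"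
      have "side \<rho> Q' \<subseteq> ?D - {c}"
        using side_nested[OF sp _ mv _ B3 rho, of Q' c] Q' c(1) by auto
      then have "side \<rho> Q' \<inter> X \<subset> ?D \<inter> X" using c(1) by auto
      then have "card (side \<rho> Q' \<inter> X) < card (?D \<inter> X)" using finX by (intro psubset_card_mono) auto
      then show False using mn[OF Q'(1) ne] by simp
    qed
    ultimately have "P c X" by (auto simp: P_def)
    then show ?thesis using c(1) by blast
  qed
  then obtain f :: "'a \<Rightarrow> nat" where f: "inj_on f B" "\<forall>v\<in>B. P v {u \<in> B. f u \<le> f v}"
    using elimination_order[OF finB, of P] by blast
  have "card {u \<in> nb B a. f u < f a} \<le> 5" if a: "a \<in> B" for a
    using card_earlier_le[of a f] f(2) a by (auto simp: P_def)
  moreover have "f a < f d"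
    if "special Q" "movable \<rho> Q" "a \<in> star Q" "d \<in> side \<rho> Q \<inter> B" for Q a d
  proof -
    have "a \<in> B" using that(3) star_subset(1)[of Q] nbB_subset(1)[of Q] by auto
    then have "side \<rho> Q \<inter> {u \<in> B. f u \<le> f a} = {}" using f(2) that by (auto simp: P_def)
    then show ?thesis using that(4) by force
  qed
  ultimately show ?thesis using f(1) by blast
qed

lemma list_piece:
  assumes "Q \<in> \<Q>" "\<And>v. v \<in> V - B \<Longrightarrow> finite (L v) \<and> card (L v) = card (nb V v)" "inj_on f B"
  shows "list_piece V adj B Q L f"
  using assms(2,3) piece[OF assms(1)] B(1) by unfold_locales auto

lemma saves_star:
  assumes Q: "Q \<in> \<Q>" and L: "\<And>v. v \<in> V - B \<Longrightarrow> finite (L v) \<and> card (L v) = card (nb V v)"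
    and f: "inj_on f B" and A: "A \<subseteq> star Q" "card A \<le> 3" "a \<in> A"
    and top: "\<And>t. t \<in> star Q \<Longrightarrow> f a \<le> f t \<Longrightarrow> t \<in> A"
  shows "saves L B f Q a"
proof -
  interpret Q: list_piece V adj B Q L f by (rule list_piece[OF Q L f])
  obtain U x0 where U: "is_end Q U" "x0 \<in> U" "adj x0 a" "a \<in> B"
    using A by (auto simp: star_def nbB_def)
  show ?thesis
  proof (rule Q.saves_end[OF clique_card_le_4 no_K33_verts U(1,2)])
    show "a \<in> nb B x0" using U by (simp add: nb_def)
    show "finite A" using A(1) star_subset(2) finite_subset by blast
    show "later B f a x \<subseteq> A" if "x \<in> U" for x
    proof
      fix b assume b: "b \<in> later B f a x"
      then have "b \<in> star Q" using U(1) that by (auto simp: later_def nb_def star_def nbB_def)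
      then show "b \<in> A" using top b by (auto simp: later_def)
    qed
  qed (use A in auto)
qed

text \<open>In the second alternative no other piece has \<open>b\<close> as a neighbour, so \<open>b\<close> is free to save \<open>Q\<close>.\<close>
lemma savers_exist:
  assumes B3: "3 \<le> card B" and rho: "\<rho> \<in> V - B"
    and L: "\<And>v. v \<in> V - B \<Longrightarrow> finite (L v) \<and> card (L v) = card (nb V v)"
    and f: "inj_on f B"
    and ord: "\<And>Q a d. special Q \<Longrightarrow> movable \<rho> Q \<Longrightarrow> a \<in> star Q \<Longrightarrow> d \<in> side \<rho> Q \<inter> B \<Longrightarrow> f a < f d"
    and Q: "Q \<in> \<Q>"
  shows "\<exists>A. A \<subseteq> nbB Q \<and> (\<forall>a\<in>A. saves L B f Q a) \<and>
    (card A = 3 \<or> (\<exists>b. A = {b} \<and> nb V b \<subseteq> Q \<union> B))"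
proof -
  interpret Q: list_piece V adj B Q L f by (rule list_piece[OF Q L f])
  have stB: "star Q \<subseteq> B" using star_subset(1)[of Q] nbB_subset(1)[of Q] by auto
  show ?thesis
  proof (cases "special Q")
    case False
    then have c3: "3 \<le> card (star Q)" using Q by (simp add: special_def)
    have "inj_on f (star Q)" using f stB by (rule inj_on_subset)
    then obtain A where A: "A \<subseteq> star Q" "card A = 3" "\<forall>a\<in>A. \<forall>t\<in>star Q. f a \<le> f t \<longrightarrow> t \<in> A"
      using top_subset[OF star_subset(2) _ c3] by blast
    have "saves L B f Q a" if "a \<in> A" for a
      by (rule saves_star[OF Q L f A(1)]) (use A that in auto)
    then show ?thesis using A(1,2) star_subset(1)[of Q] by (intro exI[of _ A]) auto
  next
    case sp: True
    obtain a b where ab: "star Q = {a, b}" "a \<noteq> b"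
      and "\<And>D. D \<in> sides Q \<Longrightarrow> touch D {a} \<Longrightarrow> touch D {b} \<Longrightarrow> False"
      using special_structure[OF sp B3] by blast
    have sv: "saves L B f Q x" if "x \<in> star Q" for x
      by (rule saves_star[OF Q L f order_refl]) (use that ab in auto)
    show ?thesis
    proof (cases "movable \<rho> Q")
      case False
      obtain x where "x \<in> star Q" "nb V x \<subseteq> Q \<union> star Q" using not_movable[OF sp B3 False] by blast
      then show ?thesis using sv star_subset(1)[of Q] stB by (intro exI[of _ "{x}"]) auto
    next
      case mv: True
      have "finite (nbB Q)" "nbB Q \<noteq> {}" using nbB_subset(2) star_subset(1)[of Q] ab by auto
      then have "Max (f ` nbB Q) \<in> f ` nbB Q" by (intro Max_in) auto
      then obtain c where c: "c \<in> nbB Q" "f c = Max (f ` nbB Q)" by auto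
      have mx: "f t \<le> f c" if "t \<in> nbB Q" for t
        using c(2) that \<open>finite (nbB Q)\<close> by simp
      have st2: "card (star Q) \<le> 2" using sp by (simp add: special_def)
      obtain v d where vd: "v \<in> Q" "d \<in> side \<rho> Q" "d \<in> B" "adj v d"
        using side_meets[OF Q st2 side(1)[OF mv]] by blast
      \<comment> \<open>\<open>d\<close> is a neighbour of \<open>Q\<close> in the chosen side and
        thus later than \<open>a\<close> and \<open>b\<close>; so the last neighbour
        \<open>c\<close> is a third vertex.\<close>
      have "f d \<le> f c" using vd by (intro mx) (auto simp: nbB_def)
      then have "f x < f c" if "x \<in> star Q" for x using ord[OF sp mv that, of d] vd by auto
      then have cs: "c \<noteq> a" "c \<noteq> b" using ab(1) by auto
      have "saves L B f Q c"
      proof (rule Q.saves_last[OF clique_card_le_4])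
        show "c \<in> B" using c(1) nbB_subset(1) by auto
        obtain v where "v \<in> Q" "adj v c" using c(1) by (auto simp: nbB_def)
        then have "v \<in> nb Q c" using adj_sym by (simp add: nb_def)
        then show "nb Q c \<noteq> {}" by blast
        show "f y \<le> f c" if "v \<in> Q" "y \<in> nb B v" for y v
          using that by (intro mx) (auto simp: nbB_def nb_def)
      qed
      then have "\<forall>x\<in>{a, b, c}. saves L B f Q x" using sv ab(1) by auto
      moreover have "card {a, b, c} = 3" using cs ab(2) by auto
      moreover have "{a, b, c} \<subseteq> nbB Q" using c(1) star_subset(1)[of Q] ab(1) by auto
      ultimately show ?thesis by (intro exI[of _ "{a, b, c}"]) simp
    qed
  qed
qed

text \<open>Here three savers per piece are decisive: in
  \<open>3 * card T + 4 \<le> 2 * (card T + card X)\<close>, where \<open>X\<close> is the set of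
  all savers, a factor 2 on the left would let \<open>card T\<close> cancel.\<close>

lemma pieces_bound:
  assumes T: "T \<subseteq> \<Q>" and A: "\<And>Q. Q \<in> T \<Longrightarrow> A Q \<subseteq> nbB Q \<and> card (A Q) = 3"
  shows "card T \<le> 2 * card (\<Union> (A ` T))"
proof (cases "T = {}")
  case False
  let ?X = "\<Union> (A ` T)"
  let ?S = "(\<lambda>x. {x}) ` ?X"
  let ?R = "SIGMA Q:T. (\<lambda>x. {x}) ` A Q"
  have finT: "finite T" by (rule finite_subset[OF T finite_pieces]) auto
  have XB: "?X \<subseteq> B" using A nbB_subset(1) by blast
  have finX: "finite ?X" using XB finB finite_subset by blast
  obtain Q0 where Q0: "Q0 \<in> T" using False by auto
  have "card (A Q0) \<le> card ?X" using Q0 by (intro card_mono[OF finX]) auto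
  then have X3: "3 \<le> card ?X" using A[OF Q0] by simp
  have "card ?R + 4 \<le> 2 * (card T + card ?S)"
  proof (rule parts_bipartite)
    have p: "Q \<subseteq> V - B" "Q \<noteq> {}" "conn Q" if "Q \<in> T" for Q
      using piece(1,3,4)[OF subsetD[OF T that]] by auto
    show "parts (T \<union> ?S)"
      unfolding parts_def
    proof (intro conjI ballI impI)
      show "Y \<subseteq> V" "Y \<noteq> {}" "conn Y" if "Y \<in> T \<union> ?S" for Y
        using that p[of Y] XB B(1) conn_singleton by auto
      fix Y Z assume YZ: "Y \<in> T \<union> ?S" "Z \<in> T \<union> ?S" "Y \<noteq> Z"
      consider "Y \<in> T" "Z \<in> T" | x where "Y \<in> T" "Z = {x}" "x \<in> ?X" | x where "Z \<in> T" "Y = {x}" "x \<in> ?X" |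
        x y where "Y = {x}" "Z = {y}" using YZ(1,2) by auto
      then show "Y \<inter> Z = {}"
      proof cases
        case 1 then show ?thesis using pieces_eq[of Y "V - B" Z] T YZ(3) by blast
      next
        case (2 x)
        have "x \<notin> Y" using p(1)[OF 2(1)] XB 2(3) by blast
        then show ?thesis using 2(2) by simp
      next
        case (3 x)
        have "x \<notin> Z" using p(1)[OF 3(1)] XB 3(3) by blast
        then show ?thesis using 3(2) by simp
      next
        case 4 then show ?thesis using YZ(3) by auto
      qed
    qed
    show "T \<inter> ?S = {}"
    proof (rule ccontr)
      assume "T \<inter> ?S \<noteq> {}"
      then obtain x where "{x} \<in> T" "x \<in> ?X" by blast
      then show False using p(1)[of "{x}"] XB by blast
    qed
    show "3 \<le> card T + card ?S" using X3 by (simp add: card_singletons)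
    fix Y Z assume "(Y, Z) \<in> ?R"
    then obtain x where x: "Y \<in> T" "x \<in> A Y" "Z = {x}" by auto
    moreover have "x \<in> nbB Y" using A[OF x(1)] x(2) by auto
    ultimately show "Y \<in> T \<and> Z \<in> ?S \<and> touch Y Z" by (auto simp: nbB_def touch_def)
  qed
  moreover have "card ?R = 3 * card T"
  proof -
    have "finite (A Q)" if "Q \<in> T" for Q using A[OF that] nbB_subset(2) finite_subset by blast
    then have "card ?R = (\<Sum>Q\<in>T. card ((\<lambda>x. {x}) ` A Q))" by (intro card_SigmaI finT) auto
    also have "\<dots> = (\<Sum>Q\<in>T. 3)" using A by (intro sum.cong) (auto simp: card_singletons)
    finally show ?thesis by simp
  qed
  ultimately show ?thesis by (simp add: card_singletons)
qed simp

theorem lcol_big: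
  fixes L :: "'a \<Rightarrow> 'c set"
  assumes L: "\<And>v. v \<in> V - B \<Longrightarrow> finite (L v) \<and> card (L v) = card (nb V v)"
    and LB: "\<And>v. v \<in> B \<Longrightarrow> finite (L v) \<and> 16 \<le> card (L v)"
  shows "lcol V L"
proof (cases "3 \<le> card B \<and> V - B \<noteq> {}")
  case True
  then have B3: "3 \<le> card B" by simp
  obtain \<rho> where rho: "\<rho> \<in> V - B" using True by auto
  obtain f :: "'a \<Rightarrow> nat" where f: "inj_on f B"
    and early: "\<And>a. a \<in> B \<Longrightarrow> card {u \<in> nb B a. f u < f a} \<le> 5"
    and ord: "\<And>Q a d. special Q \<Longrightarrow> movable \<rho> Q \<Longrightarrow> a \<in> star Q \<Longrightarrow> d \<in> side \<rho> Q \<inter> B \<Longrightarrow> f a < f d"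
    using good_order[OF B3 rho] by blast
  have "\<forall>Q\<in>\<Q>. \<exists>A. A \<subseteq> nbB Q \<and> (\<forall>a\<in>A. saves L B f Q a) \<and>
      (card A = 3 \<or> (\<exists>b. A = {b} \<and> nb V b \<subseteq> Q \<union> B))"
    by (intro ballI savers_exist[OF B3 rho L f ord]) auto
  then obtain A where A0: "\<forall>Q\<in>\<Q>. A Q \<subseteq> nbB Q \<and> (\<forall>a\<in>A Q. saves L B f Q a) \<and>
      (card (A Q) = 3 \<or> (\<exists>b. A Q = {b} \<and> nb V b \<subseteq> Q \<union> B))"
    unfolding bchoice_iff ..
  have A: "Q \<in> \<Q> \<Longrightarrow> A Q \<subseteq> nbB Q" "Q \<in> \<Q> \<Longrightarrow> a \<in> A Q \<Longrightarrow> saves L B f Q a"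
    and A3: "Q \<in> \<Q> \<Longrightarrow> card (A Q) = 3 \<or> (\<exists>b. A Q = {b} \<and> nb V b \<subseteq> Q \<union> B)" for Q a
    using A0 by simp_all
  have finA: "finite (A Q)" if "Q \<in> \<Q>" for Q using A(1)[OF that] nbB_subset(2) finite_subset by blast
  have finQ: "finite \<Q>" by (rule finite_pieces) auto
  have half: "card T \<le> 2 * card (\<Union> (A ` T))" if T: "T \<subseteq> \<Q>" for T
  proof -
    let ?R = "{Q \<in> T. card (A Q) = 3}"
    have finT: "finite T" using T finQ finite_subset by blast
    have "\<exists>b. A Q = {b} \<and> nb V b \<subseteq> Q \<union> B" if "Q \<in> T - ?R" for Q using A3[of Q] that T by blast
    then obtain b where b: "\<And>Q. Q \<in> T - ?R \<Longrightarrow> A Q = {b Q} \<and> nb V (b Q) \<subseteq> Q \<union> B" by metis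
    \<comment> \<open>All neighbours of \<open>b Q\<close> outside \<open>B\<close> lie in
      \<open>Q\<close>, so no other piece can have it as a saver.\<close>
    have only: "Q' = Q" if "Q \<in> T - ?R" "Q' \<in> T" "b Q \<in> A Q'" for Q Q'
    proof -
      have "b Q \<in> nbB Q'" using A(1)[of Q'] that T by blast
      then obtain v where v: "v \<in> Q'" "adj v (b Q)" by (auto simp: nbB_def)
      have pq: "Q' \<in> \<Q>" "Q \<in> \<Q>" using that T by auto
      then have "v \<in> V - B" using piece(1)[OF pq(1)] v(1) by auto
      then have "v \<in> Q" using b[OF that(1)] v(2) adj_sym by (auto simp: nb_def)
      then show ?thesis using pieces_eq[OF pq] v(1) by blast
    qed
    have "inj_on b (T - ?R)"
    proof (rule inj_onI)
      fix x y assume xy: "x \<in> T - ?R" "y \<in> T - ?R" "b x = b y"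
      have "b x \<in> A y" using b[OF xy(2)] xy(3) by simp
      then show "x = y" using only[OF xy(1), of y] xy(2) by blast
    qed
    then have 1: "card (b ` (T - ?R)) = card (T - ?R)" by (rule card_image)
    have 2: "card ?R \<le> 2 * card (\<Union> (A ` ?R))" using A(1) T by (intro pieces_bound) auto
    have dis: "b ` (T - ?R) \<inter> \<Union> (A ` ?R) = {}"
    proof (rule ccontr)
      assume "b ` (T - ?R) \<inter> \<Union> (A ` ?R) \<noteq> {}"
      then obtain Q Q' where "Q \<in> T - ?R" "Q' \<in> ?R" "b Q \<in> A Q'" by blast
      then show False using only[of Q Q'] by blast
    qed
    have finU: "finite (\<Union> (A ` T))" using finT finA T by (intro finite_UN_I) auto
    have "card (b ` (T - ?R)) + card (\<Union> (A ` ?R)) = card (b ` (T - ?R) \<union> \<Union> (A ` ?R))"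
      using dis finT finA T by (intro card_Un_disjoint[symmetric] finite_UN_I finite_imageI) auto
    also have "\<dots> \<le> card (\<Union> (A ` T))" using b by (intro card_mono[OF finU]) blast
    finally have 3: "card (b ` (T - ?R)) + card (\<Union> (A ` ?R)) \<le> card (\<Union> (A ` T))" .
    have "card T = card ?R + card (T - ?R)"
      using card_Diff_subset[of ?R T] card_mono[OF finT, of ?R] finT by simp
    then show ?thesis using 1 2 3 by simp
  qed
  obtain g where g: "\<And>Q. Q \<in> \<Q> \<Longrightarrow> g Q \<in> A Q" "\<And>b. card {Q \<in> \<Q>. g Q = b} \<le> 2"
    by (rule hall_capacity_two[OF finQ finA half]) auto
  show ?thesis
  proof (rule colouring_from_savers[OF B(1) f early LB])
    show "g Q \<in> B \<and> saves L B f Q (g Q)" if "Q \<in> \<Q>" for Q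
    proof
      show "g Q \<in> B" using A(1)[OF that] g(1)[OF that] nbB_subset(1)[of Q] by auto
      show "saves L B f Q (g Q)" by (rule A(2)[OF that g(1)[OF that]])
    qed
  qed (use g(2) in auto)
next
  \<comment> \<open>\<open>B\<close> has at most two vertices or is all of \<open>V\<close>. As
    \<open>V - B\<close> is connected by 3-connectivity, there is at most one piece, and any vertex
    of its star can save it.\<close>
  case False
  have "\<exists>c\<in>X. card (nb X c) \<le> 5" if "X \<subseteq> B" "X \<noteq> {}" for X
  proof -
    obtain a where a: "a \<in> X" using \<open>X \<noteq> {}\<close> by auto
    have "X \<subseteq> V" using that B(1) by auto
    then show ?thesis using low_degree[of X a] a that by (auto simp: insert_absorb)
  qed
  then obtain f :: "'a \<Rightarrow> nat" where f: "inj_on f B" "\<forall>v\<in>B. card (nb {u \<in> B. f u \<le> f v} v) \<le> 5"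
    using elimination_order[OF finB, of "\<lambda>c X. card (nb X c) \<le> 5"] by blast
  have early: "card {u \<in> nb B a. f u < f a} \<le> 5" if "a \<in> B" for a
    using card_earlier_le[of a f] f(2) that by fastforce
  have one: "Q = V - B" if "Q \<in> \<Q>" for Q
  proof -
    have "V - B \<noteq> {}" using piece(1,3)[OF that] by auto
    then have "conn (V - B)" using conn3[OF B(1)] False by auto
    then show ?thesis using that connD by (auto simp: pieces_def)
  qed
  define g where "g Q = (SOME a. a \<in> star Q)" for Q
  have g: "g Q \<in> star Q" if "Q \<in> \<Q>" for Q
    using star_nonempty[OF that] some_in_eq unfolding g_def by blast
  show ?thesis
  proof (rule colouring_from_savers[OF B(1) f(1) early LB])
    fix Q assume Q: "Q \<in> \<Q>"
    have "card B < 3" using one[OF Q] piece(3)[OF Q] False by auto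
    moreover have "star Q \<subseteq> B" using star_subset(1)[of Q] nbB_subset(1)[of Q] by auto
    moreover from this have "card (star Q) \<le> card B" by (rule card_mono[OF finB])
    ultimately show "g Q \<in> B \<and> saves L B f Q (g Q)"
      using g[OF Q] saves_star[OF Q L f(1) order_refl _ g[OF Q]] by auto
  next
    fix a
    have "card {Q \<in> \<Q>. g Q = a} \<le> card {V - B}" using one by (intro card_mono) auto
    then show "card {Q \<in> \<Q>. g Q = a} \<le> 2" by simp
  qed auto
qed

end

section \<open>From digraphs to the combinatorial setting\<close>

lemma (in graph) sgraph_dominates: "sgraph (verts G) (\<lambda>u v. u \<rightarrow>\<^bsub>G\<^esub> v)"
proof
  show "finite (verts G)" by simp
  show "v \<rightarrow>\<^bsub>G\<^esub> u" if "u \<rightarrow>\<^bsub>G\<^esub> v" for u v using arcs_ends_symmetric[OF sym_arcs that] .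
  show "\<not> u \<rightarrow>\<^bsub>G\<^esub> u" for u using no_loops by (auto simp: arcs_ends_conv)
  show "u \<in> verts G" if "u \<rightarrow>\<^bsub>G\<^esub> v" for u v using that by (auto simp: arcs_ends_conv)
qed

lemma (in graph) out_degree_eq: "out_degree G v = card {u \<in> verts G. v \<rightarrow>\<^bsub>G\<^esub> u}"
proof -
  have "head G ` out_arcs G v = {u \<in> verts G. v \<rightarrow>\<^bsub>G\<^esub> u}"
    by (force simp: out_arcs_def arcs_ends_conv)
  moreover have "inj_on (head G) (out_arcs G v)"
    using no_multi_arcs by (auto simp: inj_on_def out_arcs_def arc_to_ends_def)
  ultimately show ?thesis unfolding out_degree_def by (metis card_image)
qed

lemma (in graph) conn_if_connected:
  assumes "Digraph_Component.connected (G \<restriction> W)"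
  shows "sgraph.conn (\<lambda>u v. u \<rightarrow>\<^bsub>G\<^esub> v) W"
proof -
  interpret S: sgraph "verts G" "\<lambda>u v. u \<rightarrow>\<^bsub>G\<^esub> v" by (rule sgraph_dominates)
  let ?H = "with_proj (mk_symmetric (G \<restriction> W))"
  have H: "verts ?H = W" by (simp add: mk_symmetric_def induce_subgraph_def)
  have arc: "x \<rightarrow>\<^bsub>G\<^esub> y \<and> y \<in> W" if "x \<rightarrow>\<^bsub>?H\<^esub> y" for x y
    using that S.adj_sym by (auto simp: mk_symmetric_def induce_subgraph_def arcs_ends_conv)
  show ?thesis
    unfolding S.conn_closed_in
  proof (intro allI impI)
    fix A assume A: "S.closed_in W A" "A \<noteq> {}"
    have AW: "A \<subseteq> W" by (rule S.closed_in_subset[OF A(1)])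
    obtain a where a: "a \<in> A" using A(2) by auto
    have "y \<in> A" if y: "y \<in> W" for y
    proof -
      have "a \<rightarrow>\<^sup>*\<^bsub>?H\<^esub> y"
        using assms a AW y H unfolding Digraph_Component.connected_def strongly_connected_def by auto
      then have "(a, y) \<in> rtrancl_on (verts ?H) (arcs_ends ?H)" by (simp only: reachable_def)
      then show ?thesis
      proof (induction rule: rtrancl_on_induct)
        case base
        show ?case by (rule a)
      next
        case (step x z)
        then show ?case using S.closed_inD[OF A(1), of x z] arc[of x z] by blast
      qed
    qed
    then show "A = W" using AW by auto
  qed
qed

theorem theorem2:
  fixes G :: "('a, 'b) pre_digraph"
  assumes "graph G"
    and "k_connected 3 G"
    and "\<not> complete_graph G"
    and "planar G"
  shows "degree_truncated_choosable TYPE('c) 16 G"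
proof -
  interpret G: graph G by (rule assms(1))
  obtain p \<gamma> where draw: "plane_drawing G p \<gamma>" using assms(4) by (auto simp: planar_def)
  interpret S: sgraph "verts G" "\<lambda>u v. u \<rightarrow>\<^bsub>G\<^esub> v" by (rule G.sgraph_dominates)
  interpret S: three_connected_plane_graph "verts G" "\<lambda>u v. u \<rightarrow>\<^bsub>G\<^esub> v" p \<gamma>
  proof
    show "inj_on p (verts G)" using draw by (simp add: plane_drawing_def)
    show "arc (\<gamma> {u, v})" "{pathstart (\<gamma> {u, v}), pathfinish (\<gamma> {u, v})} = {p u, p v}"
      "path_image (\<gamma> {u, v}) \<inter> p ` verts G = {p u, p v}" if "u \<rightarrow>\<^bsub>G\<^esub> v" for u v
      using draw that unfolding plane_drawing_def by blast+
    show "path_image (\<gamma> {u, v}) \<inter> path_image (\<gamma> {x, y}) \<subseteq> p ` ({u, v} \<inter> {x, y})"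
      if "u \<rightarrow>\<^bsub>G\<^esub> v" "x \<rightarrow>\<^bsub>G\<^esub> y" "{u, v} \<noteq> {x, y}" for u v x y
      using draw that unfolding plane_drawing_def by blast
    show "3 < card (verts G)" using assms(2) by (simp add: k_connected_def)
    show "S.conn (verts G - S)" if "S \<subseteq> verts G" "card S < 3" for S
      using assms(2) that by (intro G.conn_if_connected) (simp add: k_connected_def)
  qed
  have not_clique: "\<not> S.clique (verts G)"
  proof
    assume cl: "S.clique (verts G)"
    have "arcs_ends G = {(u, v). (u, v) \<in> verts G \<times> verts G \<and> u \<noteq> v}"
    proof (intro set_eqI iffI)
      fix z assume z: "z \<in> arcs_ends G"
      obtain u v where "z = (u, v)" by (cases z)
      then show "z \<in> {(u, v). (u, v) \<in> verts G \<times> verts G \<and> u \<noteq> v}"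
        using z S.adj_V S.adj_sym S.adj_irrefl by auto
    next
      fix z assume "z \<in> {(u, v). (u, v) \<in> verts G \<times> verts G \<and> u \<noteq> v}"
      then show "z \<in> arcs_ends G" using cl by (auto simp: S.clique_def)
    qed
    then have "complete_graph G" using assms(1) by (simp add: complete_graph_def complete_digraph_def)
    then show False using assms(3) by simp
  qed
  have deg: "out_degree G v = card (S.nb (verts G) v)" for v
    by (simp add: G.out_degree_eq S.nb_def)
  show ?thesis
    unfolding degree_truncated_choosable_def
  proof (intro allI impI)
    fix L :: "'a \<Rightarrow> 'c set"
    assume L: "\<forall>v\<in>verts G. finite (L v) \<longrightarrow> min 16 (out_degree G v) \<le> card (L v)"
    \<comment> \<open>Lists are cut down to exact size, because \<open>list_piece\<close> wants
      lists in a piece to be as large as the degree; infinite lists are thereby covered as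
      well.\<close>
    have "\<exists>M\<subseteq>L v. finite M \<and> card M = min 16 (out_degree G v)" if "v \<in> verts G" for v
    proof (cases "finite (L v)")
      case True
      then show ?thesis using L that obtain_subset_with_card_n[of "min 16 (out_degree G v)" "L v"] by metis
    next
      case False
      then show ?thesis using infinite_arbitrarily_large[of "L v" "min 16 (out_degree G v)"] by blast
    qed
    then obtain M where M: "\<And>v. v \<in> verts G \<Longrightarrow> M v \<subseteq> L v \<and> finite (M v) \<and> card (M v) = min 16 (out_degree G v)"
      by metis
    define B where "B = {v \<in> verts G. 16 \<le> out_degree G v}"
    have MB: "finite (M v) \<and> card (M v) = card (S.nb (verts G) v)" if "v \<in> verts G - B" for v
      using M[of v] that deg by (auto simp: B_def)
    have "S.lcol (verts G) M"
    proof (cases "B = {}")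
      case True
      then have "S.tight (verts G) M" using MB by (auto simp: S.tight_def)
      then show ?thesis using not_clique by (rule S.lcol_no_big)
    next
      case False
      interpret T: big_vertices "verts G" "\<lambda>u v. u \<rightarrow>\<^bsub>G\<^esub> v" p \<gamma> B
        by unfold_locales (use False in \<open>auto simp: B_def\<close>)
      show ?thesis
        by (rule T.lcol_big[OF MB]) (use M in \<open>auto simp: B_def\<close>)
    qed
    then have "S.lcol (verts G) L" using M by (intro S.lcol_mono[of _ M L]) auto
    then obtain \<phi> where \<phi>: "\<forall>v\<in>verts G. \<phi> v \<in> L v"
      "\<forall>u\<in>verts G. \<forall>v\<in>verts G. u \<rightarrow>\<^bsub>G\<^esub> v \<longrightarrow> \<phi> u \<noteq> \<phi> v" unfolding S.lcol_def by blast
    have "list_colouring G L \<phi>"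
      unfolding list_colouring_def using \<phi> S.adj_V S.adj_sym by blast
    then show "list_colourable G L" by (auto simp: list_colourable_def)
  qed
qed

end
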